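(* Let $\{(\widetilde\lambda_n,\widetilde\phi_n)\}_{n\in\mathbb N}$ and $\{(\widetilde\mu_n,\widetilde\psi_n)\}_{n\in\mathbb N}$ be as described in the context. Define $\phi_n(r)=\widetilde\phi_n(t)$, $\psi_n(r)=\widetilde\psi_n(t)$ with $t=\delta^{-1}\ln(r/r_1)$, and set $\lambda_n=\delta^{-2}\widetilde\lambda_n$, $\mu_n=\delta^{-2}\widetilde\mu_n$. Then: (i) The pairs $\{(\lambda_n,\phi_n)\}_{n}$ are eigenvalue--root vector pairs of the eigenvalue problem $-(r\phi')'-\omega^2r\mathfrak n\phi-r^{-1}\lambda\phi=0$ on $(r_1,r_2)$, $\phi'(r_1)=0$, $\phi'(r_2)+i\omega\varsigma\phi(r_2)=0$, i.e., of the operator $T$. (ii) The pairs $\{(\mu_n,\psi_n)\}_n$ are eigenpairs of the self-adjoint problem $\mu(\phi,\xi)_{r^{-1}}=(\phi',\xi')_r+\delta^{-2}(\phi,\xi)_{r^{-1}}$ for all $\xi\in H^1(r_1,r_2)$. In particular, the eigenfunctions $\psi_n$, $n\in\mathbb N$, are real-valued and $\{\psi_n/\|\psi_n\|_{r^{-1}}\}_n$ is an orthonormal basis of $(L^2(r_1,r_2),(\cdot,\cdot)_{r^{-1}})$ and an orthogonal basis of $(H^1(r_1,r_2),(\cdot,\cdot)_{H^1,r})$. (iii) There exists $n_0>0$ such that $\lambda_n$ is simple for all $n>n_0$. (iv) $\{\phi_n/\|\phi_n\|_{r^{-1}}\}_n$ forms a Bari basis of $(L^2(r_1,r_2),(\cdot,\cdot)_{r^{-1}})$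 and in particular $\sum_{n=1}^\infty\big\|\psi_n/\|\psi_n\|_{r^{-1}}-\phi_n/\|\phi_n\|_{r^{-1}}\big\|_{r^{-1}}^2<\infty$. (v) $\{\phi_n/\|\phi_n\|_{H^1,r}\}_n$ forms a Bari basis of $(H^1(r_1,r_2),(\cdot,\cdot)_{H^1,r})$ and in particular $\sum_{n=1}^\infty\big\|\psi_n/\|\psi_n\|_{H^1,r}-\phi_n/\|\phi_n\|_{H^1,r}\big\|_{H^1,r}^2<\infty$. (vi) $\sqrt{|\lambda_n|}\sim n$ and $\|\phi_n\|_{H^1(r_1,r_2)}\sim\sqrt{|\lambda_n|}\,\|\phi_n\|_{L^2(r_1,r_2)}$ with implied constants independent of $n\in\mathbb N$. In particular, $\inf_{n\in\mathbb N}|\lambda_n|>0$. (vii) $\{\phi_n/\|\phi_n\|_{L^2(r_1,r_2)}\}_n$ is a Riesz basis of $L^2(r_1,r_2)$ and $\{\phi_n/\|\phi_n\|_{H^1(r_1,r_2)}\}_n$ is a Riesz basis of $H^1(r_1,r_2)$. (viii) $\lim_{n\to\infty}\lambda_n/\mu_n=1$. (ix) Statements (i)--(viii) also hold for the root vectors $\{\chi_n\}_n$ of the adjoint operator $T^\star$ (with its eigenvalues in place of $\lambda_n$).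
   Context: Data: $0<r_1<r_2<\infty$, $\omega>0$, $\varsigma>0$, $\mathfrak n\in L^\infty(r_1,r_2)$ real-valued, $\delta=\frac1\pi\ln(r_2/r_1)$, $\widetilde{\mathfrak n}(t)=\mathfrak n(r_1e^{\delta t})$ for $t\in(0,\pi)$. Notation: $(u,v)_{r^{\pm1}}=\int_{r_1}^{r_2}r^{\pm1}u\bar v\,dr$, $(u,v)_{H^1,r}=\delta(u',v')_r+\delta^{-1}(u,v)_{r^{-1}}$, with corresponding norms $\|\cdot\|_{r^{-1}}$, $\|\cdot\|_{H^1,r}$. On $(L^2(r_1,r_2),(\cdot,\cdot)_{r^{-1}})$: $T\phi=-r(r\phi')'-\omega^2\mathfrak nr^2\phi$, $D(T)=\{\phi\in H^2(r_1,r_2):\phi'(r_1)=0,\ \phi'(r_2)+i\omega\varsigma\phi(r_2)=0\}$; its adjoint $T^\star$ has the same differential expression with $D(T^\star)=\{\phi\in H^2(r_1,r_2):\phi'(r_1)=0,\ \phi'(r_2)-i\omega\varsigma\phi(r_2)=0\}$. Root vectors: $\{\phi_n\}_{n\in\mathbb N}$ are root vectors (generalized eigenvectors) of an operator $A$, with eigenvalues $\{\lambda_n\}_{n\in\mathbb N}$, if $\sigma(A)$ consists of countably many eigenvalues of finite algebraic multiplicity, $\{\lambda_n\}=\sigma(A)$ is enumerated respecting algebraic multiplicity, for each $m$ the set $\{\phi_n:\lambda_n=\lambda_m\}$ is a basis of the root space of $\lambda_m$, and for each $n$ either $\phi_{n+1}$ is an eigenvector or it is a subsequent element of a Jordan chain,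 i.e., $(A-\lambda_{n+1})\phi_{n+1}=\phi_n$. The $(\lambda_n,\phi_n)$ are then called eigenvalue--root vector pairs of $A$; they are called normalized if in addition all eigenvectors among the $\phi_n$ are normalized. Given pairs: $\widetilde\mu_1=1$, $\widetilde\psi_1=\sqrt{1/\pi}$, $\widetilde\mu_n=(n-1)^2+1$, $\widetilde\psi_n(t)=\sqrt{2/\pi}\cos((n-1)t)$ for $n\ge2$; these are the $L^2(0,\pi)$-normalized eigenpairs of $(\psi',\xi')_{L^2(0,\pi)}+(\psi,\xi)_{L^2(0,\pi)}=\mu(\psi,\xi)_{L^2(0,\pi)}$ for all $\xi\in H^1(0,\pi)$. $\{(\widetilde\lambda_n,\widetilde\phi_n)\}$ are $L^2(0,\pi)$-normalized eigenvalue--root vector pairs of $\widetilde T\phi=-\phi''-\omega^2r_1^2\delta^2e^{2\delta t}\widetilde{\mathfrak n}\phi$ on $L^2(0,\pi)$, $D(\widetilde T)=\{\phi\in H^2(0,\pi):\phi'(0)=0,\ \phi'(\pi)+i\omega\varsigma\delta r_2\phi(\pi)=0\}$, chosen such that $\widetilde\lambda_n$ is simple for all large $n$, $\{\widetilde\phi_n\}$ is a Bari basis of $L^2(0,\pi)$ with $\sum_n\|\widetilde\psi_n-\widetilde\phi_n\|_{L^2(0,\pi)}^2<\infty$, $\{\widetilde\mu_n^{-1/2}\widetilde\phi_n\}$ is a Bari basis of $H^1(0,\pi)$ with $\sum_n\|\widetilde\mu_n^{-1/2}\widetilde\psi_n-\widetilde\mu_n^{-1/2}\widetilde\phi_n\|_{H^1(0,\pi)}^2<\infty$,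 $|\widetilde\lambda_n|^{1/2}/\widetilde\mu_n^{1/2}\to1$ and $|\widetilde\lambda_n|^{1/2}/\|\widetilde\phi_n\|_{H^1(0,\pi)}\to1$, $\{\widetilde\phi_n/\|\widetilde\phi_n\|_{H^1(0,\pi)}\}$ is quadratically close to $\{\widetilde\psi_n/\widetilde\mu_n^{1/2}\}$ in $H^1(0,\pi)$, and $\widetilde\lambda_n/\widetilde\mu_n\to1$ (such a choice exists). Sequences $(x_n),(y_n)$ are quadratically close if $\sum_n\|x_n-y_n\|^2<\infty$; a Bari basis is a (Riesz) basis quadratically close to an orthonormal basis. $a_n\sim b_n$ means $c\,b_n\le a_n\le C\,b_n$ with $c,C>0$ independent of $n$.
   Formalization: In (i), also within (ix), the Jordan chain relation for φ_n holds with factor δ^{-2} instead of 1, since T corresponds to δ^{-2} times T-tilde; factor 1 is recovered after rescaling the non-eigenvector root vectors by positive numbers. Without Jordan chains, or if δ=1, (i) is literal. *)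

theory Defs
  imports "HOL-Analysis.Analysis"
begin

section \<open>Hilbert spaces of functions, given by representatives\<close>

text \<open>
  An element of \<open>L\<^sup>2(a,b)\<close> or of a Sobolev space is given by a representative
  \<open>real \<Rightarrow> complex\<close>; two representatives are the same element iff their difference has norm
  zero, so identities between elements are stated as vanishing norms or almost everywhere.
  A (generally unbounded) operator is given by its graph, a set of pairs of representatives that is
  closed under changing representatives.
\<close>

type_synonym cfun = "real \<Rightarrow> complex"

record hspace =
  elems :: "cfun set"
  ip :: "cfun \<Rightarrow> cfun \<Rightarrow> complex"

definition hnorm :: "hspace \<Rightarrow> cfun \<Rightarrow> real" where
  "hnorm H u = sqrt (Re (ip H u u))"

subsection \<open>Bases\<close>

definition total_seq :: "hspace \<Rightarrow> (nat \<Rightarrow> cfun) \<Rightarrow> bool" where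
  "total_seq H x \<longleftrightarrow> (\<forall>u\<in>elems H. \<forall>\<epsilon>>0. \<exists>N c. hnorm H (\<lambda>t. u t - (\<Sum>n<N. c n * x n t)) < \<epsilon>)"

definition orthonormal_basis :: "hspace \<Rightarrow> (nat \<Rightarrow> cfun) \<Rightarrow> bool" where
  "orthonormal_basis H e \<longleftrightarrow>
     (\<forall>n. e n \<in> elems H) \<and> (\<forall>m n. ip H (e m) (e n) = (if m = n then 1 else 0)) \<and> total_seq H e"

definition orthogonal_basis :: "hspace \<Rightarrow> (nat \<Rightarrow> cfun) \<Rightarrow> bool" where
  "orthogonal_basis H e \<longleftrightarrow>
     (\<forall>n. e n \<in> elems H \<and> hnorm H (e n) \<noteq> 0) \<and>
     (\<forall>m n. m \<noteq> n \<longrightarrow> ip H (e m) (e n) = 0) \<and> total_seq H e"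

text \<open>A Riesz basis is a total Riesz sequence.\<close>

definition riesz_basis :: "hspace \<Rightarrow> (nat \<Rightarrow> cfun) \<Rightarrow> bool" where
  "riesz_basis H x \<longleftrightarrow>
     (\<forall>n. x n \<in> elems H) \<and> total_seq H x \<and>
     (\<exists>c C. 0 < c \<and> 0 < C \<and>
        (\<forall>N a. c * (\<Sum>n<N. (cmod (a n))\<^sup>2) \<le> (hnorm H (\<lambda>t. \<Sum>n<N. a n * x n t))\<^sup>2 \<and>
               (hnorm H (\<lambda>t. \<Sum>n<N. a n * x n t))\<^sup>2 \<le> C * (\<Sum>n<N. (cmod (a n))\<^sup>2)))"

definition quadratically_close :: "hspace \<Rightarrow> (nat \<Rightarrow> cfun) \<Rightarrow> (nat \<Rightarrow> cfun) \<Rightarrow> bool" where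
  "quadratically_close H x y \<longleftrightarrow> summable (\<lambda>n. (hnorm H (\<lambda>t. x n t - y n t))\<^sup>2)"

definition bari_basis :: "hspace \<Rightarrow> (nat \<Rightarrow> cfun) \<Rightarrow> bool" where
  "bari_basis H x \<longleftrightarrow>
     riesz_basis H x \<and> (\<exists>e. orthonormal_basis H e \<and> quadratically_close H x e)"

definition normalize_seq :: "hspace \<Rightarrow> (nat \<Rightarrow> cfun) \<Rightarrow> nat \<Rightarrow> cfun" where
  "normalize_seq H x n = (\<lambda>t. x n t / of_real (hnorm H (x n)))"

subsection \<open>Operators, spectrum and root vectors\<close>

type_synonym oper = "(cfun \<times> cfun) set"

definition adjoint_op :: "hspace \<Rightarrow> oper \<Rightarrow> oper" where
  "adjoint_op H A =
     {(v, w). v \<in> elems H \<and> w \<in> elems H \<and> (\<forall>(u, f)\<in>A. ip H f v = ip H u w)}"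

text \<open>Bijectivity of \<open>A - z\<close> (up to null functions) with bounded inverse; the norm estimate
  contains injectivity.\<close>

definition resolvent_set :: "hspace \<Rightarrow> oper \<Rightarrow> complex set" where
  "resolvent_set H A =
     {z. (\<forall>g\<in>elems H. \<exists>u. (u, \<lambda>t. z * u t + g t) \<in> A) \<and>
         (\<exists>C. \<forall>(u, f)\<in>A. hnorm H u \<le> C * hnorm H (\<lambda>t. f t - z * u t))}"

definition spectrum :: "hspace \<Rightarrow> oper \<Rightarrow> complex set" where
  "spectrum H A = - resolvent_set H A"

definition eigenvector :: "hspace \<Rightarrow> oper \<Rightarrow> complex \<Rightarrow> cfun \<Rightarrow> bool" where
  "eigenvector H A z u \<longleftrightarrow> hnorm H u \<noteq> 0 \<and> (u, \<lambda>t. z * u t) \<in> A"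

definition shift_op :: "oper \<Rightarrow> complex \<Rightarrow> oper" where
  "shift_op A z = {(u, \<lambda>t. f t - z * u t) | u f. (u, f) \<in> A}"

definition root_space :: "hspace \<Rightarrow> oper \<Rightarrow> complex \<Rightarrow> cfun set" where
  "root_space H A z = {u. \<exists>k w. (u, w) \<in> shift_op A z ^^ k \<and> w \<in> elems H \<and> hnorm H w = 0}"

definition finite_basis :: "hspace \<Rightarrow> cfun set \<Rightarrow> nat set \<Rightarrow> (nat \<Rightarrow> cfun) \<Rightarrow> bool" where
  "finite_basis H S I x \<longleftrightarrow>
     finite I \<and> (\<forall>n\<in>I. x n \<in> S) \<and>
     (\<forall>c. hnorm H (\<lambda>t. \<Sum>n\<in>I. c n * x n t) = 0 \<longrightarrow> (\<forall>n\<in>I. c n = 0)) \<and>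
     (\<forall>u\<in>S. \<exists>c. hnorm H (\<lambda>t. u t - (\<Sum>n\<in>I. c n * x n t)) = 0)"

definition has_alg_mult :: "hspace \<Rightarrow> oper \<Rightarrow> complex \<Rightarrow> nat \<Rightarrow> bool" where
  "has_alg_mult H A z m \<longleftrightarrow> (\<exists>x. finite_basis H (root_space H A z) {..<m} x)"

definition simple_eigenvalue :: "hspace \<Rightarrow> oper \<Rightarrow> complex \<Rightarrow> bool" where
  "simple_eigenvalue H A z \<longleftrightarrow> (\<exists>u. eigenvector H A z u) \<and> has_alg_mult H A z 1"

text \<open>
  Sequences indexed by 1, 2, 3, ... in the mathematics are indexed from 0 throughout.  The
  parameter \<open>\<kappa>\<close> is the factor in the Jordan chain relation
  \<open>(A - \<lambda>\<^bsub>n+1\<^esub>) \<phi>\<^bsub>n+1\<^esub> = \<kappa> \<phi>\<^bsub>n\<^esub>\<close>.  Root vectors in the usual sense have \<open>\<kappa> = 1\<close>;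
  other values are needed because passing from \<open>A\<close> to \<open>s A\<close> multiplies \<open>\<kappa>\<close> by \<open>s\<close>.
\<close>

definition root_pairs_factor ::
    "complex \<Rightarrow> hspace \<Rightarrow> oper \<Rightarrow> (nat \<Rightarrow> complex) \<Rightarrow> (nat \<Rightarrow> cfun) \<Rightarrow> bool" where
  "root_pairs_factor \<kappa> H A lam phi \<longleftrightarrow>
     countable (spectrum H A) \<and>
     (\<forall>z\<in>spectrum H A. (\<exists>u. eigenvector H A z u) \<and> (\<exists>m. has_alg_mult H A z m)) \<and>
     range lam = spectrum H A \<and>
     (\<forall>m. finite {n. lam n = lam m} \<and> has_alg_mult H A (lam m) (card {n. lam n = lam m})) \<and>
     (\<forall>m. finite_basis H (root_space H A (lam m)) {n. lam n = lam m} phi) \<and>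
     (\<forall>n. eigenvector H A (lam (Suc n)) (phi (Suc n)) \<or>
          (phi (Suc n), \<lambda>t. lam (Suc n) * phi (Suc n) t + \<kappa> * phi n t) \<in> A)"

abbreviation root_pairs ::
    "hspace \<Rightarrow> oper \<Rightarrow> (nat \<Rightarrow> complex) \<Rightarrow> (nat \<Rightarrow> cfun) \<Rightarrow> bool" where
  "root_pairs \<equiv> root_pairs_factor 1"

definition normalized_root_pairs ::
    "hspace \<Rightarrow> oper \<Rightarrow> (nat \<Rightarrow> complex) \<Rightarrow> (nat \<Rightarrow> cfun) \<Rightarrow> bool" where
  "normalized_root_pairs H A lam phi \<longleftrightarrow>
     root_pairs H A lam phi \<and>
     (\<forall>n. eigenvector H A (lam n) (phi n) \<longrightarrow> hnorm H (phi n) = 1)"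

section \<open>Lebesgue and Sobolev spaces on an interval\<close>

abbreviation leb :: "real \<Rightarrow> real \<Rightarrow> real measure" where
  "leb a b \<equiv> lebesgue_on {a<..<b}"

definition Linfty :: "real \<Rightarrow> real \<Rightarrow> (real \<Rightarrow> real) set" where
  "Linfty a b = {f. f \<in> borel_measurable (leb a b) \<and> (\<exists>C. AE x in leb a b. \<bar>f x\<bar> \<le> C)}"

definition L2 :: "real \<Rightarrow> real \<Rightarrow> cfun set" where
  "L2 a b = {u. u \<in> borel_measurable (leb a b) \<and> integrable (leb a b) (\<lambda>x. (cmod (u x))\<^sup>2)}"

text \<open>Weak derivatives, tested against \<open>C\<^sup>1\<close> functions with compact support in \<open>(a,b)\<close>.\<close>

definition weak_deriv :: "real \<Rightarrow> real \<Rightarrow> cfun \<Rightarrow> cfun \<Rightarrow> bool" where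
  "weak_deriv a b u g \<longleftrightarrow>
     (\<forall>\<eta> \<eta>' :: real \<Rightarrow> real. \<forall>c d.
        a < c \<and> c < d \<and> d < b \<and> (\<forall>x. (\<eta> has_real_derivative \<eta>' x) (at x)) \<and>
        continuous_on UNIV \<eta>' \<and> (\<forall>x. x \<notin> {c..d} \<longrightarrow> \<eta> x = 0) \<longrightarrow>
        (LINT x|leb a b. u x * of_real (\<eta>' x)) = - (LINT x|leb a b. g x * of_real (\<eta> x)))"

definition H1 :: "real \<Rightarrow> real \<Rightarrow> cfun set" where
  "H1 a b = {u \<in> L2 a b. \<exists>g\<in>L2 a b. weak_deriv a b u g}"

definition wderiv :: "real \<Rightarrow> real \<Rightarrow> cfun \<Rightarrow> cfun" where
  "wderiv a b u = (SOME g. g \<in> L2 a b \<and> weak_deriv a b u g)"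

definition H2 :: "real \<Rightarrow> real \<Rightarrow> cfun set" where
  "H2 a b = {u \<in> H1 a b. wderiv a b u \<in> H1 a b}"

text \<open>The continuous representative on the closed interval, which gives meaning to boundary values
  of functions in \<open>H1\<close>.\<close>

definition crep :: "real \<Rightarrow> real \<Rightarrow> cfun \<Rightarrow> cfun" where
  "crep a b u = (SOME F. continuous_on {a..b} F \<and> (AE x in leb a b. F x = u x))"

definition L2_ip :: "real \<Rightarrow> real \<Rightarrow> (real \<Rightarrow> real) \<Rightarrow> cfun \<Rightarrow> cfun \<Rightarrow> complex" where
  "L2_ip a b w u v = (LINT x|leb a b. of_real (w x) * u x * cnj (v x))"

definition L2_space :: "real \<Rightarrow> real \<Rightarrow> (real \<Rightarrow> real) \<Rightarrow> hspace" where
  "L2_space a b w = \<lparr>elems = L2 a b, ip = L2_ip a b w\<rparr>"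

definition H1_space :: "real \<Rightarrow> real \<Rightarrow> (real \<Rightarrow> real) \<Rightarrow> (real \<Rightarrow> real) \<Rightarrow> hspace" where
  "H1_space a b p q =
     \<lparr>elems = H1 a b,
      ip = (\<lambda>u v. L2_ip a b p (wderiv a b u) (wderiv a b v) + L2_ip a b q u v)\<rparr>"

abbreviation L2_std :: "real \<Rightarrow> real \<Rightarrow> hspace" where
  "L2_std a b \<equiv> L2_space a b (\<lambda>_. 1)"

abbreviation H1_std :: "real \<Rightarrow> real \<Rightarrow> hspace" where
  "H1_std a b \<equiv> H1_space a b (\<lambda>_. 1) (\<lambda>_. 1)"

section \<open>The Sturm--Liouville problems\<close>

definition delta :: "real \<Rightarrow> real \<Rightarrow> real" where
  "delta r1 r2 = ln (r2 / r1) / pi"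

abbreviation L2_rinv :: "real \<Rightarrow> real \<Rightarrow> hspace" where
  "L2_rinv r1 r2 \<equiv> L2_space r1 r2 (\<lambda>r. 1 / r)"

abbreviation H1_r :: "real \<Rightarrow> real \<Rightarrow> hspace" where
  "H1_r r1 r2 \<equiv> H1_space r1 r2 (\<lambda>r. delta r1 r2 * r) (\<lambda>r. 1 / (delta r1 r2 * r))"

definition T_op :: "real \<Rightarrow> real \<Rightarrow> real \<Rightarrow> real \<Rightarrow> (real \<Rightarrow> real) \<Rightarrow> oper" where
  "T_op r1 r2 \<omega> \<sigma> nn =
     {(u, f). u \<in> H2 r1 r2 \<and> f \<in> L2 r1 r2 \<and>
        crep r1 r2 (wderiv r1 r2 u) r1 = 0 \<and>
        crep r1 r2 (wderiv r1 r2 u) r2 + \<i> * of_real \<omega> * of_real \<sigma> * crep r1 r2 u r2 = 0 \<and>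
        (AE r in leb r1 r2.
           f r = - of_real r * wderiv r1 r2 (\<lambda>s. of_real s * wderiv r1 r2 u s) r
                 - of_real (\<omega>\<^sup>2 * nn r * r\<^sup>2) * u r)}"

definition T_tilde :: "real \<Rightarrow> real \<Rightarrow> real \<Rightarrow> real \<Rightarrow> (real \<Rightarrow> real) \<Rightarrow> oper" where
  "T_tilde r1 r2 \<omega> \<sigma> nn =
     (let \<delta> = delta r1 r2; nt = (\<lambda>t. nn (r1 * exp (\<delta> * t))) in
      {(u, f). u \<in> H2 0 pi \<and> f \<in> L2 0 pi \<and>
        crep 0 pi (wderiv 0 pi u) 0 = 0 \<and>
        crep 0 pi (wderiv 0 pi u) pi
          + \<i> * of_real \<omega> * of_real \<sigma> * of_real (\<delta> * r2) * crep 0 pi u pi = 0 \<and>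
        (AE t in leb 0 pi.
           f t = - wderiv 0 pi (wderiv 0 pi u) t
                 - of_real (\<omega>\<^sup>2 * r1\<^sup>2 * \<delta>\<^sup>2 * exp (2 * \<delta> * t) * nt t) * u t)})"

definition mu_tilde :: "nat \<Rightarrow> real" where
  "mu_tilde n = (real n)\<^sup>2 + 1"

definition psi_tilde :: "nat \<Rightarrow> cfun" where
  "psi_tilde n t =
     of_real (if n = 0 then sqrt (1 / pi) else sqrt (2 / pi) * cos (real n * t))"

text \<open>The requirements on the choice of root pairs of an operator on \<open>L\<^sup>2(0,\<pi>)\<close>, which is
  either \<open>T_tilde\<close> or its adjoint.\<close>

definition admissible_pairs :: "oper \<Rightarrow> (nat \<Rightarrow> complex) \<Rightarrow> (nat \<Rightarrow> cfun) \<Rightarrow> bool" where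
  "admissible_pairs A lam phi \<longleftrightarrow>
     normalized_root_pairs (L2_std 0 pi) A lam phi \<and>
     (\<exists>n0. \<forall>n>n0. simple_eigenvalue (L2_std 0 pi) A (lam n)) \<and>
     bari_basis (L2_std 0 pi) phi \<and>
     quadratically_close (L2_std 0 pi) psi_tilde phi \<and>
     bari_basis (H1_std 0 pi) (\<lambda>n t. phi n t / of_real (sqrt (mu_tilde n))) \<and>
     quadratically_close (H1_std 0 pi)
       (\<lambda>n t. psi_tilde n t / of_real (sqrt (mu_tilde n)))
       (\<lambda>n t. phi n t / of_real (sqrt (mu_tilde n))) \<and>
     (\<lambda>n. sqrt (cmod (lam n)) / sqrt (mu_tilde n)) \<longlonglongrightarrow> 1 \<and>
     (\<lambda>n. sqrt (cmod (lam n)) / hnorm (H1_std 0 pi) (phi n)) \<longlonglongrightarrow> 1 \<and>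
     quadratically_close (H1_std 0 pi)
       (normalize_seq (H1_std 0 pi) phi)
       (\<lambda>n t. psi_tilde n t / of_real (sqrt (mu_tilde n))) \<and>
     (\<lambda>n. lam n / of_real (mu_tilde n)) \<longlonglongrightarrow> 1"

definition pull :: "real \<Rightarrow> real \<Rightarrow> cfun \<Rightarrow> cfun" where
  "pull r1 r2 u r = u (ln (r / r1) / delta r1 r2)"

text \<open>The problem \<open>\<mu> (\<phi>,\<xi>)\<^bsub>1/r\<^esub> = (\<phi>',\<xi>')\<^bsub>r\<^esub> + \<delta>\<^sup>-\<^sup>2 (\<phi>,\<xi>)\<^bsub>1/r\<^esub>\<close> for all \<open>\<xi> \<in> H1\<close>.\<close>

definition selfadjoint_eigenpair :: "real \<Rightarrow> real \<Rightarrow> real \<Rightarrow> cfun \<Rightarrow> bool" where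
  "selfadjoint_eigenpair r1 r2 \<mu> u \<longleftrightarrow>
     u \<in> H1 r1 r2 \<and> hnorm (L2_rinv r1 r2) u \<noteq> 0 \<and>
     (\<forall>\<xi>\<in>H1 r1 r2.
        of_real \<mu> * L2_ip r1 r2 (\<lambda>r. 1 / r) u \<xi> =
        L2_ip r1 r2 (\<lambda>r. r) (wderiv r1 r2 u) (wderiv r1 r2 \<xi>)
        + of_real (1 / (delta r1 r2)\<^sup>2) * L2_ip r1 r2 (\<lambda>r. 1 / r) u \<xi>)"

definition asymp_equiv_seq :: "(nat \<Rightarrow> real) \<Rightarrow> (nat \<Rightarrow> real) \<Rightarrow> bool" where
  "asymp_equiv_seq a b \<longleftrightarrow> (\<exists>c C. 0 < c \<and> 0 < C \<and> (\<forall>n. c * b n \<le> a n \<and> a n \<le> C * b n))"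

text \<open>
  The list of properties of a sequence of pairs \<open>(\<lambda>\<^bsub>n\<^esub>, \<phi>\<^bsub>n\<^esub>)\<close> relative to the self-adjoint
  pairs \<open>(\<mu>\<^bsub>n\<^esub>, \<psi>\<^bsub>n\<^esub>)\<close>, for an operator \<open>A\<close> on the space \<open>L2_rinv\<close>, which is either
  \<open>T\<close> or its adjoint.  The first two conjuncts say that the pairs are root pairs of \<open>A\<close>.  Under the
  change of variables the operator picks up the factor \<open>1 / \<delta>\<^sup>2\<close>, hence so does the Jordan chain
  relation; the relation with factor 1 is recovered by rescaling those root vectors that are not
  eigenvectors.  Both forms are stated.
\<close>

definition basis_properties ::
    "real \<Rightarrow> real \<Rightarrow> oper \<Rightarrow> (nat \<Rightarrow> complex) \<Rightarrow> (nat \<Rightarrow> cfun) \<Rightarrow>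
     (nat \<Rightarrow> real) \<Rightarrow> (nat \<Rightarrow> cfun) \<Rightarrow> bool" where
  "basis_properties r1 r2 A lam phi mu psi \<longleftrightarrow>
     root_pairs_factor (of_real (1 / (delta r1 r2)\<^sup>2)) (L2_rinv r1 r2) A lam phi \<and>
     (\<exists>s::nat \<Rightarrow> real.
        (\<forall>n. 0 < s n) \<and>
        (\<forall>n. eigenvector (L2_rinv r1 r2) A (lam n) (phi n) \<longrightarrow> s n = 1) \<and>
        root_pairs (L2_rinv r1 r2) A lam (\<lambda>n r. of_real (s n) * phi n r)) \<and>

     (\<forall>n. selfadjoint_eigenpair r1 r2 (mu n) (psi n)) \<and>
     (\<forall>n. \<forall>r\<in>{r1<..<r2}. psi n r \<in> \<real>) \<and>
     orthonormal_basis (L2_rinv r1 r2) (normalize_seq (L2_rinv r1 r2) psi) \<and>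
     orthogonal_basis (H1_r r1 r2) (normalize_seq (L2_rinv r1 r2) psi) \<and>

     (\<exists>n0>0. \<forall>n>n0. simple_eigenvalue (L2_rinv r1 r2) A (lam n)) \<and>

     bari_basis (L2_rinv r1 r2) (normalize_seq (L2_rinv r1 r2) phi) \<and>
     quadratically_close (L2_rinv r1 r2)
       (normalize_seq (L2_rinv r1 r2) psi) (normalize_seq (L2_rinv r1 r2) phi) \<and>

     bari_basis (H1_r r1 r2) (normalize_seq (H1_r r1 r2) phi) \<and>
     quadratically_close (H1_r r1 r2)
       (normalize_seq (H1_r r1 r2) psi) (normalize_seq (H1_r r1 r2) phi) \<and>

     asymp_equiv_seq (\<lambda>n. sqrt (cmod (lam n))) (\<lambda>n. real (Suc n)) \<and>
     asymp_equiv_seq (\<lambda>n. hnorm (H1_std r1 r2) (phi n))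
       (\<lambda>n. sqrt (cmod (lam n)) * hnorm (L2_std r1 r2) (phi n)) \<and>
     0 < (INF n. cmod (lam n)) \<and>

     riesz_basis (L2_std r1 r2) (normalize_seq (L2_std r1 r2) phi) \<and>
     riesz_basis (H1_std r1 r2) (normalize_seq (H1_std r1 r2) phi) \<and>

     (\<lambda>n. lam n / of_real (mu n)) \<longlonglongrightarrow> 1"

end

theory Submission
  imports Defs
begin

text \<open>
  The substitution \<open>r = r1 exp (\<delta> t)\<close> turns \<open>\<delta>\<^sup>2 T\<close> into the operator \<open>T_tilde\<close> on
  \<open>(0,\<pi>)\<close>; up to the factor \<open>\<delta>\<close> it is an isometry for the weighted \<open>L2\<close> norm, it is an isometry for
  the weighted \<open>H1\<close> norm, and it is an isomorphism for the unweighted norms.  Hence spectra, root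
  vectors, Riesz and Bari bases are carried over, and normalization changes a quadratically close
  sequence by a summable amount.  The self-adjoint problem has the cosines as eigenfunctions, which
  are total by the Stone--Weierstrass theorem.

  Two facts need the operator itself.  Zero is not an eigenvalue: the imaginary part of the
  quadratic form is a boundary term, so an eigenfunction would have vanishing Cauchy data at the
  right end and vanish by Gronwall's inequality.  The adjoint is the complex conjugate of the
  operator: integration by parts shows that the conjugate is contained in the adjoint, and the
  inclusion cannot be strict because the resolvent sets are not empty.  Therefore complex
  conjugation provides admissible pairs of the adjoint.
\<close>

text \<open>Derivatives and boundary values are given by choice (\<open>wderiv\<close>,
  \<open>crep\<close>) and are known only up to null sets. The device against this is to represent a
  Sobolev function as a constant plus an indefinite integral \<open>prim\<close>: this pins down
  both chosen objects, gives integration by parts through Fubini, and is preserved by the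
  substitution.

  The hypotheses on the eigenvalues are limits and control large indices only, whereas the two-sided
  bounds and the positive infimum concern every index. Excluding the eigenvalue zero closes this
  gap.

  The resolvent point needed for the adjoint comes from the countability of the spectrum, which is
  part of the notion of root pairs. It is used through surjectivity: an adjoint pair is compared
  with the solution of the conjugate equation with the same right-hand side; their difference is
  orthogonal to the range of \<open>T_tilde - z\<close>, hence to itself.

  Totality of the cosines in \<open>H1\<close> is more than totality in \<open>L2\<close>, because
  their derivatives are sines. The derivative is approximated by sines and the approximation is
  integrated.\<close>

definition push :: "real \<Rightarrow> real \<Rightarrow> (real \<Rightarrow> 'a) \<Rightarrow> real \<Rightarrow> 'a" where
  "push r1 r2 v t = v (r1 * exp (delta r1 r2 * t))"

section \<open>Lebesgue measure on a bounded open interval\<close>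

lemma integrable_leb_iff:
  fixes f :: "real \<Rightarrow> 'a::euclidean_space"
  shows "integrable (leb a b) f \<longleftrightarrow> f absolutely_integrable_on {a<..<b}"
  by (simp add: integrable_restrict_space set_integrable_def)

lemma integral_leb:
  fixes f :: "real \<Rightarrow> 'a::euclidean_space"
  assumes "integrable (leb a b) f"
  shows "integral\<^sup>L (leb a b) f = integral {a<..<b} f"
  using assms integrable_leb_iff[of a b f]
  by (simp add: integral_restrict_space set_lebesgue_integral_eq_integral(2)[symmetric] set_lebesgue_integral_def)

lemma finite_measure_leb: "finite_measure (leb a b)"
  by (rule finite_measure_lebesgue_on) simp

lemma borel_measurable_leb [measurable (raw)]:
  fixes f :: "real \<Rightarrow> 'a::topological_space"
  shows "f \<in> borel_measurable borel \<Longrightarrow> f \<in> borel_measurable (leb a b)"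
  by (rule measurable_restrict_space1, rule measurable_completion) simp

lemma AE_leb_iff: "(AE x in leb a b. P x) \<longleftrightarrow> negligible {x. a < x \<and> x < b \<and> \<not> P x}"
proof -
  have "(AE x in leb a b. P x) \<longleftrightarrow> (AE x in lebesgue. x \<in> {a<..<b} \<longrightarrow> P x)"
    by (rule AE_restrict_space_iff) simp
  also have "\<dots> \<longleftrightarrow> {x. a < x \<and> x < b \<and> \<not> P x} \<in> null_sets lebesgue"
    by (subst completion.AE_iff_null_sets) (auto simp: Collect_neg_eq[symmetric] intro!: arg_cong[where f="\<lambda>A. A \<in> null_sets lebesgue"])
  finally show ?thesis by (simp add: negligible_iff_null_sets)
qed

lemma AE_leb_I: "(\<And>x. a < x \<Longrightarrow> x < b \<Longrightarrow> P x) \<Longrightarrow> AE x in leb a b. P x"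
  by (rule AE_I2) auto

text \<open>Completeness of Lebesgue measure. The detour through \<open>measurable_on\<close> serves
  because that notion tolerates changes on negligible sets.\<close>

lemma borel_measurable_leb_AE:
  fixes f g :: "real \<Rightarrow> 'a::euclidean_space"
  assumes "f \<in> borel_measurable (leb a b)" and "AE x in leb a b. f x = g x"
  shows "g \<in> borel_measurable (leb a b)"
proof -
  let ?N = "{x. a < x \<and> x < b \<and> f x \<noteq> g x}"
  have "f measurable_on {a<..<b}"
    using assms by (subst measurable_on_iff_borel_measurable) auto
  moreover have "negligible ?N" using assms(2) by (simp add: AE_leb_iff)
  ultimately have "g measurable_on {a<..<b}"
    by (rule measurable_on_spike) auto
  then show ?thesis
    by (subst (asm) measurable_on_iff_borel_measurable) auto
qed

text \<open>Bounded functions are integrable iff they are measurable, so measurability is transported by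
  every change of variables that transports integrability.\<close>

lemma measurable_leb_iff_integrable:
  fixes f :: "real \<Rightarrow> complex"
  shows "f \<in> borel_measurable (leb a b) \<longleftrightarrow> integrable (leb a b) (\<lambda>x. f x / of_real (1 + cmod (f x)))"
    (is "_ \<longleftrightarrow> integrable _ ?h")
proof
  interpret finite_measure "leb a b" by (rule finite_measure_leb)
  have n: "cmod (z / of_real (1 + cmod z)) = cmod z / (1 + cmod z)" for z :: complex
    by (simp only: norm_divide norm_of_real) (simp add: abs_of_nonneg)
  have pos: "1 + cmod z > 0" for z :: complex using norm_ge_zero[of z] by linarith
  { assume [measurable]: "f \<in> borel_measurable (leb a b)"
    show "integrable (leb a b) ?h"
    proof (rule integrable_const_bound[where B=1])
      have "cmod z / (1 + cmod z) \<le> 1" for z :: complex using pos[of z] by simp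
      then show "AE x in leb a b. cmod (?h x) \<le> 1" by (intro AE_I2) (simp only: n)
    qed simp }
  assume "integrable (leb a b) ?h"
  then have [measurable]: "?h \<in> borel_measurable (leb a b)" by simp
  \<comment> \<open>The map \<open>z / (1 + cmod z)\<close> into the unit disc has the inverse
    \<open>w / (1 - cmod w)\<close>, so \<open>f\<close> is recovered measurably from its bounded
    transform.\<close>
  have "z / of_real (1 + cmod z) / of_real (1 - cmod (z / of_real (1 + cmod z))) = z" for z :: complex
  proof -
    have e: "1 - cmod z / (1 + cmod z) = 1 / (1 + cmod z)" using pos[of z] by (simp add: field_simps)
    have "(of_real (1 + cmod z) :: complex) \<noteq> 0" using pos[of z] by (simp only: of_real_eq_0_iff)
    then show ?thesis by (simp only: n e of_real_divide, simp?)
  qed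
  then have "f = (\<lambda>x. ?h x / of_real (1 - cmod (?h x)))" by simp
  also have "\<dots> \<in> borel_measurable (leb a b)" by measurable
  finally show "f \<in> borel_measurable (leb a b)" .
qed

lemma integrable_leb_weight:
  fixes f :: "real \<Rightarrow> complex" and m :: "real \<Rightarrow> real"
  assumes m [measurable]: "m \<in> borel_measurable borel"
    and b: "\<And>x. a < x \<Longrightarrow> x < b \<Longrightarrow> \<bar>m x\<bar> \<le> C" and f: "integrable (leb a b) f"
  shows "integrable (leb a b) (\<lambda>x. of_real (m x) * f x)"
proof (rule Bochner_Integration.integrable_bound)
  show "integrable (leb a b) (\<lambda>x. C * cmod (f x))" using f by simp
  have [measurable]: "f \<in> borel_measurable (leb a b)" using f by simp
  show "(\<lambda>x. of_real (m x) * f x) \<in> borel_measurable (leb a b)"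
    using borel_measurable_leb[OF m] by measurable
  show "AE x in leb a b. norm (of_real (m x) * f x) \<le> norm (C * cmod (f x))"
  proof (rule AE_leb_I)
    fix x assume "a < x" "x < b"
    then have "\<bar>m x\<bar> \<le> \<bar>C\<bar>" using b[of x] by linarith
    then show "norm (of_real (m x) * f x) \<le> norm (C * cmod (f x))"
      by (simp add: norm_mult abs_mult mult_right_mono)
  qed
qed

section \<open>The logarithmic change of variables\<close>

locale annulus =
  fixes r1 r2 :: real
  assumes r1_pos: "0 < r1" and r1_less: "r1 < r2"
begin

abbreviation \<delta> where "\<delta> \<equiv> delta r1 r2"
text \<open>Inverse of the logarithmic variable in \<open>pull\<close>. The constant \<delta> is the
  one for which the parameter interval has length \<open>pi\<close>.\<close>

definition \<rho> where "\<rho> t = r1 * exp (\<delta> * t)"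

lemma delta_pos: "0 < \<delta>"
  using r1_pos r1_less by (simp add: delta_def)

lemma rho_pos: "0 < \<rho> t" using r1_pos by (simp add: \<rho>_def)
lemma rho_0: "\<rho> 0 = r1" by (simp add: \<rho>_def)
lemma rho_pi: "\<rho> pi = r2" using r1_pos r1_less by (simp add: \<rho>_def delta_def)
lemma rho_less: "\<rho> s < \<rho> t \<longleftrightarrow> s < t" using r1_pos delta_pos by (simp add: \<rho>_def)
lemma rho_le: "\<rho> s \<le> \<rho> t \<longleftrightarrow> s \<le> t" using r1_pos delta_pos by (simp add: \<rho>_def)

lemma rho_log: "0 < r \<Longrightarrow> \<rho> (ln (r / r1) / \<delta>) = r"
  using r1_pos delta_pos by (simp add: \<rho>_def)
lemma log_rho: "ln (\<rho> t / r1) / \<delta> = t"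
  using r1_pos delta_pos by (simp add: \<rho>_def)

lemma push_eq: "push r1 r2 v t = v (\<rho> t)" by (simp add: push_def \<rho>_def)

lemma push_pull [simp]: "push r1 r2 (pull r1 r2 u) = u"
  by (rule ext) (simp add: push_eq pull_def log_rho)

lemma rho_mem: "\<rho> t \<in> {r1<..<r2} \<longleftrightarrow> t \<in> {0<..<pi}"
  using rho_less[of 0 t] rho_less[of t pi] by (simp add: rho_0 rho_pi)

lemma rho_mem_cl: "\<rho> t \<in> {r1..r2} \<longleftrightarrow> t \<in> {0..pi}"
  using rho_le[of 0 t] rho_le[of t pi] by (simp add: rho_0 rho_pi)

lemma rho_image: "\<rho> ` {0<..<pi} = {r1<..<r2}"
proof (intro equalityI subsetI)
  fix r assume r: "r \<in> {r1<..<r2}"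
  then have "\<rho> (ln (r / r1) / \<delta>) = r" using r1_pos by (intro rho_log) auto
  then show "r \<in> \<rho> ` {0<..<pi}"
    using r by (intro image_eqI[where x="ln (r / r1) / \<delta>"]) (simp_all only: rho_mem[symmetric])
qed (simp only: image_iff, metis rho_mem)

lemma rho_inj: "inj_on \<rho> S"
  using r1_pos delta_pos by (auto simp: inj_on_def \<rho>_def)

lemma rho_deriv: "(\<rho> has_real_derivative \<delta> * \<rho> t) (at t within S)"
  unfolding \<rho>_def by (auto intro!: derivative_eq_intros)

lemma rho_measurable [measurable]: "\<rho> \<in> borel_measurable borel"
  unfolding \<rho>_def by measurable

lemma continuous_rho: "continuous_on S \<rho>"
  unfolding \<rho>_def by (intro continuous_intros)

lemma rho_bounds: "0 < t \<Longrightarrow> t < pi \<Longrightarrow> r1 \<le> \<rho> t \<and> \<rho> t \<le> r2"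
  using rho_mem[of t] by auto

lemma change_vars:
  fixes f :: "real \<Rightarrow> 'a::euclidean_space"
  shows "(\<lambda>t. (\<delta> * \<rho> t) *\<^sub>R f (\<rho> t)) absolutely_integrable_on {0<..<pi} \<and>
         integral {0<..<pi} (\<lambda>t. (\<delta> * \<rho> t) *\<^sub>R f (\<rho> t)) = b \<longleftrightarrow>
         f absolutely_integrable_on {r1<..<r2} \<and> integral {r1<..<r2} f = b"
proof -
  have "\<bar>\<delta> * \<rho> t\<bar> = \<delta> * \<rho> t" for t using delta_pos rho_pos[of t] by simp
  then show ?thesis
    using has_absolute_integral_change_of_variables_real[of "{0<..<pi}" \<rho> "\<lambda>t. \<delta> * \<rho> t" f b]
    by (simp add: rho_deriv rho_inj rho_image)
qed

lemma integrable_change_vars: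
  fixes f :: "real \<Rightarrow> 'a::euclidean_space"
  shows "integrable (leb r1 r2) f \<longleftrightarrow> integrable (leb 0 pi) (\<lambda>t. (\<delta> * \<rho> t) *\<^sub>R f (\<rho> t))"
  unfolding integrable_leb_iff using change_vars[of f] by blast

text \<open>No integrability is required: integrability transfers in both directions, and a
  nonintegrable function has integral zero by convention on either side.\<close>

lemma integral_change_vars:
  fixes f :: "real \<Rightarrow> 'a::euclidean_space"
  shows "integral\<^sup>L (leb r1 r2) f = integral\<^sup>L (leb 0 pi) (\<lambda>t. (\<delta> * \<rho> t) *\<^sub>R f (\<rho> t))"
proof (cases "integrable (leb r1 r2) f")
  case True
  then show ?thesis
    using change_vars[of f "integral {r1<..<r2} f"] integrable_change_vars[of f]
    by (simp add: integral_leb integrable_leb_iff)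
next
  case False
  then show ?thesis
    using integrable_change_vars[of f] by (simp add: not_integrable_integral_eq)
qed

text \<open>Differentiable maps send negligible sets to negligible sets; this is applied to \<rho>
  in one direction and to its inverse \<open>?\<tau>\<close> in the other.\<close>

lemma AE_change_vars: "(AE r in leb r1 r2. P r) \<longleftrightarrow> (AE t in leb 0 pi. P (\<rho> t))"
proof -
  let ?A = "{r. r1 < r \<and> r < r2 \<and> \<not> P r}" and ?B = "{t. 0 < t \<and> t < pi \<and> \<not> P (\<rho> t)}"
  let ?\<tau> = "\<lambda>r. ln (r / r1) / \<delta>"
  have A: "?A = \<rho> ` ?B"
  proof (intro equalityI subsetI)
    fix r assume r: "r \<in> ?A"
    then obtain t where "t \<in> {0<..<pi}" "r = \<rho> t" using rho_image by (metis (no_types, lifting) greaterThanLessThan_iff imageE mem_Collect_eq)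
    then show "r \<in> \<rho> ` ?B" using r by auto
  next
    fix r assume "r \<in> \<rho> ` ?B"
    then obtain t where t: "0 < t" "t < pi" "\<not> P (\<rho> t)" "r = \<rho> t" by blast
    then show "r \<in> ?A" using rho_mem[of t] by simp
  qed
  have B: "?B = ?\<tau> ` ?A"
    unfolding A image_image by (simp add: log_rho)
  have "negligible ?B \<Longrightarrow> negligible (\<rho> ` ?B)"
    by (rule negligible_differentiable_image_negligible)
       (auto intro!: differentiableI rho_deriv[THEN has_field_derivative_imp_has_derivative] simp: differentiable_on_def)
  moreover have "negligible ?A \<Longrightarrow> negligible (?\<tau> ` ?A)"
  proof (rule negligible_differentiable_image_negligible)
    show "?\<tau> differentiable_on ?A"
      unfolding differentiable_on_def
    proof
      fix r assume "r \<in> ?A"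
      then have "(?\<tau> has_real_derivative 1 / (r * \<delta>)) (at r within ?A)"
        using r1_pos delta_pos by (auto intro!: derivative_eq_intros simp: field_simps)
      then show "?\<tau> differentiable (at r within ?A)"
        by (meson differentiableI has_field_derivative_imp_has_derivative)
    qed
  qed simp_all
  ultimately show ?thesis unfolding AE_leb_iff using A B by metis
qed

text \<open>On the open interval the Jacobian is bounded and bounded away from zero, so it can be
  multiplied in and divided out.\<close>

lemma integrable_rho_weight:
  fixes f :: "real \<Rightarrow> complex"
  shows "integrable (leb 0 pi) (\<lambda>t. (\<delta> * \<rho> t) *\<^sub>R f t) \<longleftrightarrow> integrable (leb 0 pi) f"
proof
  have d: "\<delta> * \<rho> t \<noteq> 0" for t using delta_pos rho_pos[of t] by simp
  { assume f: "integrable (leb 0 pi) f"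
    have "integrable (leb 0 pi) (\<lambda>t. of_real (\<delta> * \<rho> t) * f t)"
    proof (rule integrable_leb_weight[OF _ _ f])
      fix t assume "0 < t" "t < pi"
      then show "\<bar>\<delta> * \<rho> t\<bar> \<le> \<delta> * r2"
        using delta_pos rho_pos[of t] rho_bounds[of t] by (simp add: abs_mult)
    qed simp
    then show "integrable (leb 0 pi) (\<lambda>t. (\<delta> * \<rho> t) *\<^sub>R f t)" by (simp add: scaleR_conv_of_real) }
  { assume f: "integrable (leb 0 pi) (\<lambda>t. (\<delta> * \<rho> t) *\<^sub>R f t)"
    have "integrable (leb 0 pi) (\<lambda>t. of_real (1 / (\<delta> * \<rho> t)) * ((\<delta> * \<rho> t) *\<^sub>R f t))"
    proof (rule integrable_leb_weight[OF _ _ f])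
      fix t assume "0 < t" "t < pi"
      then show "\<bar>1 / (\<delta> * \<rho> t)\<bar> \<le> 1 / (\<delta> * r1)"
        using delta_pos rho_pos[of t] rho_bounds[of t] r1_pos by (simp add: frac_le abs_mult)
    qed simp
    moreover have "of_real (1 / (\<delta> * \<rho> t)) * ((\<delta> * \<rho> t) *\<^sub>R f t) = f t" for t
      using d[of t] by (simp add: scaleR_conv_of_real)
    ultimately show "integrable (leb 0 pi) f" by simp }
qed

lemma integrable_push:
  fixes f :: "real \<Rightarrow> complex"
  shows "integrable (leb 0 pi) (push r1 r2 f) \<longleftrightarrow> integrable (leb r1 r2) f"
  unfolding integrable_change_vars[of f] integrable_rho_weight by (simp add: push_eq[abs_def])

lemma measurable_push:
  fixes f :: "real \<Rightarrow> complex"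
  shows "push r1 r2 f \<in> borel_measurable (leb 0 pi) \<longleftrightarrow> f \<in> borel_measurable (leb r1 r2)"
  unfolding measurable_leb_iff_integrable
  using integrable_push[of "\<lambda>r. f r / of_real (1 + cmod (f r))"] by (simp add: push_eq[abs_def])

lemma L2_push: "push r1 r2 u \<in> L2 0 pi \<longleftrightarrow> u \<in> L2 r1 r2"
proof -
  have "integrable (leb 0 pi) (\<lambda>t. complex_of_real ((cmod (push r1 r2 u t))\<^sup>2)) \<longleftrightarrow>
        integrable (leb r1 r2) (\<lambda>r. complex_of_real ((cmod (u r))\<^sup>2))"
    using integrable_push[of "\<lambda>r. complex_of_real ((cmod (u r))\<^sup>2)"] by (simp add: push_eq[abs_def])
  moreover have "integrable M (\<lambda>t. complex_of_real (g t)) \<longleftrightarrow> integrable M g" for M :: "real measure" and g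
    using complex_of_real_integrable_eq by blast
  ultimately show ?thesis by (simp only: L2_def measurable_push mem_Collect_eq)
qed

lemma L2_ip_push:
  "L2_ip r1 r2 w u v = L2_ip 0 pi (\<lambda>t. \<delta> * \<rho> t * w (\<rho> t)) (push r1 r2 u) (push r1 r2 v)"
  unfolding L2_ip_def
  by (subst integral_change_vars) (simp add: push_eq scaleR_conv_of_real mult_ac)

lemma Linfty_push:
  assumes "f \<in> Linfty r1 r2" shows "push r1 r2 f \<in> Linfty 0 pi"
proof -
  have "(\<lambda>r. complex_of_real (f r)) \<in> borel_measurable (leb r1 r2)"
    using assms by (auto simp: Linfty_def)
  then have "push r1 r2 (\<lambda>r. complex_of_real (f r)) \<in> borel_measurable (leb 0 pi)"
    by (simp only: measurable_push)
  then have "(\<lambda>t. Re (complex_of_real (f (\<rho> t)))) \<in> borel_measurable (leb 0 pi)"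
    unfolding push_eq[abs_def] by measurable
  then show ?thesis using assms by (auto simp: Linfty_def push_eq[abs_def] AE_change_vars)
qed

end

section \<open>Square integrable functions\<close>

lemma L2_measurable: "u \<in> L2 a b \<Longrightarrow> u \<in> borel_measurable (leb a b)"
  by (simp add: L2_def)

lemma L2_integrable_sq: "u \<in> L2 a b \<Longrightarrow> integrable (leb a b) (\<lambda>x. (cmod (u x))\<^sup>2)"
  by (simp add: L2_def)

lemma integrable_leb_const [simp]: "integrable (leb a b) (\<lambda>x. c :: 'a::euclidean_space)"
proof -
  interpret finite_measure "leb a b" by (rule finite_measure_leb)
  show ?thesis by simp
qed

lemma L2_mult_integrable:
  assumes u: "u \<in> L2 a b" and v: "v \<in> L2 a b"
  shows "integrable (leb a b) (\<lambda>x. u x * v x)"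
proof (rule Bochner_Integration.integrable_bound)
  have [measurable]: "u \<in> borel_measurable (leb a b)" "v \<in> borel_measurable (leb a b)"
    using u v by (auto simp: L2_def)
  show "integrable (leb a b) (\<lambda>x. (cmod (u x))\<^sup>2 + (cmod (v x))\<^sup>2)"
    using u v by (simp add: L2_def)
  show "(\<lambda>x. u x * v x) \<in> borel_measurable (leb a b)" by measurable
  have "x * y \<le> x\<^sup>2 + y\<^sup>2" if "0 \<le> x" "0 \<le> y" for x y :: real
  proof -
    have "0 \<le> (x - y)\<^sup>2" "0 \<le> x * y" using that by auto
    then show ?thesis by (simp add: power2_diff)
  qed
  then show "AE x in leb a b. norm (u x * v x) \<le> norm ((cmod (u x))\<^sup>2 + (cmod (v x))\<^sup>2)"
    by (intro AE_I2) (simp add: norm_mult)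
qed

lemma L2_const [simp]: "(\<lambda>x. c) \<in> L2 a b"
  by (simp add: L2_def)

lemma L2_integrable: "u \<in> L2 a b \<Longrightarrow> integrable (leb a b) u"
  using L2_mult_integrable[of u a b "\<lambda>x. 1"] by simp

lemma L2_add:
  assumes u: "u \<in> L2 a b" and v: "v \<in> L2 a b" shows "(\<lambda>x. u x + v x) \<in> L2 a b"
proof -
  have [measurable]: "u \<in> borel_measurable (leb a b)" "v \<in> borel_measurable (leb a b)"
    using u v by (auto simp: L2_def)
  have "integrable (leb a b) (\<lambda>x. (cmod (u x + v x))\<^sup>2)"
  proof (rule Bochner_Integration.integrable_bound)
    show "integrable (leb a b) (\<lambda>x. 2 * (cmod (u x))\<^sup>2 + 2 * (cmod (v x))\<^sup>2)"
      using u v by (simp add: L2_def)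
    show "(\<lambda>x. (cmod (u x + v x))\<^sup>2) \<in> borel_measurable (leb a b)" by measurable
    have "(cmod (x + y))\<^sup>2 \<le> 2 * (cmod x)\<^sup>2 + 2 * (cmod y)\<^sup>2" for x y
    proof -
      have "(cmod (x + y))\<^sup>2 \<le> (cmod x + cmod y)\<^sup>2"
        by (intro power_mono norm_triangle_ineq) simp
      also have "\<dots> \<le> 2 * (cmod x)\<^sup>2 + 2 * (cmod y)\<^sup>2"
        using zero_le_power2[of "cmod x - cmod y"] by (simp add: power2_diff power2_sum)
      finally show ?thesis .
    qed
    then show "AE x in leb a b. norm ((cmod (u x + v x))\<^sup>2) \<le> norm (2 * (cmod (u x))\<^sup>2 + 2 * (cmod (v x))\<^sup>2)"
      by (intro AE_I2) simp
  qed
  then show ?thesis by (simp add: L2_def)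
qed

lemma L2_cmult: "u \<in> L2 a b \<Longrightarrow> (\<lambda>x. c * u x) \<in> L2 a b"
  by (auto simp: L2_def norm_mult power_mult_distrib intro!: borel_measurable_times)

lemma L2_diff: "u \<in> L2 a b \<Longrightarrow> v \<in> L2 a b \<Longrightarrow> (\<lambda>x. u x - v x) \<in> L2 a b"
  using L2_add[of u a b "\<lambda>x. - 1 * v x"] L2_cmult[of v a b "-1"] by simp

lemma L2_cnj: "u \<in> L2 a b \<Longrightarrow> (\<lambda>x. cnj (u x)) \<in> L2 a b"
  using measurable_compose[OF _ borel_measurable_continuous_onI[OF continuous_on_cnj[OF continuous_on_id]]]
  by (auto simp: L2_def)

lemma L2_AE:
  assumes u: "u \<in> L2 a b" and ae: "AE x in leb a b. u x = v x" shows "v \<in> L2 a b"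
proof -
  have [measurable]: "u \<in> borel_measurable (leb a b)" using u by (simp add: L2_def)
  have [measurable]: "v \<in> borel_measurable (leb a b)" using borel_measurable_leb_AE[OF _ ae] u by (simp add: L2_def)
  have "integrable (leb a b) (\<lambda>x. (cmod (v x))\<^sup>2)"
    using L2_integrable_sq[OF u] by (subst integrable_cong_AE) (use ae in \<open>auto elim: AE_mp\<close>)
  then show ?thesis by (simp add: L2_def)
qed

lemma L2_weight:
  assumes m: "m \<in> borel_measurable (leb a b)" and C: "AE x in leb a b. \<bar>m x\<bar> \<le> C"
    and u: "u \<in> L2 a b"
  shows "(\<lambda>x. of_real (m x) * u x) \<in> L2 a b"
proof -
  have [measurable]: "u \<in> borel_measurable (leb a b)" "m \<in> borel_measurable (leb a b)"
    using u m by (auto simp: L2_def)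
  have "integrable (leb a b) (\<lambda>x. (cmod (of_real (m x) * u x))\<^sup>2)"
  proof (rule Bochner_Integration.integrable_bound)
    show "integrable (leb a b) (\<lambda>x. C\<^sup>2 * (cmod (u x))\<^sup>2)" using u by (simp add: L2_def)
    show "(\<lambda>x. (cmod (of_real (m x) * u x))\<^sup>2) \<in> borel_measurable (leb a b)" by measurable
    show "AE x in leb a b. norm ((cmod (of_real (m x) * u x))\<^sup>2) \<le> norm (C\<^sup>2 * (cmod (u x))\<^sup>2)"
      using C
    proof eventually_elim
      case (elim x)
      then have "(m x)\<^sup>2 \<le> C\<^sup>2" by (metis abs_ge_self abs_le_square_iff order_trans)
      then show ?case by (simp add: norm_mult power_mult_distrib mult_right_mono)
    qed
  qed
  then show ?thesis by (simp add: L2_def)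
qed

lemma bounded_L2:
  assumes f: "f \<in> borel_measurable (leb a b)" and B: "\<And>x. a < x \<Longrightarrow> x < b \<Longrightarrow> cmod (f x) \<le> B"
  shows "f \<in> L2 a b"
proof -
  interpret finite_measure "leb a b" by (rule finite_measure_leb)
  have [measurable]: "f \<in> borel_measurable (leb a b)" by fact
  have "integrable (leb a b) (\<lambda>x. (cmod (f x))\<^sup>2)"
    by (rule integrable_const_bound[where B="B\<^sup>2"]) (auto intro!: AE_leb_I power_mono B)
  then show ?thesis using f by (simp add: L2_def)
qed

lemma continuous_on_interval_bounded:
  fixes f :: "real \<Rightarrow> 'a::real_normed_vector"
  assumes "continuous_on {a..b} f"
  obtains B where "\<And>x. a \<le> x \<Longrightarrow> x \<le> b \<Longrightarrow> norm (f x) \<le> B"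
proof -
  have "bounded (f ` {a..b})" by (intro compact_imp_bounded compact_continuous_image assms compact_Icc)
  then obtain B where "\<forall>y\<in>f ` {a..b}. norm y \<le> B" unfolding bounded_iff by blast
  then show ?thesis by (intro that[of B]) auto
qed

lemma continuous_L2:
  assumes F: "continuous_on {a..b} F" shows "F \<in> L2 a b"
proof -
  have "F \<in> borel_measurable (leb a b)"
    by (rule continuous_imp_measurable_on_sets_lebesgue)
       (auto intro: continuous_on_subset[OF F])
  moreover obtain B where "\<And>x. a \<le> x \<Longrightarrow> x \<le> b \<Longrightarrow> cmod (F x) \<le> B"
    using continuous_on_interval_bounded[OF F] by blast
  ultimately show ?thesis by (intro bounded_L2[where B=B]) auto
qed

section \<open>Indefinite integrals\<close>

text \<open>The cut-off sits in the integrand and the domain of integration stays fixed. In this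
  form continuity is dominated convergence, the product formula is Fubini, and the substitution is a
  single use of \<open>integral_change_vars\<close>.\<close>

definition prim :: "real \<Rightarrow> real \<Rightarrow> cfun \<Rightarrow> cfun" where
  "prim a b f x = (LINT s|leb a b. (if s < x then f s else 0))"

lemma integrable_cut:
  fixes f :: cfun
  assumes "integrable (leb a b) f" and [measurable]: "Measurable.pred borel P"
  shows "integrable (leb a b) (\<lambda>s. if P s then f s else 0)"
proof (rule Bochner_Integration.integrable_bound[OF assms(1)])
  have [measurable]: "f \<in> borel_measurable (leb a b)" using assms by simp
  have [measurable]: "Measurable.pred (leb a b) P"
    by (rule measurable_restrict_space1, rule measurable_completion) simp
  show "(\<lambda>s. if P s then f s else 0) \<in> borel_measurable (leb a b)" by measurable
qed (auto intro!: AE_I2)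

lemma prim_add:
  assumes "integrable (leb a b) f" "integrable (leb a b) g"
  shows "prim a b (\<lambda>s. f s + g s) x = prim a b f x + prim a b g x"
  unfolding prim_def
  by (subst Bochner_Integration.integral_add[symmetric])
     (auto intro!: integrable_cut assms Bochner_Integration.integral_cong)

lemma prim_cmult: "prim a b (\<lambda>s. c * f s) x = c * prim a b f x"
proof -
  have "(\<lambda>s. if s < x then c * f s else 0) = (\<lambda>s. c * (if s < x then f s else 0))" by auto
  then show ?thesis by (simp only: prim_def Bochner_Integration.integral_mult_right_zero)
qed

lemma prim_diff:
  assumes "integrable (leb a b) f" "integrable (leb a b) g"
  shows "prim a b (\<lambda>s. f s - g s) x = prim a b f x - prim a b g x"
  using prim_add[of a b f "\<lambda>s. -1 * g s"] prim_cmult[of a b "-1" g] assms by simp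

lemma prim_cnj: "prim a b (\<lambda>s. cnj (f s)) x = cnj (prim a b f x)"
proof -
  have "(\<lambda>s. if s < x then cnj (f s) else 0) = (\<lambda>s. cnj (if s < x then f s else 0))" by auto
  then show ?thesis by (simp only: prim_def Bochner_Integration.integral_cnj)
qed

lemma prim_left: "prim a b f a = 0"
  unfolding prim_def
  by (subst Bochner_Integration.integral_cong[where g="\<lambda>s. 0"]) auto

lemma prim_right: "prim a b f b = (LINT s|leb a b. f s)"
  unfolding prim_def by (rule Bochner_Integration.integral_cong) auto

lemma AE_leb_neq: "AE s in leb a b. s \<noteq> x"
proof -
  have "negligible ({x} :: real set)" by simp
  then have "negligible {s. a < s \<and> s < b \<and> \<not> s \<noteq> x}" by (rule negligible_subset) auto
  then show ?thesis by (simp add: AE_leb_iff)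
qed

lemma continuous_prim:
  assumes f: "integrable (leb a b) f" shows "continuous_on S (prim a b f)"
proof -
  have "isCont (prim a b f) x" for x
  proof (unfold continuous_at_sequentially comp_def prim_def, intro allI impI)
    fix X assume X: "X \<longlonglongrightarrow> x"
    show "(\<lambda>n. LINT s|leb a b. (if s < X n then f s else 0)) \<longlonglongrightarrow> (LINT s|leb a b. (if s < x then f s else 0))"
    proof (rule integral_dominated_convergence[where w="\<lambda>s. cmod (f s)"])
      \<comment> \<open>At \<open>s = x\<close> the cut-off need not converge, but a single point is
        null.\<close>
      show "AE s in leb a b. (\<lambda>n. if s < X n then f s else 0) \<longlonglongrightarrow> (if s < x then f s else 0)"
        using AE_leb_neq[of x a b]
      proof eventually_elim
        case (elim s)
        have "\<forall>\<^sub>F n in sequentially. (if s < X n then f s else 0) = (if s < x then f s else 0)"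
        proof (cases "s < x")
          case True
          have "\<forall>\<^sub>F n in sequentially. s < X n" by (rule order_tendstoD(1)[OF X True])
          then show ?thesis by eventually_elim (use True in simp)
        next
          case False
          then have "x < s" using elim by simp
          then have "\<forall>\<^sub>F n in sequentially. X n < s" by (rule order_tendstoD(2)[OF X])
          then show ?thesis by eventually_elim (use False in simp)
        qed
        then show ?case by (rule tendsto_eventually)
      qed
    qed (use f in \<open>auto intro!: borel_measurable_integrable integrable_cut AE_I2\<close>)
  qed
  then show ?thesis by (simp add: continuous_at_imp_continuous_on)
qed

lemma prim_eq_integral:
  assumes f: "integrable (leb a b) f" and x: "a \<le> x" "x \<le> b"
  shows "prim a b f x = integral {a..x} f"
proof -
  have "prim a b f x = integral {a<..<b} (\<lambda>s. if s < x then f s else 0)"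
    unfolding prim_def by (rule integral_leb, rule integrable_cut) (use f in auto)
  also have "\<dots> = integral UNIV (\<lambda>s. if s \<in> {a<..<b} then (if s < x then f s else 0) else 0)"
    by (rule integral_restrict_UNIV[symmetric])
  also have "\<dots> = integral UNIV (\<lambda>s. if s \<in> {a<..<x} then f s else 0)"
    by (rule arg_cong[where f="integral UNIV"]) (use x in auto)
  also have "\<dots> = integral {a<..<x} f" by (rule integral_restrict_UNIV)
  also have "\<dots> = integral {a..x} f" by (rule integral_open_interval_real[symmetric])
  finally show ?thesis .
qed

text \<open>Integration by parts in the form that Fubini provides: the two terms integrate
  \<open>g x * f s\<close> over the triangles \<open>s < x\<close> and \<open>x < s\<close>, which
  fill the square up to the null diagonal.\<close>

lemma prim_product_integral:
  assumes f: "integrable (leb a b) f" and g: "integrable (leb a b) g"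
  shows "(LINT x|leb a b. prim a b f x * g x) + (LINT x|leb a b. f x * prim a b g x) =
         (LINT x|leb a b. f x) * (LINT x|leb a b. g x)"
proof -
  let ?M = "leb a b"
  interpret fm: finite_measure ?M by (rule finite_measure_leb)
  interpret P: pair_sigma_finite ?M ?M ..
  have fm [measurable]: "f \<in> borel_measurable ?M" "g \<in> borel_measurable ?M" using f g by auto
  have id [measurable]: "(\<lambda>x. x) \<in> borel_measurable ?M" by (rule borel_measurable_leb) simp
  have [measurable]: "fst \<in> borel_measurable (?M \<Otimes>\<^sub>M ?M)" "snd \<in> borel_measurable (?M \<Otimes>\<^sub>M ?M)"
    using measurable_compose[OF measurable_fst id] measurable_compose[OF measurable_snd id] by auto
  have prod: "integrable (?M \<Otimes>\<^sub>M ?M) (\<lambda>p. g (fst p) * f (snd p))"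
  proof (rule P.Fubini_integrable)
    show "integrable ?M (\<lambda>x. LINT y|?M. norm (g (fst (x, y)) * f (snd (x, y))))"
      using g f by (simp add: norm_mult)
    show "AE x in ?M. integrable ?M (\<lambda>y. g (fst (x, y)) * f (snd (x, y)))"
      using f by (auto intro!: AE_I2)
  qed measurable
  have cut: "integrable (?M \<Otimes>\<^sub>M ?M) (\<lambda>p. if Q p then g (fst p) * f (snd p) else 0)"
    if [measurable]: "Measurable.pred (?M \<Otimes>\<^sub>M ?M) Q" for Q
    by (rule Bochner_Integration.integrable_bound[OF prod]) (auto intro!: AE_I2)
  have c1: "integrable (?M \<Otimes>\<^sub>M ?M) (\<lambda>(x, s). if s < x then g x * f s else 0)"
    using cut[of "\<lambda>p. snd p < fst p"] by (simp add: split_beta')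
  have c2: "integrable (?M \<Otimes>\<^sub>M ?M) (\<lambda>(x, s). if x < s then g x * f s else 0)"
    using cut[of "\<lambda>p. fst p < snd p"] by (simp add: split_beta')
  have 1: "(LINT x|?M. prim a b f x * g x) = (LINT x|?M. LINT s|?M. (if s < x then g x * f s else 0))"
  proof (rule Bochner_Integration.integral_cong[OF refl])
    fix x
    show "prim a b f x * g x = (LINT s|?M. (if s < x then g x * f s else 0))"
      using prim_cmult[of a b "g x" f x] by (simp only: prim_def mult.commute[of _ "g x"])
  qed
  have "(LINT s|?M. f s * prim a b g s) = (LINT s|?M. LINT x|?M. (if x < s then g x * f s else 0))"
  proof (rule Bochner_Integration.integral_cong[OF refl])
    fix s
    show "f s * prim a b g s = (LINT x|?M. (if x < s then g x * f s else 0))"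
      using prim_cmult[of a b "f s" g s] by (simp only: prim_def mult.commute[of "f s"])
  qed
  also have "\<dots> = (LINT x|?M. LINT s|?M. (if x < s then g x * f s else 0))"
    by (rule P.Fubini_integral[OF c2])
  finally have 2: "(LINT s|?M. f s * prim a b g s) = \<dots>" .
  have "(LINT x|?M. prim a b f x * g x) + (LINT s|?M. f s * prim a b g s)
      = (LINT x|?M. (LINT s|?M. (if s < x then g x * f s else 0)) + (LINT s|?M. (if x < s then g x * f s else 0)))"
    unfolding 1 2
    by (rule Bochner_Integration.integral_add[symmetric])
       (use P.integrable_fst[OF c1] P.integrable_fst[OF c2] in auto)
  also have "\<dots> = (LINT x|?M. g x * (LINT s|?M. f s))"
  proof (rule Bochner_Integration.integral_cong[OF refl])
    fix x
    have i: "integrable ?M (\<lambda>s. g x * f s)" using f by simp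
    have "(LINT s|?M. (if s < x then g x * f s else 0)) + (LINT s|?M. (if x < s then g x * f s else 0))
        = (LINT s|?M. (if s < x then g x * f s else 0) + (if x < s then g x * f s else 0))"
      by (rule Bochner_Integration.integral_add[symmetric]) (rule integrable_cut[OF i], simp)+
    also have "\<dots> = (LINT s|?M. g x * f s)"
    proof (rule integral_cong_AE)
      show "AE s in ?M. (if s < x then g x * f s else 0) + (if x < s then g x * f s else 0) = g x * f s"
        using AE_leb_neq[of x a b] by eventually_elim auto
    qed (auto intro!: borel_measurable_integrable integrable_cut Bochner_Integration.integrable_add i)
    finally show "(LINT s|?M. (if s < x then g x * f s else 0)) + (LINT s|?M. (if x < s then g x * f s else 0)) = g x * (LINT s|?M. f s)"
      by simp
  qed
  finally show ?thesis by (simp add: mult.commute)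
qed

text \<open>Lebesgue differentiation: outside a null set a value of the function is the limit of its
  averages over short intervals to the right. Those averages are difference quotients of the
  primitive, hence zero.\<close>

lemma prim_zero_imp_AE_zero:
  assumes f: "integrable (leb a b) f" and z: "\<And>x. a < x \<Longrightarrow> x < b \<Longrightarrow> prim a b f x = 0"
  shows "AE x in leb a b. f x = 0"
proof -
  let ?f = "\<lambda>s. if s \<in> {a<..<b} then f s else 0"
  have "f absolutely_integrable_on {a<..<b}" using f by (simp add: integrable_leb_iff)
  moreover have "(\<lambda>x. indicat_real {a<..<b} x *\<^sub>R f x) = ?f" by auto
  ultimately have "?f absolutely_integrable_on UNIV" by (simp add: set_integrable_def)
  then have "?f absolutely_integrable_on cbox c d" for c d :: real
    by (rule set_integrable_subset) auto
  then have int: "?f integrable_on cbox c d" for c d :: real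
    using absolutely_integrable_on_def by blast
  obtain N where N: "negligible N" and *: "\<And>x e. \<lbrakk>x \<notin> N; 0 < e\<rbrakk> \<Longrightarrow>
     \<exists>d>0. \<forall>h. 0 < h \<and> h < d \<longrightarrow> norm (integral (cbox x (x + h *\<^sub>R One)) ?f /\<^sub>R h ^ DIM(real) - ?f x) < e"
    by (rule integrable_ccontinuous_explicit[OF int]) (rule that)
  have "f x = 0" if x: "a < x" "x < b" "x \<notin> N" for x
  proof (rule ccontr)
    assume "f x \<noteq> 0"
    then have n0: "0 < norm (f x)" by simp
    obtain d where d: "d > 0" and d': "\<forall>h. 0 < h \<and> h < d \<longrightarrow>
        norm (integral (cbox x (x + h *\<^sub>R One)) ?f /\<^sub>R h ^ DIM(real) - ?f x) < norm (f x)"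
      using *[OF x(3) n0] by blast
    have h: "norm (integral {x..x + h} ?f /\<^sub>R h - f x) < norm (f x)" if "0 < h" "h < d" for h
      using d'[rule_format, of h] that x by simp
    define h where "h = min (d / 2) ((b - x) / 2)"
    have h0: "0 < h" "h < d" "x + h < b" using d x by (auto simp: h_def min_def field_simps)
    have ax: "integral {a..y} ?f = 0" if "a < y" "y < b" for y
    proof -
      have "integral {a..y} ?f = integral {a<..<y} ?f" by (rule integral_open_interval_real)
      also have "\<dots> = integral {a<..<y} f" by (rule integral_cong) (use that in auto)
      also have "\<dots> = prim a b f y"
        using prim_eq_integral[OF f, of y] that integral_open_interval_real[of a y f] by simp
      finally show ?thesis using z that by simp
    qed
    have "integral {a..x} ?f + integral {x..x+h} ?f = integral {a..x+h} ?f"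
      by (rule Henstock_Kurzweil_Integration.integral_combine) (use x h0 int[of a "x+h"] in auto)
    then have "integral {x..x+h} ?f = 0" using ax[of x] ax[of "x+h"] x h0 by simp
    then show False using h[of h] h0 by simp
  qed
  then have "{x. a < x \<and> x < b \<and> \<not> f x = 0} \<subseteq> N" by auto
  then show ?thesis using N negligible_subset by (auto simp: AE_leb_iff)
qed

section \<open>Weak derivatives\<close>

text \<open>The test functions are trapezoids that increase to the indicator function of \<open>(a,x)\<close>.\<close>

lemma AE_zero_if_orthogonal_Cc:
  fixes v :: cfun
  assumes v: "integrable (leb a b) v"
    and orth: "\<And>(w::real \<Rightarrow> real) c d. a < c \<Longrightarrow> c < d \<Longrightarrow> d < b \<Longrightarrow> continuous_on UNIV w \<Longrightarrow>
      (\<And>x. x \<notin> {c..d} \<Longrightarrow> w x = 0) \<Longrightarrow> (LINT x|leb a b. v x * of_real (w x)) = 0"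
  shows "AE x in leb a b. v x = 0"
proof (rule prim_zero_imp_AE_zero[OF v])
  fix x assume x: "a < x" "x < b"
  \<comment> \<open>The summand 3 keeps each margin below half of the length \<open>x - a\<close>
    even for \<open>n = 0\<close>, so every support interval \<open>{a + e n..x - e n}\<close> is
    nondegenerate.\<close>
  define e where "e n = (x - a) / (real n + 3)" for n
  define w where "w n s = max 0 (min 1 (real n * min (s - (a + e n)) ((x - e n) - s)))" for n s
  have e0: "0 < e n" "2 * e n < x - a" for n
  proof -
    show "0 < e n" using x by (simp add: e_def)
    have "e n \<le> (x - a) / 3" unfolding e_def by (rule divide_left_mono) (use x in auto)
    then show "2 * e n < x - a" using x by simp
  qed
  have w01: "0 \<le> w n s" "w n s \<le> 1" for n s by (auto simp: w_def)
  have cw: "continuous_on UNIV (w n)" for n unfolding w_def by (intro continuous_intros)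
  have wz: "w n s = 0" if "s \<notin> {a + e n..x - e n}" for n s
  proof -
    have "min (s - (a + e n)) ((x - e n) - s) \<le> 0" using that by auto
    then have "real n * min (s - (a + e n)) ((x - e n) - s) \<le> 0" by (simp add: mult_nonneg_nonpos)
    then show ?thesis by (simp add: w_def)
  qed
  have [measurable]: "v \<in> borel_measurable (leb a b)" using v by simp
  have [measurable]: "w n \<in> borel_measurable (leb a b)" for n
    by (rule borel_measurable_leb, rule borel_measurable_continuous_onI[OF cw])
  have "(\<lambda>n. LINT s|leb a b. v s * of_real (w n s)) \<longlonglongrightarrow> (LINT s|leb a b. (if s < x then v s else 0))"
  proof (rule integral_dominated_convergence[where w="\<lambda>s. cmod (v s)"])
    show "AE s in leb a b. (\<lambda>n. v s * of_real (w n s)) \<longlonglongrightarrow> (if s < x then v s else 0)"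
    proof (rule AE_leb_I)
      fix s assume s: "a < s" "s < b"
      have elim: "e \<longlonglongrightarrow> 0" unfolding e_def by real_asymp
      show "(\<lambda>n. v s * of_real (w n s)) \<longlonglongrightarrow> (if s < x then v s else 0)"
      proof (cases "s < x")
        case True
        define \<eta> where "\<eta> = min (s - a) (x - s) / 2"
        have \<eta>: "\<eta> > 0" using True s by (simp add: \<eta>_def)
        have "\<forall>\<^sub>F n in sequentially. e n < \<eta>" using order_tendstoD(2)[OF elim \<eta>] .
        moreover have "\<forall>\<^sub>F n in sequentially. 1 / \<eta> \<le> real n" by real_asymp
        ultimately have "\<forall>\<^sub>F n in sequentially. w n s = 1"
        proof eventually_elim
          case (elim n)
          have "\<eta> \<le> min (s - (a + e n)) ((x - e n) - s)" using elim by (simp add: \<eta>_def min_def field_simps split: if_splits)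
          then have "(1 / \<eta>) * \<eta> \<le> real n * min (s - (a + e n)) ((x - e n) - s)"
            using elim \<eta> by (intro mult_mono) auto
          then show ?case using \<eta> by (simp add: w_def)
        qed
        then have "\<forall>\<^sub>F n in sequentially. v s * of_real (w n s) = v s" by eventually_elim simp
        then show ?thesis using True by (auto intro: tendsto_eventually)
      next
        case False
        then have "w n s = 0" for n using e0(1)[of n] by (intro wz) auto
        then show ?thesis using False by simp
      qed
    qed
    show "AE s in leb a b. norm (v s * of_real (w n s)) \<le> cmod (v s)" for n
      using w01 by (intro AE_I2) (simp add: norm_mult mult_left_le)
  qed (use v in \<open>auto intro!: borel_measurable_integrable integrable_cut\<close>)
  moreover have "(LINT s|leb a b. v s * of_real (w n s)) = 0" for n
    by (rule orth[of "a + e n" "x - e n"]) (use e0[of n] x cw wz in auto)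
  ultimately show "prim a b v x = 0" by (simp add: prim_def LIMSEQ_const_iff)
qed

lemma prim_of_derivative:
  fixes \<eta> \<eta>' :: "real \<Rightarrow> real"
  assumes d: "\<And>x. (\<eta> has_real_derivative \<eta>' x) (at x)" and c: "continuous_on UNIV \<eta>'"
    and x: "a \<le> x" "x \<le> b"
  shows "prim a b (\<lambda>s. of_real (\<eta>' s)) x = of_real (\<eta> x - \<eta> a)"
proof -
  have cc: "continuous_on {a..b} (\<lambda>s. complex_of_real (\<eta>' s))"
    by (intro continuous_intros continuous_on_subset[OF c]) auto
  have "prim a b (\<lambda>s. of_real (\<eta>' s)) x = integral {a..x} (\<lambda>s. of_real (\<eta>' s))"
    by (rule prim_eq_integral[OF L2_integrable[OF continuous_L2[OF cc]] x])
  also have "\<dots> = of_real (\<eta> x) - of_real (\<eta> a)"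
  proof (rule integral_unique, rule fundamental_theorem_of_calculus[OF x(1)])
    fix s
    show "((\<lambda>x. complex_of_real (\<eta> x)) has_vector_derivative of_real (\<eta>' s)) (at s within {a..x})"
      using d[of s] has_vector_derivative_at_within has_real_derivative_iff_has_vector_derivative has_vector_derivative_of_real by blast
  qed
  finally show ?thesis by simp
qed

lemma weak_derivD:
  assumes "weak_deriv a b u g" "a < c" "c < d" "d < b"
    "\<And>x. (\<eta> has_real_derivative \<eta>' x) (at x)" "continuous_on UNIV \<eta>'" "\<And>x. x \<notin> {c..d} \<Longrightarrow> \<eta> x = 0"
  shows "(LINT x|leb a b. u x * of_real (\<eta>' x)) = - (LINT x|leb a b. g x * of_real (\<eta> x))"
  using assms unfolding weak_deriv_def by blast

text \<open>The du Bois-Reymond lemma. Weight functions with integral zero are exactly the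
  derivatives available for testing; a general weight is reduced to one of them by subtracting a
  multiple of a fixed weight \<open>w1\<close> with nonzero integral.\<close>

lemma AE_const_if_weak_deriv_zero:
  assumes u: "integrable (leb a b) u" and w: "weak_deriv a b u (\<lambda>x. 0)" and ab: "a < b"
  shows "\<exists>C. AE x in leb a b. u x = C"
proof -
  have wint: "integrable (leb a b) (\<lambda>x. h x * of_real (w x))"
    if h: "integrable (leb a b) h" and w: "continuous_on UNIV w" for h :: cfun and w :: "real \<Rightarrow> real"
  proof -
    obtain B where "\<And>x. a \<le> x \<Longrightarrow> x \<le> b \<Longrightarrow> norm (w x) \<le> B"
      using continuous_on_interval_bounded[of a b w] continuous_on_subset[OF w] by (metis subset_UNIV)
    then have "integrable (leb a b) (\<lambda>x. of_real (w x) * h x)"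
      by (intro integrable_leb_weight[where C=B] borel_measurable_continuous_onI h w) auto
    then show ?thesis by (simp add: mult.commute)
  qed
  \<comment> \<open>The antiderivative \<open>F\<close> of \<open>w\<close> is constant to the left
    of \<open>c\<close> and to the right of \<open>d\<close>; since \<open>w\<close> has integral
    zero both constants agree, and \<open>F x - F c\<close> is a test function.\<close>
  have int0: "(LINT x|leb a b. u x * of_real (w x)) = 0"
    if cd: "a < c" "c < d" "d < b" and cw: "continuous_on UNIV w" and wz: "\<And>x. x \<notin> {c..d} \<Longrightarrow> w x = 0"
      and w0: "(LINT x|leb a b. complex_of_real (w x)) = 0"
    for w :: "real \<Rightarrow> real" and c d
  proof -
    have "continuous (at x) w" for x using cw by (simp add: continuous_on_eq_continuous_at)
    then obtain F where F: "\<And>x. (F has_vector_derivative w x) (at x)"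
      using einterval_antiderivative[of "-\<infinity>" "\<infinity>" w] by auto
    then have Fd: "(F has_real_derivative w x) (at x)" for x
      by (simp add: has_real_derivative_iff_has_vector_derivative)
    have Fl: "F x = F c" if "x \<le> c" for x
    proof (cases "x = c")
      case False
      with that have "x < c" by simp
      moreover have "continuous_on {x..c} F"
        using Fd by (meson DERIV_continuous_on has_field_derivative_at_within)
      ultimately show ?thesis
        using DERIV_isconst_end[of x c F] Fd wz by (metis atLeastAtMost_iff not_le)
    qed simp
    have Fr: "F x = F d" if "d \<le> x" for x
    proof (cases "x = d")
      case False
      with that have "d < x" by simp
      moreover have "continuous_on {d..x} F"
        using Fd by (meson DERIV_continuous_on has_field_derivative_at_within)
      ultimately show ?thesis
        using DERIV_isconst_end[of d x F] Fd wz by (metis atLeastAtMost_iff not_le)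
    qed simp
    have "complex_of_real (F b - F a) = 0"
      using prim_of_derivative[OF Fd cw, of a b b] ab w0 by (simp add: prim_right)
    then have "F b = F a" by simp
    then have eq: "F d = F c" using Fl[of a] Fr[of b] cd by simp
    have "(LINT x|leb a b. u x * of_real (w x)) = - (LINT x|leb a b. 0 * of_real (F x - F c))"
    proof (rule weak_derivD[OF w cd _ cw])
      show "((\<lambda>x. F x - F c) has_real_derivative w x) (at x)" for x
        using DERIV_diff[OF Fd[of x] DERIV_const[of "F c" "at x"]] by simp
      show "F x - F c = 0" if "x \<notin> {c..d}" for x
        using that Fl[of x] Fr[of x] eq by (cases "x \<le> c") auto
    qed
    then show ?thesis by simp
  qed
  \<comment> \<open>If every such weight had integral zero, the constant function 1 would be
    orthogonal to all of them and vanish almost everywhere.\<close>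
  have "\<exists>(w::real \<Rightarrow> real) c d. a < c \<and> c < d \<and> d < b \<and> continuous_on UNIV w \<and>
      (\<forall>x. x \<notin> {c..d} \<longrightarrow> w x = 0) \<and> (LINT x|leb a b. complex_of_real (w x)) \<noteq> 0"
  proof (rule ccontr)
    assume n: "\<not> ?thesis"
    have "AE x in leb a b. (1::complex) = 0"
    proof (rule AE_zero_if_orthogonal_Cc[of a b "\<lambda>x. 1"])
      fix w :: "real \<Rightarrow> real" and c d
      assume "a < c" "c < d" "d < b" "continuous_on UNIV w" "\<And>x. x \<notin> {c..d} \<Longrightarrow> w x = 0"
      then have "(LINT x|leb a b. complex_of_real (w x)) = 0" using n by blast
      then show "(LINT x|leb a b. 1 * complex_of_real (w x)) = 0" by simp
    qed simp
    then have "negligible {x. a < x \<and> x < b}" by (simp add: AE_leb_iff)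
    moreover have "{x. a < x \<and> x < b} = box a b" by auto
    ultimately have "box a b = {}" by (simp only: negligible_interval)
    then show False using ab by simp
  qed
  then obtain w1 :: "real \<Rightarrow> real" and c1 d1 where w1: "a < c1" "c1 < d1" "d1 < b" "continuous_on UNIV w1"
      "\<And>x. x \<notin> {c1..d1} \<Longrightarrow> w1 x = 0" "(LINT x|leb a b. complex_of_real (w1 x)) \<noteq> 0" by blast
  have Ire: "(LINT x|leb a b. complex_of_real (f x)) = of_real (LINT x|leb a b. f x)" for f :: "real \<Rightarrow> real"
    by (rule integral_complex_of_real)
  define I where "I = (LINT x|leb a b. w1 x)"
  have I: "I \<noteq> 0" using w1(6) by (simp add: Ire I_def)
  \<comment> \<open>The mean of \<open>u\<close> with respect to the weight \<open>w1\<close>; it is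
    the only possible value of the constant.\<close>
  define C where "C = (LINT x|leb a b. u x * of_real (w1 x)) / of_real I"
  have "AE x in leb a b. u x - C = 0"
  proof (rule AE_zero_if_orthogonal_Cc)
    show "integrable (leb a b) (\<lambda>x. u x - C)" using u by simp
    fix w :: "real \<Rightarrow> real" and c d
    assume w: "a < c" "c < d" "d < b" "continuous_on UNIV w" "\<And>x. x \<notin> {c..d} \<Longrightarrow> w x = 0"
    define J where "J = (LINT x|leb a b. w x)"
    let ?w = "\<lambda>x. w x - J / I * w1 x"
    have iw: "integrable (leb a b) (\<lambda>x. complex_of_real (w x))" "integrable (leb a b) (\<lambda>x. complex_of_real (w1 x))"
      using wint[of "\<lambda>x. 1" w] wint[of "\<lambda>x. 1" w1] w w1 by auto
    have iuw: "integrable (leb a b) (\<lambda>x. u x * complex_of_real (w x))" "integrable (leb a b) (\<lambda>x. u x * complex_of_real (w1 x))"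
      using wint[OF u] w w1 by auto
    have "(LINT x|leb a b. u x * of_real (?w x)) = 0"
    proof (rule int0[of "min c c1" "max d d1"])
      show "continuous_on UNIV ?w" by (intro continuous_intros w w1)
      have "(LINT x|leb a b. complex_of_real (?w x)) =
            (LINT x|leb a b. of_real (w x) - of_real (J / I) * of_real (w1 x))" by simp
      also have "\<dots> = of_real J - of_real (J / I) * of_real I"
        using iw by (subst Bochner_Integration.integral_diff) (auto simp: Ire J_def I_def simp del: of_real_divide)
      finally show "(LINT x|leb a b. complex_of_real (?w x)) = 0" using I by simp
      show "?w x = 0" if x: "x \<notin> {min c c1..max d d1}" for x
      proof -
        have "w x = 0" by (rule w(5)) (use x in auto)
        moreover have "w1 x = 0" by (rule w1(5)) (use x in auto)
        ultimately show ?thesis by simp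
      qed
    qed (use w w1 in auto)
    also have "(LINT x|leb a b. u x * of_real (?w x)) =
       (LINT x|leb a b. u x * of_real (w x) - of_real (J / I) * (u x * of_real (w1 x)))"
      by (rule Bochner_Integration.integral_cong) (auto simp: algebra_simps)
    also have "\<dots> = (LINT x|leb a b. u x * of_real (w x)) - C * of_real J"
      using iuw I by (subst Bochner_Integration.integral_diff) (auto simp: C_def)
    finally have "(LINT x|leb a b. u x * of_real (w x)) = C * of_real J" by simp
    moreover have "(LINT x|leb a b. (u x - C) * of_real (w x)) =
       (LINT x|leb a b. u x * of_real (w x) - C * of_real (w x))"
      by (simp add: algebra_simps)
    moreover have "\<dots> = (LINT x|leb a b. u x * of_real (w x)) - C * of_real J"
      using iuw iw by (subst Bochner_Integration.integral_diff) (auto simp: Ire J_def)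
    ultimately show "(LINT x|leb a b. (u x - C) * of_real (w x)) = 0" by simp
  qed
  then show ?thesis by auto
qed

text \<open>An instance of \<open>prim_product_integral\<close> with second factor
  \<open>\<eta>'\<close>. The product of the total integrals drops out because \<eta> vanishes at
  both ends.\<close>

lemma weak_deriv_prim:
  assumes g: "integrable (leb a b) g" and ab: "a < b"
  shows "weak_deriv a b (\<lambda>x. C + prim a b g x) g"
  unfolding weak_deriv_def
proof (intro allI impI, elim conjE)
  fix \<eta> \<eta>' :: "real \<Rightarrow> real" and c d
  assume cd: "a < c" "c < d" "d < b" and d: "\<forall>x. (\<eta> has_real_derivative \<eta>' x) (at x)"
    and c: "continuous_on UNIV \<eta>'" and z: "\<forall>x. x \<notin> {c..d} \<longrightarrow> \<eta> x = 0"
  let ?h = "\<lambda>s. complex_of_real (\<eta>' s)"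
  have h: "?h \<in> L2 a b" by (rule continuous_L2) (intro continuous_intros continuous_on_subset[OF c], auto)
  note hi = L2_integrable[OF h]
  have ph: "prim a b ?h x = of_real (\<eta> x)" if "a \<le> x" "x \<le> b" for x
    using prim_of_derivative[of \<eta> \<eta>' a x b] d c z cd that by simp
  have I0: "(LINT x|leb a b. ?h x) = 0" using ph[of b] z cd ab by (simp add: prim_right)
  have pg: "prim a b g \<in> L2 a b" by (rule continuous_L2[OF continuous_prim[OF g]])
  have "(LINT x|leb a b. (C + prim a b g x) * ?h x) = (LINT x|leb a b. C * ?h x + prim a b g x * ?h x)"
    by (simp add: algebra_simps)
  also have "\<dots> = C * (LINT x|leb a b. ?h x) + (LINT x|leb a b. prim a b g x * ?h x)"
    using hi L2_mult_integrable[OF pg h] by simp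
  also have "\<dots> = - (LINT x|leb a b. g x * prim a b ?h x)"
    using prim_product_integral[OF g hi] I0 by (simp add: add_eq_0_iff2)
  also have "(LINT x|leb a b. g x * prim a b ?h x) = (LINT x|leb a b. g x * of_real (\<eta> x))"
    by (rule Bochner_Integration.integral_cong) (auto simp: ph)
  finally show "(LINT x|leb a b. (C + prim a b g x) * ?h x) = - (LINT x|leb a b. g x * of_real (\<eta> x))" .
qed

lemma weak_deriv_AE:
  assumes u: "integrable (leb a b) u" and ae: "AE x in leb a b. u x = v x"
  shows "weak_deriv a b u g \<longleftrightarrow> weak_deriv a b v g"
proof -
  have um [measurable]: "u \<in> borel_measurable (leb a b)" using u by simp
  have vm [measurable]: "v \<in> borel_measurable (leb a b)" using borel_measurable_leb_AE[OF um ae] .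
  have "(LINT x|leb a b. u x * of_real (w x)) = (LINT x|leb a b. v x * of_real (w x))"
    if "continuous_on UNIV w" for w :: "real \<Rightarrow> real"
  proof (rule integral_cong_AE)
    have [measurable]: "w \<in> borel_measurable (leb a b)"
      by (intro borel_measurable_leb borel_measurable_continuous_onI that)
    show "(\<lambda>x. u x * of_real (w x)) \<in> borel_measurable (leb a b)" "(\<lambda>x. v x * of_real (w x)) \<in> borel_measurable (leb a b)"
      by measurable
  qed (use ae in \<open>auto elim: AE_mp\<close>)
  then show ?thesis unfolding weak_deriv_def by auto
qed

text \<open>Identifies weakly differentiable functions on an interval with absolutely continuous
  ones, up to a null set. Most of the later calculus with \<open>wderiv\<close> and
  \<open>crep\<close> uses this representation instead of test functions.\<close>

theorem weak_deriv_iff: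
  assumes u: "integrable (leb a b) u" and g: "integrable (leb a b) g" and ab: "a < b"
  shows "weak_deriv a b u g \<longleftrightarrow> (\<exists>C. AE x in leb a b. u x = C + prim a b g x)"
proof
  assume w: "weak_deriv a b u g"
  have pg: "prim a b g \<in> L2 a b" by (rule continuous_L2[OF continuous_prim[OF g]])
  note pgi = L2_integrable[OF pg]
  let ?v = "\<lambda>x. u x - prim a b g x"
  have "weak_deriv a b ?v (\<lambda>x. 0)"
    unfolding weak_deriv_def
  proof (intro allI impI)
    fix \<eta> \<eta>' :: "real \<Rightarrow> real" and c d
    assume t: "a < c \<and> c < d \<and> d < b \<and> (\<forall>x. (\<eta> has_real_derivative \<eta>' x) (at x)) \<and>
        continuous_on UNIV \<eta>' \<and> (\<forall>x. x \<notin> {c..d} \<longrightarrow> \<eta> x = 0)"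
    have h: "(\<lambda>s. complex_of_real (\<eta>' s)) \<in> L2 a b"
      by (rule continuous_L2) (use t in \<open>auto intro!: continuous_intros intro: continuous_on_subset\<close>)
    have "(LINT x|leb a b. u x * of_real (\<eta>' x)) = (LINT x|leb a b. prim a b g x * of_real (\<eta>' x))"
      using weak_derivD[OF w, of c d \<eta> \<eta>'] weak_derivD[OF weak_deriv_prim[OF g ab, of 0], of c d \<eta> \<eta>'] t by simp
    moreover have "integrable (leb a b) (\<lambda>x. u x * of_real (\<eta>' x))"
    proof -
      obtain B where "\<And>x. a \<le> x \<Longrightarrow> x \<le> b \<Longrightarrow> norm (\<eta>' x) \<le> B"
        using continuous_on_interval_bounded[of a b \<eta>'] t by (metis continuous_on_subset subset_UNIV)
      then have "integrable (leb a b) (\<lambda>x. of_real (\<eta>' x) * u x)"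
        using t by (intro integrable_leb_weight[where C=B] borel_measurable_continuous_onI u) auto
      then show ?thesis by (simp add: mult.commute)
    qed
    ultimately show "(LINT x|leb a b. ?v x * of_real (\<eta>' x)) = - (LINT x|leb a b. 0 * of_real (\<eta> x))"
      using L2_mult_integrable[OF pg h] by (simp add: left_diff_distrib)
  qed
  then obtain C where "AE x in leb a b. ?v x = C"
    using AE_const_if_weak_deriv_zero[of a b ?v] u pgi ab by auto
  then have "AE x in leb a b. u x = C + prim a b g x" by eventually_elim (simp add: algebra_simps)
  then show "\<exists>C. AE x in leb a b. u x = C + prim a b g x" ..
next
  assume "\<exists>C. AE x in leb a b. u x = C + prim a b g x"
  then obtain C where C: "AE x in leb a b. u x = C + prim a b g x" ..
  show "weak_deriv a b u g"
    unfolding weak_deriv_AE[OF u C] by (rule weak_deriv_prim[OF g ab])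
qed

section \<open>Sobolev functions on an interval\<close>

lemma AE_eq_imp_eq_on_interval:
  fixes F G :: cfun
  assumes F: "continuous_on {a..b} F" and G: "continuous_on {a..b} G" and ab: "a < b"
    and ae: "AE x in leb a b. F x = G x" and x: "x \<in> {a..b}"
  shows "F x = G x"
proof (rule ccontr)
  assume ne: "F x \<noteq> G x"
  have "continuous_on {a..b} (\<lambda>x. F x - G x)" by (intro continuous_intros F G)
  then obtain d where d: "d > 0" and near: "\<And>y. y \<in> {a..b} \<Longrightarrow> dist y x < d \<Longrightarrow>
      dist (F y - G y) (F x - G x) < norm (F x - G x)"
    using x ne unfolding continuous_on_iff by (metis right_minus_eq zero_less_norm_iff)
  have sub: "box (max a (x - d)) (min b (x + d)) \<subseteq> {y. a < y \<and> y < b \<and> \<not> F y = G y}"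
  proof
    fix y assume y: "y \<in> box (max a (x - d)) (min b (x + d))"
    then have "dist y x < d" "y \<in> {a..b}" by (auto simp: dist_real_def)
    then have "F y - G y \<noteq> 0" using near[of y] by (auto simp: dist_norm norm_minus_commute)
    then show "y \<in> {y. a < y \<and> y < b \<and> \<not> F y = G y}" using y by auto
  qed
  have "negligible {y. a < y \<and> y < b \<and> \<not> F y = G y}" using ae by (simp only: AE_leb_iff)
  then have "negligible (box (max a (x - d)) (min b (x + d)))" using sub by (rule negligible_subset)
  then have "box (max a (x - d)) (min b (x + d)) = {}" by (simp only: negligible_interval)
  then show False using ab d x by (auto simp: max_def min_def split: if_splits)
qed

text \<open>Continuous functions that agree almost everywhere agree on the whole closed interval, so
  the choice inside \<open>crep\<close> does not affect boundary values.\<close>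

lemma crep_eq:
  assumes F: "continuous_on {a..b} F" and ae: "AE x in leb a b. u x = F x" and ab: "a < b"
    and x: "x \<in> {a..b}"
  shows "crep a b u x = F x"
proof -
  have ae': "AE x in leb a b. F x = u x" using ae by eventually_elim simp
  have "continuous_on {a..b} (crep a b u) \<and> (AE x in leb a b. crep a b u x = u x)"
    unfolding crep_def by (rule someI[of _ F]) (use F ae' in blast)
  then have c: "continuous_on {a..b} (crep a b u)" and cu: "AE x in leb a b. crep a b u x = u x" by auto
  from cu ae have "AE x in leb a b. crep a b u x = F x" by eventually_elim simp
  then show ?thesis by (rule AE_eq_imp_eq_on_interval[OF c F ab _ x])
qed

lemma wderiv_H1:
  assumes "u \<in> H1 a b"
  shows "wderiv a b u \<in> L2 a b" "weak_deriv a b u (wderiv a b u)"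
proof -
  obtain g where "g \<in> L2 a b \<and> weak_deriv a b u g" using assms by (auto simp: H1_def)
  then have "wderiv a b u \<in> L2 a b \<and> weak_deriv a b u (wderiv a b u)"
    unfolding wderiv_def by (rule someI[where P="\<lambda>g. g \<in> L2 a b \<and> weak_deriv a b u g"])
  then show "wderiv a b u \<in> L2 a b" "weak_deriv a b u (wderiv a b u)" by auto
qed

lemma H1_L2: "u \<in> H1 a b \<Longrightarrow> u \<in> L2 a b" by (simp add: H1_def)

lemma prim_eq_imp_AE_eq:
  assumes f: "integrable (leb a b) f" and g: "integrable (leb a b) g" and ab: "a < b"
    and eq: "AE x in leb a b. C + prim a b f x = D + prim a b g x"
  shows "C = D" "AE x in leb a b. f x = g x"
proof -
  have e: "C + prim a b f x = D + prim a b g x" if "x \<in> {a..b}" for x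
    by (rule AE_eq_imp_eq_on_interval[OF _ _ ab eq that]) (intro continuous_intros continuous_prim f g)+
  from e[of a] show CD: "C = D" using ab by (simp add: prim_left)
  have "AE x in leb a b. f x - g x = 0"
  proof (rule prim_zero_imp_AE_zero)
    fix x assume "a < x" "x < b"
    then show "prim a b (\<lambda>x. f x - g x) x = 0" using e[of x] CD by (simp add: prim_diff[OF f g])
  qed (use f g in auto)
  then show "AE x in leb a b. f x = g x" by simp
qed

theorem H1_rep:
  assumes u: "u \<in> H1 a b" and ab: "a < b"
  shows "AE x in leb a b. u x = crep a b u x"
    and "x \<in> {a..b} \<Longrightarrow> crep a b u x = crep a b u a + prim a b (wderiv a b u) x"
proof -
  note w = wderiv_H1[OF u]
  note wi = L2_integrable[OF w(1)]
  obtain C where C: "AE x in leb a b. u x = C + prim a b (wderiv a b u) x"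
    using w weak_deriv_iff[OF L2_integrable[OF H1_L2[OF u]] wi ab] by blast
  have c: "continuous_on {a..b} (\<lambda>x. C + prim a b (wderiv a b u) x)"
    by (intro continuous_intros continuous_prim wi)
  have e: "crep a b u x = C + prim a b (wderiv a b u) x" if "x \<in> {a..b}" for x
    by (rule crep_eq[OF c C ab that])
  have "crep a b u a = C" using e[of a] ab by (simp add: prim_left)
  then show "x \<in> {a..b} \<Longrightarrow> crep a b u x = crep a b u a + prim a b (wderiv a b u) x" using e by simp
  have "AE x in leb a b. x \<in> {a..b}" by (rule AE_leb_I) auto
  with C show "AE x in leb a b. u x = crep a b u x" by eventually_elim (simp add: e)
qed

lemma continuous_crep:
  assumes u: "u \<in> H1 a b" and ab: "a < b"
  shows "continuous_on {a..b} (crep a b u)"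
proof -
  have "continuous_on {a..b} (\<lambda>x. crep a b u a + prim a b (wderiv a b u) x)"
    by (intro continuous_intros continuous_prim L2_integrable wderiv_H1 u)
  then show ?thesis by (rule continuous_on_eq) (simp only: H1_rep(2)[OF u ab, symmetric])
qed

text \<open>The working rule for \<open>H1\<close>: one representation as constant plus primitive
  delivers membership, the derivative and the boundary values together. The closure lemmas below
  produce such a representation and read off all three.\<close>

theorem H1_I:
  assumes g: "g \<in> L2 a b" and ab: "a < b" and ae: "AE x in leb a b. u x = C + prim a b g x"
  shows "u \<in> H1 a b" and "AE x in leb a b. wderiv a b u x = g x"
    and "x \<in> {a..b} \<Longrightarrow> crep a b u x = C + prim a b g x"
proof -
  note gi = L2_integrable[OF g]
  have c: "continuous_on {a..b} (\<lambda>x. C + prim a b g x)"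
    by (intro continuous_intros continuous_prim gi)
  have u2: "u \<in> L2 a b"
    by (rule L2_AE[OF continuous_L2[OF c]]) (use ae in \<open>eventually_elim, simp\<close>)
  note ui = L2_integrable[OF u2]
  have "weak_deriv a b u g" using weak_deriv_iff[OF ui gi ab] ae by blast
  then show u: "u \<in> H1 a b" using u2 g by (auto simp: H1_def)
  show "x \<in> {a..b} \<Longrightarrow> crep a b u x = C + prim a b g x" by (rule crep_eq[OF c ae ab])
  have "AE x in leb a b. x \<in> {a..b}" by (rule AE_leb_I) auto
  then have "AE x in leb a b. crep a b u a + prim a b (wderiv a b u) x = C + prim a b g x"
    using ae H1_rep(1)[OF u ab]
  proof eventually_elim
    case (elim x)
    then show ?case using H1_rep(2)[OF u ab, of x] by simp
  qed
  then show "AE x in leb a b. wderiv a b u x = g x"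
    by (rule prim_eq_imp_AE_eq(2)[OF L2_integrable[OF wderiv_H1(1)[OF u]] gi ab])
qed

lemma H1_repE:
  assumes u: "u \<in> H1 a b" and ab: "a < b"
  shows "AE x in leb a b. u x = crep a b u a + prim a b (wderiv a b u) x"
proof -
  have "AE x in leb a b. x \<in> {a..b}" by (rule AE_leb_I) auto
  then show ?thesis using H1_rep(1)[OF u ab]
  proof eventually_elim
    case (elim x)
    then show ?case using H1_rep(2)[OF u ab, of x] by simp
  qed
qed

lemma H1_add:
  assumes u: "u \<in> H1 a b" and v: "v \<in> H1 a b" and ab: "a < b"
  shows "(\<lambda>x. u x + v x) \<in> H1 a b"
    and "AE x in leb a b. wderiv a b (\<lambda>x. u x + v x) x = wderiv a b u x + wderiv a b v x"
    and "x \<in> {a..b} \<Longrightarrow> crep a b (\<lambda>x. u x + v x) x = crep a b u x + crep a b v x"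
proof -
  note wi = L2_integrable[OF wderiv_H1(1)[OF u]] L2_integrable[OF wderiv_H1(1)[OF v]]
  have g: "(\<lambda>x. wderiv a b u x + wderiv a b v x) \<in> L2 a b" by (intro L2_add wderiv_H1 u v)
  have ae: "AE x in leb a b. u x + v x = (crep a b u a + crep a b v a) + prim a b (\<lambda>x. wderiv a b u x + wderiv a b v x) x"
    using H1_repE[OF u ab] H1_repE[OF v ab] by eventually_elim (simp add: prim_add[OF wi])
  show "(\<lambda>x. u x + v x) \<in> H1 a b" by (rule H1_I(1)[OF g ab ae])
  show "AE x in leb a b. wderiv a b (\<lambda>x. u x + v x) x = wderiv a b u x + wderiv a b v x" by (rule H1_I(2)[OF g ab ae])
  show "crep a b (\<lambda>x. u x + v x) x = crep a b u x + crep a b v x" if "x \<in> {a..b}"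
    using H1_I(3)[OF g ab ae that] H1_rep(2)[OF u ab that] H1_rep(2)[OF v ab that] by (simp add: prim_add[OF wi])
qed

lemma H1_cmult:
  assumes u: "u \<in> H1 a b" and ab: "a < b"
  shows "(\<lambda>x. c * u x) \<in> H1 a b"
    and "AE x in leb a b. wderiv a b (\<lambda>x. c * u x) x = c * wderiv a b u x"
    and "x \<in> {a..b} \<Longrightarrow> crep a b (\<lambda>x. c * u x) x = c * crep a b u x"
proof -
  have g: "(\<lambda>x. c * wderiv a b u x) \<in> L2 a b" by (intro L2_cmult wderiv_H1 u)
  have ae: "AE x in leb a b. c * u x = c * crep a b u a + prim a b (\<lambda>x. c * wderiv a b u x) x"
    using H1_repE[OF u ab] by eventually_elim (simp add: prim_cmult distrib_left)
  show "(\<lambda>x. c * u x) \<in> H1 a b" by (rule H1_I(1)[OF g ab ae])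
  show "AE x in leb a b. wderiv a b (\<lambda>x. c * u x) x = c * wderiv a b u x" by (rule H1_I(2)[OF g ab ae])
  show "crep a b (\<lambda>x. c * u x) x = c * crep a b u x" if "x \<in> {a..b}"
    using H1_I(3)[OF g ab ae that] H1_rep(2)[OF u ab that] by (simp add: prim_cmult distrib_left)
qed

lemma H1_cnj:
  assumes u: "u \<in> H1 a b" and ab: "a < b"
  shows "(\<lambda>x. cnj (u x)) \<in> H1 a b"
    and "AE x in leb a b. wderiv a b (\<lambda>x. cnj (u x)) x = cnj (wderiv a b u x)"
    and "x \<in> {a..b} \<Longrightarrow> crep a b (\<lambda>x. cnj (u x)) x = cnj (crep a b u x)"
proof -
  have g: "(\<lambda>x. cnj (wderiv a b u x)) \<in> L2 a b" by (intro L2_cnj wderiv_H1 u)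
  have ae: "AE x in leb a b. cnj (u x) = cnj (crep a b u a) + prim a b (\<lambda>x. cnj (wderiv a b u x)) x"
    using H1_repE[OF u ab] by eventually_elim (simp add: prim_cnj)
  show "(\<lambda>x. cnj (u x)) \<in> H1 a b" by (rule H1_I(1)[OF g ab ae])
  show "AE x in leb a b. wderiv a b (\<lambda>x. cnj (u x)) x = cnj (wderiv a b u x)" by (rule H1_I(2)[OF g ab ae])
  show "crep a b (\<lambda>x. cnj (u x)) x = cnj (crep a b u x)" if "x \<in> {a..b}"
    using H1_I(3)[OF g ab ae that] H1_rep(2)[OF u ab that] by (simp add: prim_cnj)
qed

lemma H1_AE:
  assumes u: "u \<in> H1 a b" and ab: "a < b" and ae: "AE x in leb a b. v x = u x"
  shows "v \<in> H1 a b"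
    and "AE x in leb a b. wderiv a b v x = wderiv a b u x"
    and "x \<in> {a..b} \<Longrightarrow> crep a b v x = crep a b u x"
proof -
  note g = wderiv_H1(1)[OF u]
  have ae: "AE x in leb a b. v x = crep a b u a + prim a b (wderiv a b u) x"
    using H1_repE[OF u ab] ae by eventually_elim simp
  show "v \<in> H1 a b" by (rule H1_I(1)[OF g ab ae])
  show "AE x in leb a b. wderiv a b v x = wderiv a b u x" by (rule H1_I(2)[OF g ab ae])
  show "crep a b v x = crep a b u x" if "x \<in> {a..b}"
    using H1_I(3)[OF g ab ae that] H1_rep(2)[OF u ab that] by simp
qed

lemma H1_C1:
  assumes d: "\<And>x. (m has_real_derivative m' x) (at x)" and c: "continuous_on UNIV m'" and ab: "a < b"
  shows "(\<lambda>x. of_real (m x)) \<in> H1 a b"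
    and "AE x in leb a b. wderiv a b (\<lambda>x. of_real (m x)) x = of_real (m' x)"
    and "x \<in> {a..b} \<Longrightarrow> crep a b (\<lambda>x. of_real (m x)) x = of_real (m x)"
proof -
  have g: "(\<lambda>x. complex_of_real (m' x)) \<in> L2 a b"
    by (intro continuous_L2 continuous_intros continuous_on_subset[OF c]) auto
  have ae: "AE x in leb a b. complex_of_real (m x) = of_real (m a) + prim a b (\<lambda>x. of_real (m' x)) x"
    by (rule AE_leb_I) (simp add: prim_of_derivative[OF d c])
  show "(\<lambda>x. of_real (m x)) \<in> H1 a b" by (rule H1_I(1)[OF g ab ae])
  show "AE x in leb a b. wderiv a b (\<lambda>x. of_real (m x)) x = of_real (m' x)" by (rule H1_I(2)[OF g ab ae])
  show "crep a b (\<lambda>x. of_real (m x)) x = of_real (m x)" if "x \<in> {a..b}"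
    using H1_I(3)[OF g ab ae that] that by (simp add: prim_of_derivative[OF d c])
qed

text \<open>Both functions are written as constant plus primitive; what remains beyond
  \<open>prim_product_integral\<close> is the expansion of the boundary values at
  \<open>b\<close>.\<close>

theorem H1_parts:
  assumes u: "u \<in> H1 a b" and v: "v \<in> H1 a b" and ab: "a < b"
  shows "(LINT x|leb a b. u x * wderiv a b v x) + (LINT x|leb a b. wderiv a b u x * v x) =
         crep a b u b * crep a b v b - crep a b u a * crep a b v a"
proof -
  let ?f = "wderiv a b u" and ?g = "wderiv a b v" and ?A = "crep a b u a" and ?B = "crep a b v a"
  note fg = wderiv_H1(1)[OF u] wderiv_H1(1)[OF v]
  note i = fg[THEN L2_integrable]
  have p: "prim a b ?f \<in> L2 a b" "prim a b ?g \<in> L2 a b" by (intro continuous_L2 continuous_prim i)+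
  have m: "u \<in> borel_measurable (leb a b)" "v \<in> borel_measurable (leb a b)"
    "?f \<in> borel_measurable (leb a b)" "?g \<in> borel_measurable (leb a b)"
    "prim a b ?f \<in> borel_measurable (leb a b)" "prim a b ?g \<in> borel_measurable (leb a b)"
    using fg p H1_L2[OF u] H1_L2[OF v] by (auto simp: L2_def)
  have "(LINT x|leb a b. u x * ?g x) = (LINT x|leb a b. ?A * ?g x + prim a b ?f x * ?g x)"
  proof (rule integral_cong_AE)
    show "AE x in leb a b. u x * ?g x = ?A * ?g x + prim a b ?f x * ?g x"
      using H1_repE[OF u ab] by eventually_elim (simp add: distrib_right)
  qed (intro borel_measurable_times borel_measurable_add borel_measurable_const m)+
  also have "\<dots> = ?A * (LINT x|leb a b. ?g x) + (LINT x|leb a b. prim a b ?f x * ?g x)"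
    using i L2_mult_integrable[OF p(1) fg(2)] by simp
  finally have 1: "(LINT x|leb a b. u x * ?g x) = \<dots>" .
  have "(LINT x|leb a b. ?f x * v x) = (LINT x|leb a b. ?f x * ?B + ?f x * prim a b ?g x)"
  proof (rule integral_cong_AE)
    show "AE x in leb a b. ?f x * v x = ?f x * ?B + ?f x * prim a b ?g x"
      using H1_repE[OF v ab] by eventually_elim (simp add: distrib_left)
  qed (intro borel_measurable_times borel_measurable_add borel_measurable_const m)+
  also have "\<dots> = (LINT x|leb a b. ?f x) * ?B + (LINT x|leb a b. ?f x * prim a b ?g x)"
    using i L2_mult_integrable[OF fg(1) p(2)] by simp
  finally have 2: "(LINT x|leb a b. ?f x * v x) = \<dots>" .
  have "crep a b u b = ?A + (LINT x|leb a b. ?f x)" "crep a b v b = ?B + (LINT x|leb a b. ?g x)"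
    using H1_rep(2)[OF u ab, of b] H1_rep(2)[OF v ab, of b] ab by (simp_all add: prim_right)
  then show ?thesis unfolding 1 2 using prim_product_integral[OF i] by (simp add: algebra_simps)
qed

text \<open>The smooth factor is moved to the other side of the pairing:
  \<open>m x * \<eta> x\<close> is again an admissible test function.\<close>

lemma H1_mult_C1:
  assumes u: "u \<in> H1 a b" and ab: "a < b"
    and d: "\<And>x. (m has_real_derivative m' x) (at x)" and c: "continuous_on UNIV m'"
  shows "(\<lambda>x. of_real (m x) * u x) \<in> H1 a b"
    and "AE x in leb a b. wderiv a b (\<lambda>x. of_real (m x) * u x) x = of_real (m' x) * u x + of_real (m x) * wderiv a b u x"
    and "x \<in> {a..b} \<Longrightarrow> crep a b (\<lambda>x. of_real (m x) * u x) x = of_real (m x) * crep a b u x"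
proof -
  have cm: "continuous_on UNIV m" using d by (meson DERIV_continuous_on has_field_derivative_at_within)
  have L: "(\<lambda>x. of_real (w x) * h x) \<in> L2 a b" if h: "h \<in> L2 a b" and w: "continuous_on UNIV w" for w :: "real \<Rightarrow> real" and h
  proof -
    obtain B where "\<And>x. a \<le> x \<Longrightarrow> x \<le> b \<Longrightarrow> norm (w x) \<le> B"
      using continuous_on_interval_bounded[of a b w] continuous_on_subset[OF w] by (metis subset_UNIV)
    then show ?thesis
      by (intro L2_weight[where C=B] borel_measurable_leb borel_measurable_continuous_onI h w AE_leb_I) auto
  qed
  note u2 = H1_L2[OF u] and w = wderiv_H1[OF u]
  let ?g = "\<lambda>x. of_real (m' x) * u x + of_real (m x) * wderiv a b u x"
  have mu: "(\<lambda>x. of_real (m x) * u x) \<in> L2 a b" by (intro L u2 cm)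
  have g: "?g \<in> L2 a b" by (intro L2_add L u2 w cm c)
  have "weak_deriv a b (\<lambda>x. of_real (m x) * u x) ?g"
    unfolding weak_deriv_def
  proof (intro allI impI, elim conjE)
    fix \<eta> \<eta>' :: "real \<Rightarrow> real" and p q
    assume pq: "a < p" "p < q" "q < b" and e: "\<forall>x. (\<eta> has_real_derivative \<eta>' x) (at x)"
      and ce: "continuous_on UNIV \<eta>'" and z: "\<forall>x. x \<notin> {p..q} \<longrightarrow> \<eta> x = 0"
    have ct: "continuous_on UNIV \<eta>" using e by (meson DERIV_continuous_on has_field_derivative_at_within)
    have E: "(LINT x|leb a b. u x * of_real (m' x * \<eta> x + \<eta>' x * m x)) = - (LINT x|leb a b. wderiv a b u x * of_real (m x * \<eta> x))"
    proof (rule weak_derivD[OF w(2) pq])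
      show "((\<lambda>x. m x * \<eta> x) has_real_derivative m' x * \<eta> x + \<eta>' x * m x) (at x)" for x
        using e by (intro DERIV_mult d) simp
      show "continuous_on UNIV (\<lambda>x. m' x * \<eta> x + \<eta>' x * m x)" by (intro continuous_intros c ct ce cm)
    qed (use z in auto)
    have I: "integrable (leb a b) (\<lambda>x. of_real (w x) * h x)" if "h \<in> L2 a b" "continuous_on UNIV w" for w :: "real \<Rightarrow> real" and h
      using L2_integrable[OF L[OF that]] .
    have i: "integrable (leb a b) (\<lambda>x. of_real (\<eta>' x * m x) * u x)" "integrable (leb a b) (\<lambda>x. of_real (m' x * \<eta> x) * u x)"
       "integrable (leb a b) (\<lambda>x. of_real (m x * \<eta> x) * wderiv a b u x)"
      by (intro I u2 w continuous_intros c ct ce cm)+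
    have "(LINT x|leb a b. (of_real (m x) * u x) * of_real (\<eta>' x)) = (LINT x|leb a b. of_real (\<eta>' x * m x) * u x)"
      by (simp add: mult_ac)
    also have "\<dots> = (LINT x|leb a b. u x * of_real (m' x * \<eta> x + \<eta>' x * m x)) - (LINT x|leb a b. of_real (m' x * \<eta> x) * u x)"
      using i by (subst Bochner_Integration.integral_diff[symmetric]) (auto simp: algebra_simps)
    also have "\<dots> = - ((LINT x|leb a b. of_real (m x * \<eta> x) * wderiv a b u x) + (LINT x|leb a b. of_real (m' x * \<eta> x) * u x))"
      unfolding E by (simp add: mult_ac)
    also have "\<dots> = - (LINT x|leb a b. of_real (m x * \<eta> x) * wderiv a b u x + of_real (m' x * \<eta> x) * u x)"
      by (subst Bochner_Integration.integral_add[OF i(3,2)]) simp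
    also have "\<dots> = - (LINT x|leb a b. ?g x * of_real (\<eta> x))" by (simp add: algebra_simps)
    finally show "(LINT x|leb a b. (of_real (m x) * u x) * of_real (\<eta>' x)) = - (LINT x|leb a b. ?g x * of_real (\<eta> x))" .
  qed
  then obtain C where ae: "AE x in leb a b. of_real (m x) * u x = C + prim a b ?g x"
    using weak_deriv_iff[OF L2_integrable[OF mu] L2_integrable[OF g] ab] by blast
  show "(\<lambda>x. of_real (m x) * u x) \<in> H1 a b" by (rule H1_I(1)[OF g ab ae])
  show "AE x in leb a b. wderiv a b (\<lambda>x. of_real (m x) * u x) x = ?g x" by (rule H1_I(2)[OF g ab ae])
  have c: "continuous_on {a..b} (\<lambda>x. of_real (m x) * crep a b u x)"
    by (intro continuous_intros continuous_crep u ab continuous_on_subset[OF cm]) auto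
  have "AE x in leb a b. of_real (m x) * u x = of_real (m x) * crep a b u x"
    using H1_rep(1)[OF u ab] by eventually_elim simp
  from crep_eq[OF c this ab] show "x \<in> {a..b} \<Longrightarrow> crep a b (\<lambda>x. of_real (m x) * u x) x = of_real (m x) * crep a b u x" .
qed

section \<open>Sobolev functions under the logarithmic substitution\<close>

context annulus
begin

lemma prim_push: "prim r1 r2 g (\<rho> t) = prim 0 pi (\<lambda>s. of_real (\<delta> * \<rho> s) * push r1 r2 g s) t"
  unfolding prim_def by (subst integral_change_vars) 
    (auto simp: rho_less push_eq scaleR_conv_of_real intro!: Bochner_Integration.integral_cong)

lemma L2_rho_weight: "(\<lambda>t. of_real (\<delta> * \<rho> t) * g t) \<in> L2 0 pi \<longleftrightarrow> g \<in> L2 0 pi"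
proof
  { assume g: "g \<in> L2 0 pi"
    show "(\<lambda>t. of_real (\<delta> * \<rho> t) * g t) \<in> L2 0 pi"
    proof (rule L2_weight[OF _ _ g])
      show "AE t in leb 0 pi. \<bar>\<delta> * \<rho> t\<bar> \<le> \<delta> * r2"
        using delta_pos rho_pos rho_bounds by (intro AE_leb_I) (simp add: abs_mult less_imp_le)
    qed (auto intro!: borel_measurable_leb) }
  { assume g: "(\<lambda>t. of_real (\<delta> * \<rho> t) * g t) \<in> L2 0 pi"
    have "(\<lambda>t. of_real (1 / (\<delta> * \<rho> t)) * (of_real (\<delta> * \<rho> t) * g t)) \<in> L2 0 pi"
    proof (rule L2_weight[OF _ _ g])
      have "\<bar>1 / (\<delta> * \<rho> t)\<bar> \<le> 1 / (\<delta> * r1)" if "0 < t" "t < pi" for t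
        using delta_pos rho_pos[of t] rho_bounds[OF that] r1_pos by (simp add: frac_le abs_mult)
      then show "AE t in leb 0 pi. \<bar>1 / (\<delta> * \<rho> t)\<bar> \<le> 1 / (\<delta> * r1)" by (rule AE_leb_I)
    qed (auto intro!: borel_measurable_leb)
    moreover have "of_real (1 / (\<delta> * \<rho> t)) * (of_real (\<delta> * \<rho> t) * g t) = g t" for t
      using delta_pos rho_pos[of t] by simp
    ultimately show "g \<in> L2 0 pi" by simp }
qed

text \<open>By \<open>prim_push\<close>, the substitution turns a constant plus a primitive into the
  same constant plus a primitive, with the Jacobian absorbed in the integrand.\<close>

theorem H1_push: "push r1 r2 u \<in> H1 0 pi \<longleftrightarrow> u \<in> H1 r1 r2"
proof
  assume u: "push r1 r2 u \<in> H1 0 pi"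
  let ?G = "wderiv 0 pi (push r1 r2 u)"
  \<comment> \<open>The chain rule read backwards: the derivative in \<open>t\<close> divided by the
    Jacobian.\<close>
  define g where "g = pull r1 r2 (\<lambda>t. ?G t / of_real (\<delta> * \<rho> t))"
  have pg: "of_real (\<delta> * \<rho> t) * push r1 r2 g t = ?G t" for t
    using delta_pos rho_pos[of t] by (simp add: g_def)
  have "(\<lambda>t. of_real (\<delta> * \<rho> t) * push r1 r2 g t) \<in> L2 0 pi" using wderiv_H1(1)[OF u] by (simp only: pg)
  then have g2: "g \<in> L2 r1 r2" by (simp only: L2_rho_weight L2_push)
  have "AE t in leb 0 pi. u (\<rho> t) = crep 0 pi (push r1 r2 u) 0 + prim r1 r2 g (\<rho> t)"
    using H1_repE[OF u pi_gt_zero] by (simp only: prim_push pg push_eq[of u, symmetric])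
  then have "AE r in leb r1 r2. u r = crep 0 pi (push r1 r2 u) 0 + prim r1 r2 g r"
    by (simp only: AE_change_vars)
  from H1_I(1)[OF g2 r1_less this] show "u \<in> H1 r1 r2" .
next
  assume u: "u \<in> H1 r1 r2"
  have "(\<lambda>t. of_real (\<delta> * \<rho> t) * push r1 r2 (wderiv r1 r2 u) t) \<in> L2 0 pi"
    using wderiv_H1(1)[OF u] by (simp only: L2_rho_weight L2_push)
  moreover have "AE t in leb 0 pi. push r1 r2 u t = crep r1 r2 u r1 + prim 0 pi (\<lambda>t. of_real (\<delta> * \<rho> t) * push r1 r2 (wderiv r1 r2 u) t) t"
    using H1_repE[OF u r1_less] by (simp only: AE_change_vars prim_push push_eq)
  ultimately show "push r1 r2 u \<in> H1 0 pi" using H1_I(1) pi_gt_zero by blast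
qed

lemma wderiv_push:
  assumes u: "u \<in> H1 r1 r2"
  shows "AE t in leb 0 pi. wderiv 0 pi (push r1 r2 u) t = of_real (\<delta> * \<rho> t) * push r1 r2 (wderiv r1 r2 u) t"
    and "t \<in> {0..pi} \<Longrightarrow> crep 0 pi (push r1 r2 u) t = crep r1 r2 u (\<rho> t)"
proof -
  have g: "(\<lambda>t. of_real (\<delta> * \<rho> t) * push r1 r2 (wderiv r1 r2 u) t) \<in> L2 0 pi"
    using wderiv_H1(1)[OF u] by (simp only: L2_rho_weight L2_push)
  have ae: "AE t in leb 0 pi. push r1 r2 u t = crep r1 r2 u r1 + prim 0 pi (\<lambda>t. of_real (\<delta> * \<rho> t) * push r1 r2 (wderiv r1 r2 u) t) t"
    using H1_repE[OF u r1_less] by (simp only: AE_change_vars prim_push push_eq)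
  show "AE t in leb 0 pi. wderiv 0 pi (push r1 r2 u) t = of_real (\<delta> * \<rho> t) * push r1 r2 (wderiv r1 r2 u) t"
    by (rule H1_I(2)[OF g pi_gt_zero ae])
  show "crep 0 pi (push r1 r2 u) t = crep r1 r2 u (\<rho> t)" if "t \<in> {0..pi}"
    using H1_I(3)[OF g pi_gt_zero ae that] H1_rep(2)[OF u r1_less, of "\<rho> t"] that rho_mem_cl[of t] by (simp add: prim_push)
qed

end

section \<open>Seminormed spaces of representatives\<close>

text \<open>Only a seminorm can be expected, since distinct representatives may differ by a null
  function. The algebraic laws are confined to members because the integrals behind
  \<open>ip\<close> need not converge for other functions.\<close>

locale semi_ip =
  fixes H :: hspace
  assumes zero_mem: "(\<lambda>_. 0) \<in> elems H"
    and add_mem: "u \<in> elems H \<Longrightarrow> v \<in> elems H \<Longrightarrow> (\<lambda>t. u t + v t) \<in> elems H"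
    and cmult_mem: "u \<in> elems H \<Longrightarrow> (\<lambda>t. c * u t) \<in> elems H"
    and ip_add: "u \<in> elems H \<Longrightarrow> v \<in> elems H \<Longrightarrow> w \<in> elems H \<Longrightarrow> ip H (\<lambda>t. u t + v t) w = ip H u w + ip H v w"
    and ip_cmult: "u \<in> elems H \<Longrightarrow> w \<in> elems H \<Longrightarrow> ip H (\<lambda>t. c * u t) w = c * ip H u w"
    and ip_cnj: "u \<in> elems H \<Longrightarrow> v \<in> elems H \<Longrightarrow> ip H v u = cnj (ip H u v)"
    and ip_nonneg: "u \<in> elems H \<Longrightarrow> 0 \<le> Re (ip H u u)"
begin

lemma diff_mem: "u \<in> elems H \<Longrightarrow> v \<in> elems H \<Longrightarrow> (\<lambda>t. u t - v t) \<in> elems H"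
  using add_mem[of u "\<lambda>t. - 1 * v t"] cmult_mem[of v "-1"] by simp

lemma sum_mem: "finite I \<Longrightarrow> (\<And>n. n \<in> I \<Longrightarrow> x n \<in> elems H) \<Longrightarrow> (\<lambda>t. \<Sum>n\<in>I. a n * x n t) \<in> elems H"
proof (induction I rule: finite_induct)
  case empty
  then show ?case using zero_mem by simp
next
  case (insert n I)
  then have "(\<lambda>t. a n * x n t + (\<Sum>n\<in>I. a n * x n t)) \<in> elems H"
    by (intro add_mem cmult_mem) auto
  then show ?case using insert by simp
qed

lemma ip_add_right:
  "u \<in> elems H \<Longrightarrow> v \<in> elems H \<Longrightarrow> w \<in> elems H \<Longrightarrow> ip H w (\<lambda>t. u t + v t) = ip H w u + ip H w v"
  using ip_cnj[of "\<lambda>t. u t + v t" w] ip_cnj[of u w] ip_cnj[of v w] add_mem[of u v] ip_add[of u v w] by simp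

lemma ip_cmult_right: "u \<in> elems H \<Longrightarrow> w \<in> elems H \<Longrightarrow> ip H w (\<lambda>t. c * u t) = cnj c * ip H w u"
  using ip_cnj[of "\<lambda>t. c * u t" w] ip_cnj[of u w] cmult_mem[of u c] ip_cmult[of u w c] by simp

lemma ip_diff:
  assumes "u \<in> elems H" "v \<in> elems H" "w \<in> elems H"
  shows "ip H (\<lambda>t. u t - v t) w = ip H u w - ip H v w"
  using ip_add[of u "\<lambda>t. -1 * v t" w] ip_cmult[of v w "-1"] cmult_mem[of v "-1"] assms by simp

lemma ip_diff_right:
  assumes "u \<in> elems H" "v \<in> elems H" "w \<in> elems H"
  shows "ip H w (\<lambda>t. u t - v t) = ip H w u - ip H w v"
  using ip_add_right[of u "\<lambda>t. -1 * v t" w] ip_cmult_right[of v w "-1"] cmult_mem[of v "-1"] assms by simp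

lemma ip_self: assumes "u \<in> elems H" shows "ip H u u = of_real ((hnorm H u)\<^sup>2)"
proof -
  have "Im (ip H u u) = 0" using ip_cnj[OF assms assms] by (metis Reals_cnj_iff complex_is_Real_iff)
  then show ?thesis using ip_nonneg[OF assms] by (simp add: hnorm_def complex_eq_iff)
qed

lemma hnorm_sq: "u \<in> elems H \<Longrightarrow> (hnorm H u)\<^sup>2 = Re (ip H u u)"
  using ip_nonneg by (simp add: hnorm_def)

lemma hnorm_nonneg: "u \<in> elems H \<Longrightarrow> 0 \<le> hnorm H u"
  using ip_nonneg by (simp add: hnorm_def)

lemma hnorm_cmult: assumes "u \<in> elems H" shows "hnorm H (\<lambda>t. c * u t) = cmod c * hnorm H u"
proof -
  have "ip H (\<lambda>t. c * u t) (\<lambda>t. c * u t) = (c * cnj c) * ip H u u"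
    using assms cmult_mem by (simp add: ip_cmult ip_cmult_right)
  also have "c * cnj c = of_real ((cmod c)\<^sup>2)" by (metis complex_norm_square)
  finally have "Re (ip H (\<lambda>t. c * u t) (\<lambda>t. c * u t)) = (cmod c)\<^sup>2 * Re (ip H u u)"
    by (simp only: Re_complex_of_real times_complex.sel Im_complex_of_real)
  then show ?thesis by (simp add: hnorm_def real_sqrt_mult)
qed

lemma Cauchy_Schwarz:
  assumes u: "u \<in> elems H" and v: "v \<in> elems H"
  shows "cmod (ip H u v) \<le> hnorm H u * hnorm H v"
proof -
  define z a b where "z = ip H u v" and "a = (hnorm H u)\<^sup>2" and "b = (hnorm H v)\<^sup>2"
  \<comment> \<open>Nonnegativity of the squared norm of \<open>u - s z v\<close>; the factor
    \<open>z\<close> makes the mixed terms real, so a real parameter \<open>s\<close> is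
    enough.\<close>
  have q: "0 \<le> a - 2 * s * (cmod z)\<^sup>2 + s\<^sup>2 * (cmod z)\<^sup>2 * b" for s :: real
  proof -
    let ?c = "of_real s * z" and ?w = "\<lambda>t. of_real s * z * v t"
    have w: "?w \<in> elems H" using cmult_mem[OF v, of ?c] by (simp add: mult.assoc)
    have "ip H (\<lambda>t. u t - ?w t) (\<lambda>t. u t - ?w t) = ip H u u - cnj ?c * z - ?c * cnj z + ?c * cnj ?c * ip H v v"
      using ip_cmult[OF v, of _ ?c] ip_cmult_right[OF v, of _ ?c] ip_cnj[OF u v] diff_mem[OF u w] u v w
      by (simp add: ip_diff ip_diff_right z_def algebra_simps)
    also have "\<dots> = of_real a - of_real s * (z * cnj z) - of_real s * (z * cnj z) + of_real (s\<^sup>2) * (z * cnj z) * of_real b"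
      using u v by (simp add: ip_self a_def b_def algebra_simps power2_eq_square)
    also have "z * cnj z = of_real ((cmod z)\<^sup>2)" by (metis complex_norm_square)
    finally have "ip H (\<lambda>t. u t - ?w t) (\<lambda>t. u t - ?w t) = of_real (a - 2 * s * (cmod z)\<^sup>2 + s\<^sup>2 * (cmod z)\<^sup>2 * b)"
      by (simp add: algebra_simps)
    then show ?thesis using ip_nonneg[OF diff_mem[OF u w]] by (simp only: Re_complex_of_real)
  qed
  have "(cmod z)\<^sup>2 \<le> a * b"
  proof (cases "b = 0")
    case True
    have "(cmod z)\<^sup>2 = 0"
    proof (rule ccontr)
      assume "(cmod z)\<^sup>2 \<noteq> 0"
      \<comment> \<open>For \<open>b = 0\<close> the quadratic is affine in \<open>s\<close>, and at
        this parameter it equals -1.\<close>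
      then show False using q[of "(a + 1) / (2 * (cmod z)\<^sup>2)"] True by (simp add: field_simps)
    qed
    then show ?thesis using True by simp
  next
    case False
    then have b: "b > 0" by (simp add: b_def)
    have "0 \<le> a - (cmod z)\<^sup>2 / b" using q[of "1 / b"] b by (simp add: power2_eq_square field_simps)
    then show ?thesis using b by (simp add: field_simps)
  qed
  then have "(cmod z)\<^sup>2 \<le> (hnorm H u * hnorm H v)\<^sup>2" by (simp add: a_def b_def power_mult_distrib)
  then show ?thesis using hnorm_nonneg[OF u] hnorm_nonneg[OF v] by (simp add: z_def power2_le_iff_abs_le abs_mult)
qed

lemma hnorm_triangle:
  assumes u: "u \<in> elems H" and v: "v \<in> elems H"
  shows "hnorm H (\<lambda>t. u t + v t) \<le> hnorm H u + hnorm H v"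
proof -
  have "ip H (\<lambda>t. u t + v t) (\<lambda>t. u t + v t) = ip H u u + ip H v v + (ip H u v + cnj (ip H u v))"
    using ip_cnj[OF u v] add_mem[OF u v] u v by (simp add: ip_add ip_add_right)
  then have "(hnorm H (\<lambda>t. u t + v t))\<^sup>2 = (hnorm H u)\<^sup>2 + (hnorm H v)\<^sup>2 + 2 * Re (ip H u v)"
    using hnorm_sq[OF add_mem[OF u v]] hnorm_sq[OF u] hnorm_sq[OF v] by simp
  also have "\<dots> \<le> (hnorm H u + hnorm H v)\<^sup>2"
    using Cauchy_Schwarz[OF u v] complex_Re_le_cmod[of "ip H u v"] by (simp add: power2_sum)
  finally show ?thesis using hnorm_nonneg[OF u] hnorm_nonneg[OF v] by (simp add: power2_le_iff_abs_le)
qed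

lemma hnorm_diff_commute:
  assumes "u \<in> elems H" "v \<in> elems H"
  shows "hnorm H (\<lambda>t. u t - v t) = hnorm H (\<lambda>t. v t - u t)"
  using hnorm_cmult[OF diff_mem[OF assms], of "-1"] by simp

lemma hnorm_diff_triangle:
  assumes u: "u \<in> elems H" and v: "v \<in> elems H" and w: "w \<in> elems H"
  shows "hnorm H (\<lambda>t. u t - w t) \<le> hnorm H (\<lambda>t. u t - v t) + hnorm H (\<lambda>t. v t - w t)"
  using hnorm_triangle[OF diff_mem[OF u v] diff_mem[OF v w]] by simp

lemma hnorm_reverse_triangle:
  assumes u: "u \<in> elems H" and v: "v \<in> elems H"
  shows "\<bar>hnorm H u - hnorm H v\<bar> \<le> hnorm H (\<lambda>t. u t - v t)"
  using hnorm_triangle[OF diff_mem[OF u v] v] hnorm_triangle[OF diff_mem[OF v u] u] hnorm_diff_commute[OF u v]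
  by simp

lemma riesz_basis_norms:
  assumes "riesz_basis H x"
  obtains c C where "0 < c" "0 < C" "\<And>n. c \<le> hnorm H (x n)" "\<And>n. hnorm H (x n) \<le> C"
proof -
  obtain c C where cC: "0 < c" "0 < C" and R: "\<And>N a. c * (\<Sum>n<N. (cmod (a n))\<^sup>2) \<le> (hnorm H (\<lambda>t. \<Sum>n<N. a n * x n t))\<^sup>2 \<and>
        (hnorm H (\<lambda>t. \<Sum>n<N. a n * x n t))\<^sup>2 \<le> C * (\<Sum>n<N. (cmod (a n))\<^sup>2)"
    using assms unfolding riesz_basis_def by blast
  have mem: "x n \<in> elems H" for n using assms by (simp add: riesz_basis_def)
  \<comment> \<open>The Riesz inequalities are tested with the unit coefficient vector at position
    \<open>n\<close>.\<close>
  have eq: "(\<Sum>m<Suc n. (if m = n then 1 else 0) * x m t) = x n t" for n t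
    by (simp add: if_distrib[of "\<lambda>z. z * _"] cong: if_cong)
  have eq': "(\<Sum>m<Suc n. (cmod (if m = n then 1 else 0))\<^sup>2) = 1" for n
    by (simp add: if_distrib[of cmod] if_distrib[of "\<lambda>z. z\<^sup>2"] cong: if_cong)
  have b: "c \<le> (hnorm H (x n))\<^sup>2" "(hnorm H (x n))\<^sup>2 \<le> C" for n
    using R[where N="Suc n" and a="\<lambda>m. if m = n then 1 else 0"] by (simp_all only: eq eq' mult_1_right)
  show ?thesis
  proof (rule that[of "sqrt c" "sqrt C"])
    fix n
    show "sqrt c \<le> hnorm H (x n)" using b(1)[of n] hnorm_nonneg[OF mem[of n]] by (simp add: real_le_lsqrt)
    show "hnorm H (x n) \<le> sqrt C" using b(2)[of n] hnorm_nonneg[OF mem[of n]] by (simp add: real_le_rsqrt)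
  qed (use cC in auto)
qed

end

section \<open>Transport along a change of variables\<close>

text \<open>The identity and \<open>cnj\<close> are treated together since the adjoint operators are
  complex conjugates.\<close>

definition cnj_if :: "bool \<Rightarrow> complex \<Rightarrow> complex" where
  "cnj_if b z = (if b then cnj z else z)"

lemma cnj_if_const: "cnj_if False z = z" "cnj_if True z = cnj z"
  by (simp_all add: cnj_if_def)

lemma cnj_if_simps [simp]:
  "cnj_if b (z + w) = cnj_if b z + cnj_if b w" "cnj_if b (z - w) = cnj_if b z - cnj_if b w"
  "cnj_if b (z * w) = cnj_if b z * cnj_if b w" "cnj_if b (z / w) = cnj_if b z / cnj_if b w"
  "cnj_if b (cnj_if b z) = z" "cnj_if b (of_real x) = of_real x" "cmod (cnj_if b z) = cmod z"
  "cnj_if b 0 = 0" "cnj_if b 1 = 1" "cnj_if b z = 0 \<longleftrightarrow> z = 0"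
  "cnj_if b (sum f I) = (\<Sum>i\<in>I. cnj_if b (f i))" "Re (cnj_if b z) = Re z"
  by (auto simp: cnj_if_def)

text \<open>The inverse law is one-sided because the logarithm inverts \<rho> everywhere, while
  \<rho> inverts the logarithm for positive arguments only. Hence \<open>Q\<close> undoes
  \<open>P\<close>, but \<open>P\<close> need not undo \<open>Q\<close>.\<close>

locale transport = semi_ip H for H +
  fixes K :: hspace and b :: bool and \<tau> \<rho> :: "real \<Rightarrow> real"
  assumes tau_rho: "\<tau> (\<rho> t) = t"
begin

abbreviation \<sigma> where "\<sigma> \<equiv> cnj_if b"
definition P where "P u = (\<lambda>r. \<sigma> (u (\<tau> r)))"
definition Q where "Q v = (\<lambda>t. \<sigma> (v (\<rho> t)))"

lemma sg_eq_iff: "cnj_if b z = cnj_if b w \<longleftrightarrow> z = w" by (auto simp: cnj_if_def)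

lemma Q_P [simp]: "Q (P u) = u" by (simp add: P_def Q_def tau_rho)

end

text \<open>Two-sided norm bounds are enough for totality and Riesz bases, and they are what the
  unweighted spaces on the annulus provide.\<close>

locale norm_transport = transport +
  fixes c C :: real
  assumes c_pos: "0 < c" and C_pos: "0 < C"
    and elems_iff: "v \<in> elems K \<longleftrightarrow> Q v \<in> elems H"
    and norm_lower: "v \<in> elems K \<Longrightarrow> c * hnorm H (Q v) \<le> hnorm K v"
    and norm_upper: "v \<in> elems K \<Longrightarrow> hnorm K v \<le> C * hnorm H (Q v)"
begin

lemma total_seq_transport:
  assumes t: "total_seq H x" and x: "\<And>n. x n \<in> elems H" and \<alpha>: "\<And>n. \<alpha> n \<noteq> 0"
  shows "total_seq K (\<lambda>n r. \<alpha> n * P (x n) r)"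
  unfolding total_seq_def
proof (intro ballI allI impI)
  fix v and \<epsilon> :: real assume v: "v \<in> elems K" and e: "\<epsilon> > 0"
  have qv: "Q v \<in> elems H" using v by (simp add: elems_iff)
  then obtain N d where Nb: "hnorm H (\<lambda>t. Q v t - (\<Sum>n<N. d n * x n t)) < \<epsilon> / C"
    using t e C_pos unfolding total_seq_def by (metis divide_pos_pos)
  let ?a = "\<lambda>n. \<sigma> (d n) / \<alpha> n"
  let ?w = "\<lambda>r. v r - (\<Sum>n<N. ?a n * (\<alpha> n * P (x n) r))"
  have q: "Q ?w = (\<lambda>t. Q v t - (\<Sum>n<N. d n * x n t))"
    using \<alpha> by (simp add: Q_def P_def tau_rho sg_eq_iff)
  have "?w \<in> elems K" unfolding elems_iff q by (intro diff_mem qv sum_mem x) auto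
  then have "hnorm K ?w \<le> C * hnorm H (\<lambda>t. Q v t - (\<Sum>n<N. d n * x n t))"
    using norm_upper[of ?w] by (simp only: q)
  also have "\<dots> < \<epsilon>" using Nb C_pos by (simp add: field_simps)
  finally show "\<exists>N c. hnorm K (\<lambda>r. v r - (\<Sum>n<N. c n * (\<alpha> n * P (x n) r))) < \<epsilon>"
    by (intro exI[of _ N] exI[of _ ?a])
qed

text \<open>The multipliers \<open>\<alpha> n\<close> are built in so that a renormalization,
  bounded from both sides, can be carried out together with the transport.\<close>

lemma riesz_basis_transport:
  assumes R: "riesz_basis H x" and A: "0 < A" and \<alpha>: "\<And>n. A \<le> cmod (\<alpha> n)" "\<And>n. cmod (\<alpha> n) \<le> B"
  shows "riesz_basis K (\<lambda>n r. \<alpha> n * P (x n) r)"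
proof -
  have x: "x n \<in> elems H" for n using R by (simp add: riesz_basis_def)
  have B: "0 < B" using A \<alpha>[of 0] by linarith
  have \<alpha>0: "\<alpha> n \<noteq> 0" for n using A \<alpha>(1)[of n] by auto
  obtain d D where dD: "0 < d" "0 < D" and b: "\<And>N a. d * (\<Sum>n<N. (cmod (a n))\<^sup>2) \<le> (hnorm H (\<lambda>t. \<Sum>n<N. a n * x n t))\<^sup>2 \<and>
        (hnorm H (\<lambda>t. \<Sum>n<N. a n * x n t))\<^sup>2 \<le> D * (\<Sum>n<N. (cmod (a n))\<^sup>2)"
    using R unfolding riesz_basis_def by blast
  have mem: "(\<lambda>r. \<alpha> n * P (x n) r) \<in> elems K" for n
  proof -
    have "Q (\<lambda>r. \<alpha> n * P (x n) r) = (\<lambda>t. \<sigma> (\<alpha> n) * x n t)" by (simp add: Q_def P_def tau_rho)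
    then show ?thesis using cmult_mem[OF x] by (simp add: elems_iff)
  qed
  have est: "(c\<^sup>2 * d * A\<^sup>2) * (\<Sum>n<N. (cmod (a n))\<^sup>2) \<le> (hnorm K (\<lambda>r. \<Sum>n<N. a n * (\<alpha> n * P (x n) r)))\<^sup>2 \<and>
        (hnorm K (\<lambda>r. \<Sum>n<N. a n * (\<alpha> n * P (x n) r)))\<^sup>2 \<le> (C\<^sup>2 * D * B\<^sup>2) * (\<Sum>n<N. (cmod (a n))\<^sup>2)" for N a
  proof -
    let ?a = "\<lambda>n. \<sigma> (a n * \<alpha> n)" and ?w = "\<lambda>r. \<Sum>n<N. a n * (\<alpha> n * P (x n) r)"
    let ?u = "\<lambda>t. \<Sum>n<N. ?a n * x n t"
    have q: "Q ?w = ?u" by (simp add: Q_def P_def tau_rho mult.assoc)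
    have u: "?u \<in> elems H" by (rule sum_mem) (auto simp: x)
    then have w: "?w \<in> elems K" by (simp only: elems_iff q)
    have n: "c * hnorm H ?u \<le> hnorm K ?w" "hnorm K ?w \<le> C * hnorm H ?u"
      using norm_lower[OF w] norm_upper[OF w] by (simp_all only: q)
    have n0: "0 \<le> c * hnorm H ?u" using hnorm_nonneg[OF u] c_pos by simp
    have s: "A\<^sup>2 * (\<Sum>n<N. (cmod (a n))\<^sup>2) \<le> (\<Sum>n<N. (cmod (?a n))\<^sup>2)"
      "(\<Sum>n<N. (cmod (?a n))\<^sup>2) \<le> B\<^sup>2 * (\<Sum>n<N. (cmod (a n))\<^sup>2)"
      unfolding sum_distrib_left using A \<alpha>
      by (auto intro!: sum_mono mult_left_mono power_mono simp: norm_mult power_mult_distrib mult.commute[of _ "(cmod (a _))\<^sup>2"])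
    have "(c\<^sup>2 * d * A\<^sup>2) * (\<Sum>n<N. (cmod (a n))\<^sup>2) = c\<^sup>2 * (d * (A\<^sup>2 * (\<Sum>n<N. (cmod (a n))\<^sup>2)))" by simp
    also have "\<dots> \<le> c\<^sup>2 * (d * (\<Sum>n<N. (cmod (?a n))\<^sup>2))" using s(1) dD by (intro mult_left_mono) auto
    also have "\<dots> \<le> c\<^sup>2 * (hnorm H ?u)\<^sup>2" using b[where N=N and a="?a"] by (intro mult_left_mono) auto
    also have "\<dots> \<le> (hnorm K ?w)\<^sup>2" using power_mono[OF n(1) n0, of 2] by (simp add: power_mult_distrib)
    finally have 1: "(c\<^sup>2 * d * A\<^sup>2) * (\<Sum>n<N. (cmod (a n))\<^sup>2) \<le> (hnorm K ?w)\<^sup>2" .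
    have "(hnorm K ?w)\<^sup>2 \<le> C\<^sup>2 * (hnorm H ?u)\<^sup>2" using power_mono[OF n(2), of 2] n n0 by (simp add: power_mult_distrib)
    also have "\<dots> \<le> C\<^sup>2 * (D * (\<Sum>n<N. (cmod (?a n))\<^sup>2))" using b[where N=N and a="?a"] by (intro mult_left_mono) auto
    also have "\<dots> \<le> C\<^sup>2 * (D * (B\<^sup>2 * (\<Sum>n<N. (cmod (a n))\<^sup>2)))" using s(2) dD by (intro mult_left_mono) auto
    finally show ?thesis using 1 by (simp add: mult.assoc)
  qed
  have "0 < c\<^sup>2 * d * A\<^sup>2" "0 < C\<^sup>2 * D * B\<^sup>2" using c_pos C_pos dD A B by auto
  then have ex: "\<exists>c C. 0 < c \<and> 0 < C \<and> (\<forall>N a. c * (\<Sum>n<N. (cmod (a n))\<^sup>2) \<le> (hnorm K (\<lambda>r. \<Sum>n<N. a n * (\<alpha> n * P (x n) r)))\<^sup>2 \<and>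
        (hnorm K (\<lambda>r. \<Sum>n<N. a n * (\<alpha> n * P (x n) r)))\<^sup>2 \<le> C * (\<Sum>n<N. (cmod (a n))\<^sup>2))"
    using est by blast
  have "total_seq H x" using R by (simp add: riesz_basis_def)
  from total_seq_transport[OF this x \<alpha>0] show ?thesis
    unfolding riesz_basis_def by (intro conjI allI mem ex)
qed

end

context semi_ip
begin

text \<open>The identity is a transport of the space to itself, so this is the multiplier part of
  \<open>riesz_basis_transport\<close> alone.\<close>

lemma riesz_basis_rescale:
  assumes R: "riesz_basis H x" and A: "0 < A" and \<alpha>: "\<And>n. A \<le> cmod (\<alpha> n)" "\<And>n. cmod (\<alpha> n) \<le> B"
  shows "riesz_basis H (\<lambda>n t. \<alpha> n * x n t)"
proof -
  interpret I: transport H H False "\<lambda>r. r" "\<lambda>r. r" by unfold_locales auto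
  interpret I: norm_transport H H False "\<lambda>r. r" "\<lambda>r. r" 1 1
    by unfold_locales (auto simp: I.Q_def cnj_if_const)
  show ?thesis using I.riesz_basis_transport[OF assms] by (simp add: I.P_def cnj_if_const)
qed

lemma riesz_basis_normalize:
  assumes R: "riesz_basis H x" shows "riesz_basis H (normalize_seq H x)"
proof -
  obtain c C where cC: "0 < c" "0 < C" "\<And>n. c \<le> hnorm H (x n)" "\<And>n. hnorm H (x n) \<le> C"
    by (rule riesz_basis_norms[OF R]) (rule that)
  have p: "hnorm H (x n) > 0" for n using cC(1) cC(3)[of n] by linarith
  have "riesz_basis H (\<lambda>n t. (1 / of_real (hnorm H (x n))) * x n t)"
    by (rule riesz_basis_rescale[OF R, of "1 / C" _ "1 / c"])
       (use cC p in \<open>auto simp: norm_divide frac_le less_imp_le\<close>)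
  then show ?thesis by (simp add: normalize_seq_def[abs_def])
qed

text \<open>Normalizing moves \<open>x n\<close> by the distance of its norm from 1, which is at
  most its distance to the unit vector \<open>e n\<close>. Each distance is therefore at most
  doubled, and its square grows by at most the factor 4.\<close>

lemma quadratically_close_normalize:
  assumes e: "\<And>n. e n \<in> elems H" "\<And>n. hnorm H (e n) = 1" and x: "\<And>n. x n \<in> elems H" "\<And>n. hnorm H (x n) \<noteq> 0"
    and q: "quadratically_close H e x"
  shows "quadratically_close H e (normalize_seq H x)"
proof -
  have sm: "summable (\<lambda>n. 4 * (hnorm H (\<lambda>t. e n t - x n t))\<^sup>2)"
    using q by (auto simp: quadratically_close_def)
  have b: "(hnorm H (\<lambda>t. e n t - normalize_seq H x n t))\<^sup>2 \<le> 4 * (hnorm H (\<lambda>t. e n t - x n t))\<^sup>2" for n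
  proof -
    let ?N = "hnorm H (x n)"
    let ?c = "1 / of_real ?N :: complex"
    have nx: "normalize_seq H x n = (\<lambda>t. ?c * x n t)" by (simp add: normalize_seq_def)
    have m: "normalize_seq H x n \<in> elems H" unfolding nx by (rule cmult_mem[OF x(1)])
    have pos: "?N > 0" using hnorm_nonneg[OF x(1)] x(2)[of n] by (simp add: less_le)
    have "hnorm H (\<lambda>t. x n t - normalize_seq H x n t) = hnorm H (\<lambda>t. (1 - ?c) * x n t)"
      by (simp add: nx left_diff_distrib)
    also have "\<dots> = cmod (1 - ?c) * ?N" by (rule hnorm_cmult[OF x(1)])
    also have "cmod (1 - ?c) = \<bar>1 - 1 / ?N\<bar>"
      by (metis norm_of_real of_real_1 of_real_diff of_real_divide)
    also have "\<bar>1 - 1 / ?N\<bar> * ?N = \<bar>?N - 1\<bar>" 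
      using pos by (simp add: abs_mult_pos' abs_if field_simps split: if_splits)
    also have "\<dots> \<le> hnorm H (\<lambda>t. e n t - x n t)"
      using hnorm_reverse_triangle[OF e(1) x(1), of n n] e(2)[of n] by simp
    finally have "hnorm H (\<lambda>t. e n t - normalize_seq H x n t) \<le> 2 * hnorm H (\<lambda>t. e n t - x n t)"
      using hnorm_diff_triangle[OF e(1) x(1) m, of n n] by simp
    then have "(hnorm H (\<lambda>t. e n t - normalize_seq H x n t))\<^sup>2 \<le> (2 * hnorm H (\<lambda>t. e n t - x n t))\<^sup>2"
      by (rule power_mono) (rule hnorm_nonneg[OF diff_mem[OF e(1) m]])
    then show ?thesis by (simp add: power_mult_distrib)
  qed
  show ?thesis unfolding quadratically_close_def
    by (rule summable_comparison_test'[OF sm, of 0]) (use b in auto)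
qed

lemma quadratically_close_commute:
  assumes x: "\<And>n. x n \<in> elems H" and y: "\<And>n. y n \<in> elems H" and q: "quadratically_close H x y"
  shows "quadratically_close H y x"
  using q hnorm_diff_commute[OF x y] by (simp add: quadratically_close_def)

end

text \<open>The constant \<kappa> accommodates the factor \<delta> that the substitution leaves in
  the weighted \<open>L2\<close> product; the flag \<open>b\<close> admits conjugate-linear
  isometries.\<close>

locale isometry = transport +
  fixes \<kappa> :: real
  assumes kappa_pos: "0 < \<kappa>"
    and elems_iff: "v \<in> elems K \<longleftrightarrow> Q v \<in> elems H"
    and ip_transport: "v \<in> elems K \<Longrightarrow> w \<in> elems K \<Longrightarrow> ip K v w = of_real \<kappa> * \<sigma> (ip H (Q v) (Q w))"
begin

lemma hnorm_transport: "v \<in> elems K \<Longrightarrow> hnorm K v = sqrt \<kappa> * hnorm H (Q v)"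
  using ip_transport[of v v] by (simp add: hnorm_def real_sqrt_mult)

sublocale norm_transport H K b \<tau> \<rho> "sqrt \<kappa>" "sqrt \<kappa>"
  by unfold_locales (use kappa_pos elems_iff hnorm_transport in auto)

text \<open>\<open>P\<close> rescaled so that norms are preserved exactly; orthonormal sequences
  then stay orthonormal.\<close>

definition S where "S u = (\<lambda>r. of_real (1 / sqrt \<kappa>) * P u r)"

lemma Q_S: "Q (S u) = (\<lambda>t. of_real (1 / sqrt \<kappa>) * u t)"
  by (simp add: S_def Q_def P_def tau_rho)

lemma S_mem: "u \<in> elems H \<Longrightarrow> S u \<in> elems K"
  unfolding elems_iff Q_S by (rule cmult_mem)

lemma P_mem: "u \<in> elems H \<Longrightarrow> P u \<in> elems K"
  unfolding elems_iff by simp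

lemma ip_S:
  assumes u: "u \<in> elems H" and v: "v \<in> elems H" shows "ip K (S u) (S v) = \<sigma> (ip H u v)"
proof -
  have k: "of_real \<kappa> * (of_real (1 / sqrt \<kappa>) * of_real (1 / sqrt \<kappa>)) = (1::complex)"
    using kappa_pos unfolding of_real_mult[symmetric] by simp
  have "ip K (S u) (S v) = of_real \<kappa> * (of_real (1 / sqrt \<kappa>) * of_real (1 / sqrt \<kappa>)) * \<sigma> (ip H u v)"
    unfolding ip_transport[OF S_mem[OF u] S_mem[OF v]] Q_S
    by (subst ip_cmult[OF u cmult_mem[OF v]], subst ip_cmult_right[OF v u]) (simp del: of_real_divide)
  then show ?thesis unfolding k by simp
qed

lemma hnorm_S: "u \<in> elems H \<Longrightarrow> hnorm K (S u) = hnorm H u"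
  using ip_S[of u u] by (simp add: hnorm_def)

lemma normalize_seq_transport:
  assumes "x n \<in> elems H"
  shows "normalize_seq K (\<lambda>n. P (x n)) n = S (normalize_seq H x n)"
proof -
  have "hnorm K (P (x n)) = sqrt \<kappa> * hnorm H (x n)" using hnorm_transport[OF P_mem[OF assms]] by simp
  then show ?thesis by (simp add: normalize_seq_def S_def P_def)
qed

lemma riesz_basis_S: "riesz_basis H x \<Longrightarrow> riesz_basis K (\<lambda>n. S (x n))"
  unfolding S_def
  by (rule riesz_basis_transport[of x "1 / sqrt \<kappa>" "\<lambda>_. of_real (1 / sqrt \<kappa>)" "1 / sqrt \<kappa>"])
     (use kappa_pos in \<open>auto simp: norm_divide\<close>)

lemma total_seq_S: "total_seq H x \<Longrightarrow> (\<And>n. x n \<in> elems H) \<Longrightarrow> total_seq K (\<lambda>n. S (x n))"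
  unfolding S_def using kappa_pos
  by (intro total_seq_transport[of x "\<lambda>_. of_real (1 / sqrt \<kappa>)"]) auto

lemma orthonormal_basis_S: "orthonormal_basis H e \<Longrightarrow> orthonormal_basis K (\<lambda>n. S (e n))"
  unfolding orthonormal_basis_def using S_mem ip_S total_seq_S by auto

lemma orthogonal_basis_S: "orthogonal_basis H e \<Longrightarrow> orthogonal_basis K (\<lambda>n. S (e n))"
  unfolding orthogonal_basis_def using S_mem ip_S total_seq_S hnorm_S by auto

lemma quadratically_close_S:
  assumes "\<And>n. x n \<in> elems H" "\<And>n. y n \<in> elems H" "quadratically_close H x y"
  shows "quadratically_close K (\<lambda>n. S (x n)) (\<lambda>n. S (y n))"
proof -
  have "(\<lambda>t. S (x n) t - S (y n) t) = S (\<lambda>t. x n t - y n t)" for n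
    by (simp add: S_def P_def right_diff_distrib)
  then have "hnorm K (\<lambda>t. S (x n) t - S (y n) t) = hnorm H (\<lambda>t. x n t - y n t)" for n
    using hnorm_S[OF diff_mem[OF assms(1,2)]] by simp
  then show ?thesis using assms(3) by (simp add: quadratically_close_def)
qed

lemma bari_basis_S: "bari_basis H x \<Longrightarrow> bari_basis K (\<lambda>n. S (x n))"
  unfolding bari_basis_def
  using riesz_basis_S orthonormal_basis_S quadratically_close_S
  by (metis (no_types, lifting) orthonormal_basis_def riesz_basis_def)

end

section \<open>Transport of operators and root vectors\<close>

lemma shift_iff: "(u, w) \<in> shift_op C z \<longleftrightarrow> (u, \<lambda>t. w t + z * u t) \<in> C"
proof
  assume "(u, w) \<in> shift_op C z"
  then obtain f where "(u, f) \<in> C" "w = (\<lambda>t. f t - z * u t)" by (auto simp: shift_op_def)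
  then show "(u, \<lambda>t. w t + z * u t) \<in> C" by simp
next
  assume "(u, \<lambda>t. w t + z * u t) \<in> C"
  then show "(u, w) \<in> shift_op C z"
    unfolding shift_op_def mem_Collect_eq by (intro exI[of _ u] exI[of _ "\<lambda>t. w t + z * u t"]) simp
qed

text \<open>Up to the substitution, and conjugation if \<open>b\<close> holds, \<open>B\<close> is
  \<open>A\<close> divided by \<open>s\<close>. The law for inner products is required of all
  functions because \<open>eigenvector\<close> and \<open>finite_basis\<close> take norms without
  asking for membership.\<close>

locale op_transport = isometry +
  fixes A B :: oper and s :: real
  assumes s_pos: "0 < s"
    and B_iff: "(u, f) \<in> B \<longleftrightarrow> (Q u, \<lambda>t. of_real s * Q f t) \<in> A"
    and A_cmult: "(u, f) \<in> A \<Longrightarrow> (\<lambda>t. c * u t, \<lambda>t. c * f t) \<in> A"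
    and A_mem: "(u, f) \<in> A \<Longrightarrow> u \<in> elems H \<and> f \<in> elems H"
    and ip_transport_all: "ip K v w = of_real \<kappa> * \<sigma> (ip H (Q v) (Q w))"
begin

lemma norm_all: "hnorm K v = sqrt \<kappa> * hnorm H (Q v)"
  using ip_transport_all[of v v] by (simp add: hnorm_def real_sqrt_mult)

text \<open>The spectral parameter of \<open>A\<close> that corresponds to \<open>z\<close> for
  \<open>B\<close>; its inverse is \<open>zs\<close> below.\<close>

abbreviation sz where "sz z \<equiv> of_real s * \<sigma> z"

lemma B_P_iff: "(P u, P f) \<in> B \<longleftrightarrow> (u, \<lambda>t. of_real s * f t) \<in> A"
  by (simp add: B_iff)

lemma B_cmult: "(u, f) \<in> B \<Longrightarrow> (\<lambda>t. c * u t, \<lambda>t. c * f t) \<in> B"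
  using A_cmult[of "Q u" "\<lambda>t. of_real s * Q f t" "\<sigma> c"] unfolding B_iff by (simp add: Q_def mult.left_commute)

lemma eigenvector_transport: "eigenvector K B z u \<longleftrightarrow> eigenvector H A (sz z) (Q u)"
proof -
  have "(\<lambda>t. of_real s * Q (\<lambda>t. z * u t) t) = (\<lambda>t. sz z * Q u t)" by (simp add: Q_def mult.assoc)
  then show ?thesis using kappa_pos by (simp add: eigenvector_def B_iff norm_all)
qed

lemma shift_transport: "(u, w) \<in> shift_op B z \<longleftrightarrow> (Q u, \<lambda>t. of_real s * Q w t) \<in> shift_op A (sz z)"
proof -
  have "(\<lambda>t. of_real s * Q (\<lambda>t. w t + z * u t) t) = (\<lambda>t. of_real s * Q w t + sz z * Q u t)"
    by (simp add: Q_def algebra_simps)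
  then show ?thesis by (simp add: shift_iff B_iff)
qed

lemma shift_cmult: "(u, w) \<in> shift_op A z \<Longrightarrow> (\<lambda>t. c * u t, \<lambda>t. c * w t) \<in> shift_op A z"
  using A_cmult[of u "\<lambda>t. w t + z * u t" c] by (simp add: shift_iff algebra_simps)

text \<open>\<open>B - z\<close> corresponds to \<open>A - sz z\<close> divided by \<open>s\<close>,
  so each step of the iteration contributes one factor \<open>s\<close>.\<close>

lemma shift_power_forward:
  "(u, w) \<in> shift_op B z ^^ k \<Longrightarrow> (Q u, \<lambda>t. of_real (s ^ k) * Q w t) \<in> shift_op A (sz z) ^^ k"
proof (induction k arbitrary: w)
  case 0
  then show ?case by simp
next
  case (Suc k)
  then obtain v where v: "(u, v) \<in> shift_op B z ^^ k" "(v, w) \<in> shift_op B z" by auto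
  from shift_cmult[OF v(2)[unfolded shift_transport], of "of_real (s ^ k)"]
  have "(\<lambda>t. of_real (s ^ k) * Q v t, \<lambda>t. of_real (s ^ Suc k) * Q w t) \<in> shift_op A (sz z)"
    by (simp add: mult_ac)
  with Suc.IH[OF v(1)] show ?case by auto
qed

lemma shift_power_backward:
  "(Q u, w') \<in> shift_op A (sz z) ^^ k \<Longrightarrow> \<exists>w. w' = (\<lambda>t. of_real (s ^ k) * Q w t) \<and> (u, w) \<in> shift_op B z ^^ k"
proof (induction k arbitrary: w')
  case 0
  then show ?case by auto
next
  case (Suc k)
  then obtain v' where v': "(Q u, v') \<in> shift_op A (sz z) ^^ k" "(v', w') \<in> shift_op A (sz z)" by auto
  then obtain v where v: "v' = (\<lambda>t. of_real (s ^ k) * Q v t)" "(u, v) \<in> shift_op B z ^^ k" using Suc.IH by blast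
  \<comment> \<open>Every function lies in the range of \<open>Q\<close>, so the next element of the
    chain has a preimage, found by dividing out the accumulated power of \<open>s\<close>.\<close>
  define w where "w = P (\<lambda>t. w' t / of_real (s ^ Suc k))"
  have qw: "(\<lambda>t. of_real s * Q w t) = (\<lambda>t. (1 / of_real (s ^ k)) * w' t)"
    using s_pos by (auto simp: w_def)
  have "(\<lambda>t. (1 / of_real (s ^ k)) * v' t, \<lambda>t. (1 / of_real (s ^ k)) * w' t) \<in> shift_op A (sz z)"
    by (rule shift_cmult[OF v'(2)])
  moreover have "(\<lambda>t. (1 / of_real (s ^ k)) * v' t) = Q v" using s_pos by (simp add: v)
  ultimately have "(v, w) \<in> shift_op B z" unfolding shift_transport qw by simp
  then have "(u, w) \<in> shift_op B z ^^ Suc k" using v(2) by auto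
  moreover have "w' = (\<lambda>t. of_real (s ^ Suc k) * Q w t)" using s_pos by (auto simp: w_def)
  ultimately show ?case by blast
qed

lemma null_transport:
  assumes "a \<noteq> 0"
  shows "w \<in> elems K \<and> hnorm K w = 0 \<longleftrightarrow> (\<lambda>t. of_real a * Q w t) \<in> elems H \<and> hnorm H (\<lambda>t. of_real a * Q w t) = 0"
proof -
  have e: "(\<lambda>t. of_real a * Q w t) \<in> elems H \<longleftrightarrow> Q w \<in> elems H"
  proof
    assume "(\<lambda>t. of_real a * Q w t) \<in> elems H"
    from cmult_mem[OF this, of "1 / of_real a"] show "Q w \<in> elems H" using assms by simp
  qed (rule cmult_mem)
  have "hnorm H (\<lambda>t. of_real a * Q w t) = \<bar>a\<bar> * hnorm H (Q w)" if "Q w \<in> elems H"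
    using hnorm_cmult[OF that, of "of_real a"] by simp
  then show ?thesis using e assms kappa_pos by (auto simp: elems_iff norm_all)
qed

lemma root_space_transport: "u \<in> root_space K B z \<longleftrightarrow> Q u \<in> root_space H A (sz z)"
proof
  assume "u \<in> root_space K B z"
  then obtain k w where w: "(u, w) \<in> shift_op B z ^^ k" "w \<in> elems K" "hnorm K w = 0" by (auto simp: root_space_def)
  show "Q u \<in> root_space H A (sz z)"
    unfolding root_space_def mem_Collect_eq
    using shift_power_forward[OF w(1)] null_transport[of "s ^ k" w] s_pos w(2,3) by auto
next
  assume "Q u \<in> root_space H A (sz z)"
  then obtain k w' where w': "(Q u, w') \<in> shift_op A (sz z) ^^ k" "w' \<in> elems H" "hnorm H w' = 0" by (auto simp: root_space_def)
  obtain w where w: "w' = (\<lambda>t. of_real (s ^ k) * Q w t)" "(u, w) \<in> shift_op B z ^^ k"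
    using shift_power_backward[OF w'(1)] by blast
  have "w \<in> elems K \<and> hnorm K w = 0"
    using null_transport[of "s ^ k" w] w' s_pos unfolding w(1) by simp
  then show "u \<in> root_space K B z" using w(2) by (auto simp: root_space_def)
qed

lemma finite_basis_transport:
  assumes "finite_basis H (root_space H A (sz z)) I x"
  shows "finite_basis K (root_space K B z) I (\<lambda>n. P (x n))"
proof -
  have f: "finite I" and m: "\<And>n. n \<in> I \<Longrightarrow> x n \<in> root_space H A (sz z)"
    and ind: "\<And>c. hnorm H (\<lambda>t. \<Sum>n\<in>I. c n * x n t) = 0 \<Longrightarrow> \<forall>n\<in>I. c n = 0"
    and sp: "\<And>u. u \<in> root_space H A (sz z) \<Longrightarrow> \<exists>c. hnorm H (\<lambda>t. u t - (\<Sum>n\<in>I. c n * x n t)) = 0"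
    using assms unfolding finite_basis_def by auto
  have q: "Q (\<lambda>r. \<Sum>n\<in>I. c n * P (x n) r) = (\<lambda>t. \<Sum>n\<in>I. \<sigma> (c n) * x n t)" for c
    by (simp add: Q_def P_def tau_rho)
  have q': "Q (\<lambda>r. u r - (\<Sum>n\<in>I. c n * P (x n) r)) = (\<lambda>t. Q u t - (\<Sum>n\<in>I. \<sigma> (c n) * x n t))" for u c
    by (simp add: Q_def P_def tau_rho)
  show ?thesis
    unfolding finite_basis_def
  proof (intro conjI ballI allI impI f)
    show "P (x n) \<in> root_space K B z" if "n \<in> I" for n using m[OF that] by (simp add: root_space_transport)
    show "c n = 0" if "hnorm K (\<lambda>r. \<Sum>n\<in>I. c n * P (x n) r) = 0" "n \<in> I" for c n
    proof -
      have "\<forall>n\<in>I. \<sigma> (c n) = 0" using that(1) kappa_pos by (intro ind) (simp add: norm_all q)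
      then show ?thesis using that(2) by simp
    qed
    show "\<exists>c. hnorm K (\<lambda>r. u r - (\<Sum>n\<in>I. c n * P (x n) r)) = 0" if "u \<in> root_space K B z" for u
    proof -
      have "Q u \<in> root_space H A (sz z)" using that by (simp only: root_space_transport)
      from sp[OF this] obtain c where "hnorm H (\<lambda>t. Q u t - (\<Sum>n\<in>I. c n * x n t)) = 0" ..
      then have "hnorm K (\<lambda>r. u r - (\<Sum>n\<in>I. \<sigma> (c n) * P (x n) r)) = 0" by (simp add: norm_all q')
      then show ?thesis by (intro exI[of _ "\<lambda>n. \<sigma> (c n)"])
    qed
  qed
qed

lemma has_alg_mult_transport: "has_alg_mult H A (sz z) m \<Longrightarrow> has_alg_mult K B z m"
  unfolding has_alg_mult_def using finite_basis_transport by blast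

lemma ex_eigenvector_transport: "\<exists>u. eigenvector H A (sz z) u \<Longrightarrow> \<exists>u. eigenvector K B z u"
  using eigenvector_transport[of z] by (metis Q_P)

lemma simple_eigenvalue_transport: "simple_eigenvalue H A (sz z) \<Longrightarrow> simple_eigenvalue K B z"
  unfolding simple_eigenvalue_def using has_alg_mult_transport ex_eigenvector_transport by blast

lemma resolvent_transport: "z \<in> resolvent_set K B \<longleftrightarrow> sz z \<in> resolvent_set H A"
proof -
  have "(\<forall>g\<in>elems K. \<exists>u. (u, \<lambda>t. z * u t + g t) \<in> B) \<longleftrightarrow> (\<forall>g\<in>elems H. \<exists>u. (u, \<lambda>t. sz z * u t + g t) \<in> A)"
  proof -
    have e: "(\<lambda>t. of_real s * Q (\<lambda>t. z * u t + g t) t) = (\<lambda>t. sz z * Q u t + of_real s * Q g t)" for u g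
      by (simp add: Q_def algebra_simps)
    show ?thesis
    proof (intro iffI ballI)
      fix g assume L: "\<forall>g\<in>elems K. \<exists>u. (u, \<lambda>t. z * u t + g t) \<in> B" and g: "g \<in> elems H"
      let ?g = "P (\<lambda>t. 1 / of_real s * g t)"
      have "?g \<in> elems K" using cmult_mem[OF g] by (intro P_mem)
      then obtain u where "(u, \<lambda>t. z * u t + ?g t) \<in> B" using L by blast
      then have "(Q u, \<lambda>t. sz z * Q u t + g t) \<in> A" using s_pos by (simp add: B_iff e)
      then show "\<exists>u. (u, \<lambda>t. sz z * u t + g t) \<in> A" by (intro exI[of _ "Q u"])
    next
      fix g assume R: "\<forall>g\<in>elems H. \<exists>u. (u, \<lambda>t. sz z * u t + g t) \<in> A" and g: "g \<in> elems K"
      have "(\<lambda>t. of_real s * Q g t) \<in> elems H" using g by (intro cmult_mem) (simp add: elems_iff)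
      from bspec[OF R this] obtain u where u: "(u, \<lambda>t. sz z * u t + of_real s * Q g t) \<in> A" ..
      then have "(P u, \<lambda>t. z * P u t + g t) \<in> B" by (simp add: B_iff e)
      then show "\<exists>u. (u, \<lambda>t. z * u t + g t) \<in> B" by (intro exI[of _ "P u"])
    qed
  qed
  moreover have "(\<exists>C. \<forall>(u, f)\<in>B. hnorm K u \<le> C * hnorm K (\<lambda>t. f t - z * u t)) \<longleftrightarrow>
     (\<exists>C. \<forall>(u, f)\<in>A. hnorm H u \<le> C * hnorm H (\<lambda>t. f t - sz z * u t))"
  proof -
    have e: "hnorm K (\<lambda>t. f t - z * u t) = sqrt \<kappa> / s * hnorm H (\<lambda>t. of_real s * Q f t - sz z * Q u t)"
      if "(u, f) \<in> B" for u f
    proof -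
      have m: "Q u \<in> elems H" "(\<lambda>t. of_real s * Q f t) \<in> elems H" using A_mem that B_iff by auto
      have q: "Q (\<lambda>t. f t - z * u t) = (\<lambda>t. of_real (1 / s) * (of_real s * Q f t - sz z * Q u t))"
        using s_pos by (simp add: Q_def diff_divide_distrib)
      show ?thesis unfolding norm_all q
        by (subst hnorm_cmult[OF diff_mem[OF m(2) cmult_mem[OF m(1)]]]) (use s_pos in \<open>simp add: norm_divide\<close>)
    qed
    have sk: "sqrt \<kappa> > 0" using kappa_pos by simp
    show ?thesis
    proof (intro iffI; elim exE)
      fix C assume C: "\<forall>(u, f)\<in>B. hnorm K u \<le> C * hnorm K (\<lambda>t. f t - z * u t)"
      have "hnorm H u \<le> (C / s) * hnorm H (\<lambda>t. f t - sz z * u t)" if "(u, f) \<in> A" for u f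
      proof -
        let ?f = "P (\<lambda>t. 1 / of_real s * f t)"
        have b: "(P u, ?f) \<in> B" using that s_pos by (simp add: B_iff)
        have "sqrt \<kappa> * hnorm H u \<le> C * (sqrt \<kappa> / s * hnorm H (\<lambda>t. f t - sz z * u t))"
          using C b e[OF b] s_pos by (auto simp: norm_all)
        then have "sqrt \<kappa> * hnorm H u \<le> sqrt \<kappa> * ((C / s) * hnorm H (\<lambda>t. f t - sz z * u t))" by (simp add: mult_ac)
        then show ?thesis using sk by (simp only: mult_le_cancel_left_pos)
      qed
      then show "\<exists>C. \<forall>(u, f)\<in>A. hnorm H u \<le> C * hnorm H (\<lambda>t. f t - sz z * u t)" by blast
    next
      fix C assume C: "\<forall>(u, f)\<in>A. hnorm H u \<le> C * hnorm H (\<lambda>t. f t - sz z * u t)"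
      have "hnorm K u \<le> (C * s) * hnorm K (\<lambda>t. f t - z * u t)" if b: "(u, f) \<in> B" for u f
      proof -
        have "(Q u, \<lambda>t. of_real s * Q f t) \<in> A" using b B_iff by simp
        from bspec[OF C this] have "hnorm H (Q u) \<le> C * hnorm H (\<lambda>t. of_real s * Q f t - sz z * Q u t)"
          by (simp only: prod.case)
        then have "sqrt \<kappa> * hnorm H (Q u) \<le> sqrt \<kappa> * (C * hnorm H (\<lambda>t. of_real s * Q f t - sz z * Q u t))"
          using sk by (simp only: mult_le_cancel_left_pos)
        then show ?thesis unfolding e[OF b] norm_all[of u] using s_pos by (simp add: mult_ac)
      qed
      then show "\<exists>C. \<forall>(u, f)\<in>B. hnorm K u \<le> C * hnorm K (\<lambda>t. f t - z * u t)" by blast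
    qed
  qed
  ultimately show ?thesis by (simp add: resolvent_set_def)
qed

lemma spectrum_transport: "z \<in> spectrum K B \<longleftrightarrow> sz z \<in> spectrum H A"
  by (simp add: spectrum_def resolvent_transport)

definition zs where "zs z = \<sigma> z / of_real s"

lemma sz_zs [simp]: "sz (zs z) = z" using s_pos by (simp add: zs_def)
lemma zs_sz [simp]: "zs (sz z) = z" using s_pos by (simp add: zs_def)

lemma zs_inj: "zs z = zs w \<longleftrightarrow> z = w" using s_pos by (simp add: zs_def sg_eq_iff)

text \<open>Spectrum, multiplicities and bases correspond under \<open>zs\<close>; in the chain
  relation the division by \<open>s\<close> and the possible conjugation act on the factor as well,
  which becomes \<open>zs k\<close>.\<close>

theorem root_pairs_transport:
  assumes R: "root_pairs_factor k H A lam phi"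
  shows "root_pairs_factor (zs k) K B (\<lambda>n. zs (lam n)) (\<lambda>n. P (phi n))"
proof -
  have s1: "countable (spectrum H A)"
    and s2: "\<And>z. z \<in> spectrum H A \<Longrightarrow> (\<exists>u. eigenvector H A z u) \<and> (\<exists>m. has_alg_mult H A z m)"
    and s3: "range lam = spectrum H A"
    and s4: "\<And>m. finite {n. lam n = lam m} \<and> has_alg_mult H A (lam m) (card {n. lam n = lam m})"
    and s5: "\<And>m. finite_basis H (root_space H A (lam m)) {n. lam n = lam m} phi"
    and s6: "\<And>n. eigenvector H A (lam (Suc n)) (phi (Suc n)) \<or>
          (phi (Suc n), \<lambda>t. lam (Suc n) * phi (Suc n) t + k * phi n t) \<in> A"
    using R unfolding root_pairs_factor_def by blast+
  have sp: "spectrum K B = zs ` spectrum H A"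
  proof (intro equalityI subsetI)
    fix z assume "z \<in> spectrum K B"
    then show "z \<in> zs ` spectrum H A" by (intro image_eqI[where x="sz z"]) (simp_all only: zs_sz spectrum_transport)
  next
    fix z assume "z \<in> zs ` spectrum H A"
    then show "z \<in> spectrum K B" by (auto simp del: cnj_if_simps simp: spectrum_transport)
  qed
  have set: "{n. zs (lam n) = zs (lam m)} = {n. lam n = lam m}" for m by (simp add: zs_inj)
  show ?thesis
    unfolding root_pairs_factor_def set
  proof (intro conjI ballI allI)
    show "countable (spectrum K B)" using s1 by (simp add: sp)
    show "range (\<lambda>n. zs (lam n)) = spectrum K B" unfolding sp s3[symmetric] by auto
    fix z assume "z \<in> spectrum K B"
    then have "sz z \<in> spectrum H A" by (simp only: spectrum_transport)
    with s2[OF this] show "\<exists>u. eigenvector K B z u" "\<exists>m. has_alg_mult K B z m"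
      using ex_eigenvector_transport[of z] has_alg_mult_transport[of z] by blast+
  next
    fix m
    show "finite {n. lam n = lam m}" using s4 by blast
    show "has_alg_mult K B (zs (lam m)) (card {n. lam n = lam m})"
      by (rule has_alg_mult_transport) (use s4[of m] in \<open>simp only: sz_zs\<close>)
    show "finite_basis K (root_space K B (zs (lam m))) {n. lam n = lam m} (\<lambda>n. P (phi n))"
      by (rule finite_basis_transport) (use s5[of m] in \<open>simp only: sz_zs\<close>)
  next
    fix n
    have e: "(P (phi (Suc n)), \<lambda>t. zs (lam (Suc n)) * P (phi (Suc n)) t + zs k * P (phi n) t) \<in> B"
      if "(phi (Suc n), \<lambda>t. lam (Suc n) * phi (Suc n) t + k * phi n t) \<in> A"
    proof -
      have "(\<lambda>t. zs (lam (Suc n)) * P (phi (Suc n)) t + zs k * P (phi n) t)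
         = P (\<lambda>t. 1 / of_real s * (lam (Suc n) * phi (Suc n) t + k * phi n t))"
        using s_pos by (simp add: P_def zs_def field_simps)
      then show ?thesis using that s_pos by (simp add: B_P_iff)
    qed
    have "eigenvector K B (zs (lam (Suc n))) (P (phi (Suc n))) \<longleftrightarrow> eigenvector H A (lam (Suc n)) (phi (Suc n))"
      by (simp only: eigenvector_transport sz_zs Q_P)
    then show "eigenvector K B (zs (lam (Suc n))) (P (phi (Suc n))) \<or>
       (P (phi (Suc n)), \<lambda>t. zs (lam (Suc n)) * P (phi (Suc n)) t + zs k * P (phi n) t) \<in> B"
      using s6[of n] e by blast
  qed
qed

text \<open>The positive factors \<kappa> and \<open>s\<close> appear on both sides of the adjoint
  relation and cancel, so the adjoints are related in the same way as the operators.\<close>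

lemma adjoint_transport:
  "(v, w) \<in> adjoint_op K B \<longleftrightarrow> (Q v, \<lambda>t. of_real s * Q w t) \<in> adjoint_op H A"
proof -
  have key: "ip K f v = ip K u w \<longleftrightarrow> ip H (\<lambda>t. of_real s * Q f t) (Q v) = ip H (Q u) (\<lambda>t. of_real s * Q w t)"
    if b: "(u, f) \<in> B" and v: "Q v \<in> elems H" and w: "Q w \<in> elems H" for u f
  proof -
    have m: "Q u \<in> elems H" "(\<lambda>t. of_real s * Q f t) \<in> elems H" using A_mem b B_iff by auto
    from cmult_mem[OF m(2), of "1 / of_real s"] have f: "Q f \<in> elems H" using s_pos by simp
    show ?thesis
      unfolding ip_transport_all ip_cmult[OF f v] ip_cmult_right[OF w m(1)]
      using kappa_pos s_pos by (simp add: sg_eq_iff)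
  qed
  have e: "(\<lambda>t. of_real s * Q w t) \<in> elems H \<longleftrightarrow> Q w \<in> elems H"
  proof
    assume "(\<lambda>t. of_real s * Q w t) \<in> elems H"
    from cmult_mem[OF this, of "1 / of_real s"] show "Q w \<in> elems H" using s_pos by simp
  qed (rule cmult_mem)
  show ?thesis
  proof
    assume L: "(v, w) \<in> adjoint_op K B"
    then have m: "Q v \<in> elems H" "Q w \<in> elems H" by (auto simp: adjoint_op_def elems_iff)
    have "ip H f (Q v) = ip H u (\<lambda>t. of_real s * Q w t)" if "(u, f) \<in> A" for u f
    proof -
      let ?f = "P (\<lambda>t. 1 / of_real s * f t)"
      have b: "(P u, ?f) \<in> B" using that s_pos by (simp add: B_iff)
      then have "ip K ?f v = ip K (P u) w" using L by (auto simp: adjoint_op_def)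
      then show ?thesis using key[OF b m] s_pos by simp
    qed
    then show "(Q v, \<lambda>t. of_real s * Q w t) \<in> adjoint_op H A" using m e by (auto simp: adjoint_op_def)
  next
    assume R: "(Q v, \<lambda>t. of_real s * Q w t) \<in> adjoint_op H A"
    then have m: "Q v \<in> elems H" "Q w \<in> elems H" using e by (auto simp: adjoint_op_def)
    have "ip K f v = ip K u w" if b: "(u, f) \<in> B" for u f
      using R b unfolding key[OF b m] adjoint_op_def B_iff by blast
    then show "(v, w) \<in> adjoint_op K B" using m by (auto simp: adjoint_op_def elems_iff)
  qed
qed

end

lemma (in semi_ip) adjoint_cmult:
  assumes A: "\<And>u f. (u, f) \<in> A \<Longrightarrow> u \<in> elems H \<and> f \<in> elems H" and vw: "(v, w) \<in> adjoint_op H A"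
  shows "(\<lambda>t. c * v t, \<lambda>t. c * w t) \<in> adjoint_op H A"
  using vw A by (fastforce simp: adjoint_op_def cmult_mem ip_cmult_right)

text \<open>Jordan chains are rescaled step by step, starting anew with factor 1 at each eigenvector.\<close>

lemma root_pairs_rescale:
  assumes R: "root_pairs_factor (of_real k) K B lam phi" and k: "0 < k"
    and B: "\<And>u f c. (u, f) \<in> B \<Longrightarrow> (\<lambda>t. c * u t, \<lambda>t. c * f t) \<in> B"
    and sub: "\<And>z u c. u \<in> root_space K B z \<Longrightarrow> (\<lambda>t. c * u t) \<in> root_space K B z"
  obtains s :: "nat \<Rightarrow> real" where "\<And>n. 0 < s n" "\<And>n. eigenvector K B (lam n) (phi n) \<Longrightarrow> s n = 1"
    "root_pairs K B lam (\<lambda>n r. of_real (s n) * phi n r)"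
proof -
  \<comment> \<open>Along a chain \<open>s (Suc n) * k = s n\<close>, which absorbs the factor
    \<open>k\<close>. At an eigenvector no relation to the previous element is demanded, so the
    scale may restart at 1.\<close>
  define s :: "nat \<Rightarrow> real" where
    "s = rec_nat 1 (\<lambda>n x. if eigenvector K B (lam (Suc n)) (phi (Suc n)) then 1 else x / k)"
  have s0: "s 0 = 1" and sS: "s (Suc n) = (if eigenvector K B (lam (Suc n)) (phi (Suc n)) then 1 else s n / k)" for n
    by (simp_all add: s_def)
  have pos: "0 < s n" for n by (induction n) (use k in \<open>auto simp: s0 sS\<close>)
  have one: "s n = 1" if "eigenvector K B (lam n) (phi n)" for n using that by (cases n) (auto simp: s0 sS)
  have fb: "finite_basis K (root_space K B z) I (\<lambda>n r. of_real (s n) * phi n r)"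
    if F: "finite_basis K (root_space K B z) I phi" for z I
    unfolding finite_basis_def
  proof (intro conjI ballI allI impI)
    have ind: "\<And>c. hnorm K (\<lambda>t. \<Sum>n\<in>I. c n * phi n t) = 0 \<Longrightarrow> \<forall>n\<in>I. c n = 0"
      and sp: "\<And>u. u \<in> root_space K B z \<Longrightarrow> \<exists>c. hnorm K (\<lambda>t. u t - (\<Sum>n\<in>I. c n * phi n t)) = 0"
      using F by (auto simp: finite_basis_def)
    show "finite I" using F by (simp add: finite_basis_def)
    show "(\<lambda>r. of_real (s n) * phi n r) \<in> root_space K B z" if "n \<in> I" for n
      using F that by (intro sub) (simp add: finite_basis_def)
    show "c n = 0" if h: "hnorm K (\<lambda>t. \<Sum>n\<in>I. c n * (of_real (s n) * phi n t)) = 0" and n: "n \<in> I" for c n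
    proof -
      have "hnorm K (\<lambda>t. \<Sum>n\<in>I. (c n * of_real (s n)) * phi n t) = 0" using h by (simp add: mult.assoc)
      then have "c n * of_real (s n) = 0"
        using ind[of "\<lambda>n. c n * of_real (s n)"] n by simp
      then show ?thesis using pos[of n] by simp
    qed
    show "\<exists>c. hnorm K (\<lambda>t. u t - (\<Sum>n\<in>I. c n * (of_real (s n) * phi n t))) = 0" if u: "u \<in> root_space K B z" for u
    proof -
      obtain c where "hnorm K (\<lambda>t. u t - (\<Sum>n\<in>I. c n * phi n t)) = 0"
        using sp[OF u] ..
      moreover have "c n / of_real (s n) * (of_real (s n) * phi n t) = c n * phi n t" for n t using pos[of n] by simp
      ultimately show ?thesis by (intro exI[of _ "\<lambda>n. c n / of_real (s n)"]) simp
    qed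
  qed
  have ch: "eigenvector K B (lam (Suc n)) (\<lambda>r. of_real (s (Suc n)) * phi (Suc n) r) \<or>
      (\<lambda>r. of_real (s (Suc n)) * phi (Suc n) r,
       \<lambda>t. lam (Suc n) * (of_real (s (Suc n)) * phi (Suc n) t) + 1 * (of_real (s n) * phi n t)) \<in> B" for n
  proof (cases "eigenvector K B (lam (Suc n)) (phi (Suc n))")
    case True
    then show ?thesis by (simp add: sS)
  next
    case False
    then have c: "(phi (Suc n), \<lambda>t. lam (Suc n) * phi (Suc n) t + of_real k * phi n t) \<in> B"
      using R unfolding root_pairs_factor_def by blast
    have "of_real (s (Suc n)) * (lam (Suc n) * phi (Suc n) t + of_real k * phi n t) =
      lam (Suc n) * (of_real (s (Suc n)) * phi (Suc n) t) + 1 * (of_real (s n) * phi n t)" for t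
      using False k by (simp add: sS field_simps)
    then show ?thesis using B[OF c, of "of_real (s (Suc n))"] by simp
  qed
  have "root_pairs K B lam (\<lambda>n r. of_real (s n) * phi n r)"
    using R fb ch unfolding root_pairs_factor_def by simp
  with pos one show ?thesis by (rule that)
qed

section \<open>The spaces as instances\<close>

lemma L2_space_simps [simp]: "elems (L2_space a b w) = L2 a b" "ip (L2_space a b w) = L2_ip a b w"
  by (simp_all add: L2_space_def)

lemma H1_space_simps [simp]: "elems (H1_space a b p q) = H1 a b"
    "ip (H1_space a b p q) u v = L2_ip a b p (wderiv a b u) (wderiv a b v) + L2_ip a b q u v"
  by (simp_all add: H1_space_def)

lemma L2_ip_one: "L2_ip a b (\<lambda>_. 1) u v = (LINT x|leb a b. u x * cnj (v x))"
  by (simp add: L2_ip_def)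

lemma L2_ip_cnj: "L2_ip a b (\<lambda>_. 1) (\<lambda>t. cnj (u t)) (\<lambda>t. cnj (v t)) = cnj (L2_ip a b (\<lambda>_. 1) u v)"
  unfolding L2_ip_one by (simp flip: Bochner_Integration.integral_cnj)

lemma L2_ip_self: "L2_ip a b w u u = of_real (LINT x|leb a b. w x * (cmod (u x))\<^sup>2)"
proof -
  have "of_real (w x) * u x * cnj (u x) = of_real (w x * (cmod (u x))\<^sup>2)" for x
    using complex_norm_square[of "u x"] by (simp add: mult.assoc)
  then show ?thesis by (simp only: L2_ip_def integral_complex_of_real)
qed

lemma L2_ip_const: "L2_ip a b (\<lambda>_. k) u v = of_real k * L2_ip a b (\<lambda>_. 1) u v"
  unfolding L2_ip_def by (subst Bochner_Integration.integral_mult_right_zero[symmetric]) (simp add: mult.assoc)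

lemma L2_ip_cong_AE:
  assumes "AE x in leb a b. u x = u' x" "AE x in leb a b. v x = v' x" "AE x in leb a b. w x = w' x"
    and "u \<in> L2 a b" "v \<in> L2 a b" "w \<in> borel_measurable (leb a b)" "w' \<in> borel_measurable (leb a b)"
  shows "L2_ip a b w u v = L2_ip a b w' u' v'"
proof -
  have "u' \<in> L2 a b" "v' \<in> L2 a b" using L2_AE assms by blast+
  then have [measurable]: "u \<in> borel_measurable (leb a b)" "v \<in> borel_measurable (leb a b)"
     "u' \<in> borel_measurable (leb a b)" "v' \<in> borel_measurable (leb a b)" using assms by (auto simp: L2_def)
  have cm: "cnj \<in> borel_measurable borel" by (intro borel_measurable_continuous_onI continuous_on_cnj continuous_on_id)
  have [measurable]: "(\<lambda>x. cnj (v x)) \<in> borel_measurable (leb a b)"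
    by (rule measurable_compose[OF _ cm]) fact
  have [measurable]: "(\<lambda>x. cnj (v' x)) \<in> borel_measurable (leb a b)"
    by (rule measurable_compose[OF _ cm]) fact
  have [measurable]: "w \<in> borel_measurable (leb a b)" "w' \<in> borel_measurable (leb a b)" by fact+
  show ?thesis unfolding L2_ip_def
  proof (rule integral_cong_AE)
    show "AE x in leb a b. of_real (w x) * u x * cnj (v x) = of_real (w' x) * u' x * cnj (v' x)"
      using assms(1-3) by eventually_elim simp
  qed measurable
qed

lemma hnorm_L2_std: "hnorm (L2_std a b) u = sqrt (LINT x|leb a b. (cmod (u x))\<^sup>2)"
  by (simp add: hnorm_def L2_ip_self)

lemma semi_ip_L2_std: "semi_ip (L2_std a b)"
proof
  fix u v w c
  { assume "u \<in> elems (L2_std a b)" "v \<in> elems (L2_std a b)"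
    then show "(\<lambda>t. u t + v t) \<in> elems (L2_std a b)" by (simp add: L2_add) }
  { assume "u \<in> elems (L2_std a b)"
    then show "(\<lambda>t. c * u t) \<in> elems (L2_std a b)" by (simp add: L2_cmult) }
  { assume "u \<in> elems (L2_std a b)" "v \<in> elems (L2_std a b)" "w \<in> elems (L2_std a b)"
    then have "integrable (leb a b) (\<lambda>x. u x * cnj (w x))" "integrable (leb a b) (\<lambda>x. v x * cnj (w x))"
      by (simp_all add: L2_mult_integrable L2_cnj)
    then show "ip (L2_std a b) (\<lambda>t. u t + v t) w = ip (L2_std a b) u w + ip (L2_std a b) v w"
      by (simp add: L2_ip_one distrib_right) }
  { show "ip (L2_std a b) (\<lambda>t. c * u t) w = c * ip (L2_std a b) u w"
      by (simp add: L2_ip_one mult.assoc) }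
  { have "(LINT x|leb a b. v x * cnj (u x)) = (LINT x|leb a b. cnj (u x * cnj (v x)))" by (simp add: mult.commute)
    then show "ip (L2_std a b) v u = cnj (ip (L2_std a b) u v)"
      by (simp only: L2_space_simps L2_ip_one Bochner_Integration.integral_cnj) }
  { show "0 \<le> Re (ip (L2_std a b) u u)" by (simp add: L2_ip_self) }
qed simp

interpretation L2s: semi_ip "L2_std a b" for a b by (rule semi_ip_L2_std)

lemma semi_ip_H1_std:
  assumes ab: "a < b" shows "semi_ip (H1_std a b)"
proof
  note w = wderiv_H1(1)
  have I: "L2_ip a b (\<lambda>_. 1) (\<lambda>t. u t + v t) w = L2_ip a b (\<lambda>_. 1) u w + L2_ip a b (\<lambda>_. 1) v w"
    if "u \<in> L2 a b" "v \<in> L2 a b" "w \<in> L2 a b" for u v w using L2s.ip_add[of u a b v w] that by simp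
  have C: "L2_ip a b (\<lambda>_. 1) (\<lambda>t. c * u t) w = c * L2_ip a b (\<lambda>_. 1) u w"
    if "u \<in> L2 a b" "w \<in> L2 a b" for u w c using L2s.ip_cmult[of u a b w c] that by simp
  have J: "L2_ip a b (\<lambda>_. 1) v u = cnj (L2_ip a b (\<lambda>_. 1) u v)"
    if "u \<in> L2 a b" "v \<in> L2 a b" for u v using L2s.ip_cnj[of u a b v] that by simp
  have z: "(\<lambda>_. 0) \<in> H1 a b" by (rule H1_I(1)[where g="\<lambda>_. 0" and C=0]) (use ab in \<open>auto simp: prim_def intro!: AE_I2\<close>)
  then show "(\<lambda>_. 0) \<in> elems (H1_std a b)" by simp
  fix u v v' c
  { assume "u \<in> elems (H1_std a b)" "v \<in> elems (H1_std a b)"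
    then show "(\<lambda>t. u t + v t) \<in> elems (H1_std a b)" using H1_add(1)[OF _ _ ab] by simp }
  { assume "u \<in> elems (H1_std a b)"
    then show "(\<lambda>t. c * u t) \<in> elems (H1_std a b)" using H1_cmult(1)[OF _ ab] by simp }
  { assume "u \<in> elems (H1_std a b)" "v \<in> elems (H1_std a b)" "v' \<in> elems (H1_std a b)"
    then have u: "u \<in> H1 a b" "v \<in> H1 a b" "v' \<in> H1 a b" by simp_all
    have "L2_ip a b (\<lambda>_. 1) (wderiv a b (\<lambda>t. u t + v t)) (wderiv a b v') =
        L2_ip a b (\<lambda>_. 1) (\<lambda>t. wderiv a b u t + wderiv a b v t) (wderiv a b v')"
      by (rule L2_ip_cong_AE) (use H1_add[OF u(1,2) ab] u in \<open>auto intro!: w\<close>)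
    then show "ip (H1_std a b) (\<lambda>t. u t + v t) v' = ip (H1_std a b) u v' + ip (H1_std a b) v v'"
      using u by (simp add: I w H1_L2) }
  { assume "u \<in> elems (H1_std a b)" "v' \<in> elems (H1_std a b)"
    then have u: "u \<in> H1 a b" "v' \<in> H1 a b" by simp_all
    have "L2_ip a b (\<lambda>_. 1) (wderiv a b (\<lambda>t. c * u t)) (wderiv a b v') =
        L2_ip a b (\<lambda>_. 1) (\<lambda>t. c * wderiv a b u t) (wderiv a b v')"
      by (rule L2_ip_cong_AE) (use H1_cmult[OF u(1) ab] u in \<open>auto intro!: w\<close>)
    then show "ip (H1_std a b) (\<lambda>t. c * u t) v' = c * ip (H1_std a b) u v'"
      using u by (simp add: C w H1_L2 distrib_left) }
  { assume "u \<in> elems (H1_std a b)" "v \<in> elems (H1_std a b)"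
    then have u: "u \<in> H1 a b" "v \<in> H1 a b" by simp_all
    show "ip (H1_std a b) v u = cnj (ip (H1_std a b) u v)"
      unfolding H1_space_simps complex_cnj_add J[OF w[OF u(1)] w[OF u(2)]] J[OF H1_L2[OF u(1)] H1_L2[OF u(2)]] .. }
  { show "0 \<le> Re (ip (H1_std a b) u u)" by (simp add: L2_ip_self) }
qed

lemma hnorm_H1_std_sq: "(hnorm (H1_std a b) u)\<^sup>2 = (hnorm (L2_std a b) (wderiv a b u))\<^sup>2 + (hnorm (L2_std a b) u)\<^sup>2"
  by (simp add: hnorm_def L2_ip_self)

lemma L2_ip_weight_bounds:
  assumes m [measurable]: "m \<in> borel_measurable borel" and lo: "\<And>x. a < x \<Longrightarrow> x < b \<Longrightarrow> lo \<le> m x"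
    and hi: "\<And>x. a < x \<Longrightarrow> x < b \<Longrightarrow> m x \<le> hi" and lo0: "0 < lo" and u: "u \<in> L2 a b"
  shows "lo * (hnorm (L2_std a b) u)\<^sup>2 \<le> Re (L2_ip a b m u u)" "Re (L2_ip a b m u u) \<le> hi * (hnorm (L2_std a b) u)\<^sup>2"
proof -
  have i: "integrable (leb a b) (\<lambda>x. (cmod (u x))\<^sup>2)" using u by (simp add: L2_def)
  have "integrable (leb a b) (\<lambda>x. complex_of_real (m x) * complex_of_real ((cmod (u x))\<^sup>2))"
    by (rule integrable_leb_weight[OF m, of _ _ hi])
       (use lo hi lo0 i in \<open>fastforce simp del: of_real_power\<close>)+
  then have "integrable (leb a b) (\<lambda>x. complex_of_real (m x * (cmod (u x))\<^sup>2))" by simp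
  then have mi: "integrable (leb a b) (\<lambda>x. m x * (cmod (u x))\<^sup>2)" by (simp only: complex_of_real_integrable_eq)
  have n: "(hnorm (L2_std a b) u)\<^sup>2 = (LINT x|leb a b. (cmod (u x))\<^sup>2)" by (simp add: hnorm_L2_std)
  have "lo * (LINT x|leb a b. (cmod (u x))\<^sup>2) = (LINT x|leb a b. lo * (cmod (u x))\<^sup>2)" by simp
  also have "\<dots> \<le> (LINT x|leb a b. m x * (cmod (u x))\<^sup>2)"
    by (rule integral_mono_AE) (use i mi lo in \<open>auto intro!: AE_leb_I mult_right_mono\<close>)
  finally show "lo * (hnorm (L2_std a b) u)\<^sup>2 \<le> Re (L2_ip a b m u u)" unfolding n L2_ip_self by simp
  have "(LINT x|leb a b. m x * (cmod (u x))\<^sup>2) \<le> (LINT x|leb a b. hi * (cmod (u x))\<^sup>2)"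
    by (rule integral_mono_AE) (use i mi hi in \<open>auto intro!: AE_leb_I mult_right_mono\<close>)
  then show "Re (L2_ip a b m u u) \<le> hi * (hnorm (L2_std a b) u)\<^sup>2" unfolding n L2_ip_self by simp
qed

context annulus
begin

abbreviation tau where "tau r \<equiv> ln (r / r1) / \<delta>"

lemma transport_std: "semi_ip H \<Longrightarrow> transport H tau \<rho>"
  by (simp add: transport_def transport_axioms_def log_rho)

lemma P_eq_pull: "semi_ip H \<Longrightarrow> transport.P False tau = pull r1 r2"
  using transport.P_def[OF transport_std] by (simp add: fun_eq_iff pull_def cnj_if_const)

lemma Q_eq_push: "semi_ip H \<Longrightarrow> transport.Q False \<rho> = push r1 r2"
  using transport.Q_def[OF transport_std] by (simp add: fun_eq_iff push_eq cnj_if_const)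

end

section \<open>Totality of the cosines\<close>

text \<open>The limit inherits the bound by \<open>w\<close>, so four times the square of
  \<open>cmod (w x)\<close> dominates the squared differences.\<close>

lemma L2_dominated_convergence:
  assumes um: "\<And>n. U n \<in> borel_measurable (leb a b)" and u: "u \<in> borel_measurable (leb a b)" and w: "w \<in> L2 a b"
    and b: "\<And>n x. a < x \<Longrightarrow> x < b \<Longrightarrow> cmod (U n x) \<le> cmod (w x)"
    and lim: "AE x in leb a b. (\<lambda>n. U n x) \<longlonglongrightarrow> u x"
  shows "(\<lambda>n. hnorm (L2_std a b) (\<lambda>x. u x - U n x)) \<longlonglongrightarrow> 0"
proof -
  have [measurable]: "U n \<in> borel_measurable (leb a b)" "u \<in> borel_measurable (leb a b)" for n by fact+
  have ub: "AE x in leb a b. cmod (u x) \<le> cmod (w x)"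
  proof -
    have "AE x in leb a b. a < x \<and> x < b" by (rule AE_leb_I) auto
    with lim show ?thesis
    proof eventually_elim
      case (elim x)
      then show ?case using b by (intro LIMSEQ_le_const2[OF tendsto_norm[OF elim(1)]]) auto
    qed
  qed
  have "(\<lambda>n. LINT x|leb a b. (cmod (u x - U n x))\<^sup>2) \<longlonglongrightarrow> (LINT x|leb a b. 0)"
  proof (rule integral_dominated_convergence[where w="\<lambda>x. 4 * (cmod (w x))\<^sup>2"])
    show "integrable (leb a b) (\<lambda>x. 4 * (cmod (w x))\<^sup>2)" using w by (simp add: L2_def)
    show "AE x in leb a b. (\<lambda>n. (cmod (u x - U n x))\<^sup>2) \<longlonglongrightarrow> 0"
      using lim
    proof eventually_elim
      case (elim x)
      have "(\<lambda>n. (cmod (u x - U n x))\<^sup>2) \<longlonglongrightarrow> (cmod (u x - u x))\<^sup>2" by (intro tendsto_intros elim)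
      then show ?case by simp
    qed
    show "AE x in leb a b. norm ((cmod (u x - U n x))\<^sup>2) \<le> 4 * (cmod (w x))\<^sup>2" for n
    proof -
      have "AE x in leb a b. cmod (U n x) \<le> cmod (w x)" by (rule AE_leb_I) (rule b)
      with ub show ?thesis
      proof eventually_elim
        case (elim x)
        have "cmod (u x - U n x) \<le> 2 * cmod (w x)" using norm_triangle_ineq4[of "u x" "U n x"] elim by simp
        then have "(cmod (u x - U n x))\<^sup>2 \<le> (2 * cmod (w x))\<^sup>2" by (rule power_mono) simp
        then show ?case by (simp add: power_mult_distrib)
      qed
    qed
  qed measurable
  then have "(\<lambda>n. sqrt (LINT x|leb a b. (cmod (u x - U n x))\<^sup>2)) \<longlonglongrightarrow> sqrt 0"
    by (intro tendsto_real_sqrt) simp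
  then show ?thesis by (simp add: hnorm_L2_std)
qed

text \<open>The radial retraction onto the disc of radius \<open>k\<close>, written without case
  distinction so that its continuity is immediate.\<close>

definition truncate :: "real \<Rightarrow> complex \<Rightarrow> complex" where
  "truncate k z = of_real (1 / max 1 (cmod z / k)) * z"

lemma truncate_bounds: "0 < k \<Longrightarrow> cmod (truncate k z) \<le> k" "cmod (truncate k z) \<le> cmod z"
proof -
  have n: "cmod (truncate k z) = cmod z / max 1 (cmod z / k)"
    by (simp only: truncate_def norm_mult norm_of_real) simp
  show "cmod (truncate k z) \<le> cmod z" unfolding n by (simp add: divide_le_eq mult_le_cancel_left1)
  assume k: "0 < k"
  show "cmod (truncate k z) \<le> k" unfolding n using k by (auto simp: max_def field_simps)
qed

lemma truncate_eq: "0 < k \<Longrightarrow> cmod z \<le> k \<Longrightarrow> truncate k z = z"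
  by (simp add: truncate_def max_def)

lemma continuous_truncate: "0 < k \<Longrightarrow> continuous_on UNIV (truncate k)"
  unfolding truncate_def by (intro continuous_intros) auto

text \<open>Two dominated limits: truncation makes the function bounded, and a bounded measurable
  function is an almost everywhere limit of uniformly bounded continuous functions.\<close>

lemma L2_continuous_dense:
  assumes u: "u \<in> L2 a b" and e: "0 < e"
  shows "\<exists>F. continuous_on UNIV F \<and> hnorm (L2_std a b) (\<lambda>x. u x - F x) < e"
proof -
  have um: "u \<in> borel_measurable (leb a b)" using u by (rule L2_measurable)
  have tm: "truncate (real (Suc k)) \<in> borel_measurable borel" for k
    by (intro borel_measurable_continuous_onI continuous_truncate) simp
  define U where "U k x = truncate (real (Suc k)) (u x)" for k x
  have Um: "U k \<in> borel_measurable (leb a b)" for k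
    unfolding U_def by (rule measurable_compose[OF um tm])
  have "(\<lambda>k. hnorm (L2_std a b) (\<lambda>x. u x - U k x)) \<longlonglongrightarrow> 0"
  proof (rule L2_dominated_convergence[OF Um um u])
    show "cmod (U n x) \<le> cmod (u x)" for n x unfolding U_def by (rule truncate_bounds)
    show "AE x in leb a b. (\<lambda>n. U n x) \<longlonglongrightarrow> u x"
    proof (rule AE_I2)
      fix x
      have "\<forall>\<^sub>F k in sequentially. cmod (u x) \<le> real k"
        using filterlim_real_sequentially unfolding filterlim_at_top by blast
      then have "\<forall>\<^sub>F k in sequentially. U k x = u x"
        by eventually_elim (simp add: U_def truncate_eq)
      then show "(\<lambda>n. U n x) \<longlonglongrightarrow> u x" by (rule tendsto_eventually)
    qed
  qed
  then obtain k where k: "hnorm (L2_std a b) (\<lambda>x. u x - U k x) < e / 2"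
    using order_tendstoD(2)[of _ 0 sequentially "e / 2"] e by (metis (no_types, lifting) eventually_sequentially half_gt_zero order_refl)
  have "u measurable_on {a<..<b}" using um by (subst measurable_on_iff_borel_measurable) auto
  then obtain N g where N: "negligible N" and g: "\<And>n. continuous_on UNIV (g n)"
      and gl: "\<And>x. x \<notin> N \<Longrightarrow> (\<lambda>n. g n x) \<longlonglongrightarrow> (if x \<in> {a<..<b} then u x else 0)"
    unfolding measurable_on_def by blast
  \<comment> \<open>Truncating the continuous approximants at the same level keeps them continuous
    and supplies the constant bound for dominated convergence.\<close>
  define G where "G n x = truncate (real (Suc k)) (g n x)" for n x
  have Gc: "continuous_on UNIV (G n)" for n
    unfolding G_def by (rule continuous_on_compose2[OF continuous_truncate g]) auto
  have Gm: "G n \<in> borel_measurable (leb a b)" for n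
    by (intro borel_measurable_leb borel_measurable_continuous_onI Gc)
  have "(\<lambda>n. hnorm (L2_std a b) (\<lambda>x. U k x - G n x)) \<longlonglongrightarrow> 0"
  proof (rule L2_dominated_convergence[OF Gm Um L2_const])
    show "cmod (G n x) \<le> cmod (of_real (real (Suc k)))" for n x
      unfolding G_def norm_of_real using truncate_bounds(1)[of "real (Suc k)" "g n x"] by simp
    have "{x. a < x \<and> x < b \<and> \<not> x \<notin> N} \<subseteq> N" by auto
    then have "AE x in leb a b. x \<notin> N" unfolding AE_leb_iff by (rule negligible_subset[OF N])
    moreover have "AE x in leb a b. x \<in> {a<..<b}" by (rule AE_leb_I) auto
    ultimately show "AE x in leb a b. (\<lambda>n. G n x) \<longlonglongrightarrow> U k x"
    proof eventually_elim
      case (elim x)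
      have l: "(\<lambda>n. g n x) \<longlonglongrightarrow> u x" using gl[OF elim(1)] elim(2) by simp
      have "isCont (truncate (real (Suc k))) (u x)"
        using continuous_truncate[of "real (Suc k)"] by (simp add: continuous_on_eq_continuous_at)
      from isCont_tendsto_compose[OF this l] show ?case by (simp add: G_def U_def)
    qed
  qed
  then obtain n where n: "hnorm (L2_std a b) (\<lambda>x. U k x - G n x) < e / 2"
    using order_tendstoD(2)[of _ 0 sequentially "e / 2"] e by (metis (no_types, lifting) eventually_sequentially half_gt_zero order_refl)
  have "U k \<in> L2 a b" by (rule bounded_L2[OF Um, where B="real (Suc k)"]) (use truncate_bounds(1)[of "real (Suc k)"] in \<open>simp add: U_def\<close>)
  moreover have "G n \<in> L2 a b" by (intro continuous_L2 continuous_on_subset[OF Gc]) auto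
  ultimately have "hnorm (L2_std a b) (\<lambda>x. u x - G n x) < e"
    using L2s.hnorm_diff_triangle[of u a b "U k" "G n"] u k n by simp
  then show ?thesis using Gc by blast
qed

section \<open>Finite linear combinations and trigonometric density\<close>

definition combo :: "(nat \<Rightarrow> cfun) \<Rightarrow> cfun \<Rightarrow> bool" where
  "combo x f \<longleftrightarrow> (\<exists>N c. \<forall>t. f t = (\<Sum>n<N. c n * x n t))"

lemma combo_base: "combo x (\<lambda>t. x n t)"
proof -
  have "x n t = (\<Sum>m<Suc n. (if m = n then 1 else 0) * x m t)" for t
    by (simp add: if_distrib[of "\<lambda>z. z * _"] cong: if_cong)
  then show ?thesis
    unfolding combo_def by (intro exI[of _ "Suc n"] exI[of _ "\<lambda>m. if m = n then 1 else 0"] allI)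
qed

lemma combo_zero: "combo x (\<lambda>t. 0)"
  unfolding combo_def by (intro exI[of _ 0]) simp

lemma combo_cmult: assumes "combo x f" shows "combo x (\<lambda>t. c * f t)"
proof -
  obtain N a where "\<forall>t. f t = (\<Sum>n<N. a n * x n t)" using assms by (auto simp: combo_def)
  then have "\<forall>t. c * f t = (\<Sum>n<N. (c * a n) * x n t)" by (simp add: sum_distrib_left mult.assoc)
  then show ?thesis unfolding combo_def by (intro exI[of _ N] exI[of _ "\<lambda>n. c * a n"])
qed

lemma combo_add: assumes "combo x f" "combo x g" shows "combo x (\<lambda>t. f t + g t)"
proof -
  obtain N a where f: "\<forall>t. f t = (\<Sum>n<N. a n * x n t)" using assms by (auto simp: combo_def)
  obtain M b where g: "\<forall>t. g t = (\<Sum>n<M. b n * x n t)" using assms by (auto simp: combo_def)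
  have pad: "(\<Sum>n<N. a n * x n t) = (\<Sum>n<max N M. (if n < N then a n else 0) * x n t)" for N M a t
    by (rule sum.mono_neutral_cong_left) auto
  have "\<forall>t. f t + g t = (\<Sum>n<max N M. ((if n < N then a n else 0) + (if n < M then b n else 0)) * x n t)"
    using f g pad[where N=N and M=M and a=a] pad[where N=M and M=N and a=b]
    by (simp only: distrib_right sum.distrib max.commute[of M N] simp_thms)
  then show ?thesis unfolding combo_def
    by (intro exI[of _ "max N M"] exI[of _ "\<lambda>n. (if n < N then a n else 0) + (if n < M then b n else 0)"])
qed

lemma combo_sum: "finite I \<Longrightarrow> (\<And>i. i \<in> I \<Longrightarrow> combo x (f i)) \<Longrightarrow> combo x (\<lambda>t. \<Sum>i\<in>I. f i t)"
  by (induction I rule: finite_induct) (auto intro: combo_zero combo_add)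

text \<open>Serves three purposes: products of cosines, the passage from cosines to sines through
  multiplication by \<open>sin\<close>, and, with multiplier 1, a change of the spanning
  sequence.\<close>

lemma combo_mult: assumes "\<And>n. combo y (\<lambda>t. m t * x n t)" "combo x f" shows "combo y (\<lambda>t. m t * f t)"
proof -
  obtain N a where f: "\<forall>t. f t = (\<Sum>n<N. a n * x n t)" using assms(2) by (auto simp: combo_def)
  have "combo y (\<lambda>t. \<Sum>n<N. a n * (m t * x n t))" by (intro combo_sum combo_cmult assms(1)) simp
  moreover have "(\<lambda>t. \<Sum>n<N. a n * (m t * x n t)) = (\<lambda>t. m t * f t)" using f by (simp add: sum_distrib_left mult.left_commute)
  ultimately show ?thesis by simp
qed

lemma (in semi_ip) total_seq_combo:
  "total_seq H x \<longleftrightarrow> (\<forall>u\<in>elems H. \<forall>e>0. \<exists>f. combo x f \<and> hnorm H (\<lambda>t. u t - f t) < e)"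
proof -
  have "(\<exists>N c. hnorm H (\<lambda>t. u t - (\<Sum>n<N. c n * x n t)) < e) \<longleftrightarrow> (\<exists>f. combo x f \<and> hnorm H (\<lambda>t. u t - f t) < e)" for u e
  proof
    assume "\<exists>N c. hnorm H (\<lambda>t. u t - (\<Sum>n<N. c n * x n t)) < e"
    then obtain N c where "hnorm H (\<lambda>t. u t - (\<Sum>n<N. c n * x n t)) < e" by blast
    then show "\<exists>f. combo x f \<and> hnorm H (\<lambda>t. u t - f t) < e"
      by (intro exI[of _ "\<lambda>t. \<Sum>n<N. c n * x n t"]) (auto simp: combo_def)
  next
    assume "\<exists>f. combo x f \<and> hnorm H (\<lambda>t. u t - f t) < e"
    then obtain f N c where f: "\<forall>t. f t = (\<Sum>n<N. c n * x n t)" "hnorm H (\<lambda>t. u t - f t) < e" by (auto simp: combo_def)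
    then show "\<exists>N c. hnorm H (\<lambda>t. u t - (\<Sum>n<N. c n * x n t)) < e" by (intro exI[of _ N] exI[of _ c]) simp
  qed
  then show ?thesis by (simp add: total_seq_def)
qed

definition cosn :: "nat \<Rightarrow> cfun" where "cosn n t = of_real (cos (real n * t))"
definition sinn :: "nat \<Rightarrow> cfun" where "sinn n t = of_real (sin (real n * t))"

lemma combo_cos_mult: "combo cosn (\<lambda>t. cosn m t * cosn n t)"
proof -
  \<comment> \<open>The absolute value of \<open>m - n\<close> as a natural number; the sign is
    irrelevant because cosine is even.\<close>
  define k where "k = (if m \<le> n then n - m else m - n)"
  have "cos (real k * t) = cos (real m * t - real n * t)" for t
  proof (cases "m \<le> n")
    case True
    then have "real k * t = - (real m * t - real n * t)" by (simp add: k_def of_nat_diff left_diff_distrib)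
    then show ?thesis by (simp only: cos_minus)
  qed (simp add: k_def of_nat_diff left_diff_distrib)
  then have E: "cos (real m * t) * cos (real n * t) = (cos (real k * t) + cos (real (m + n) * t)) / 2" for t
    by (simp add: cos_times_cos distrib_right)
  have "cosn m t * cosn n t = (1 / 2) * (cosn k t + cosn (m + n) t)" for t
    by (simp only: cosn_def of_real_mult[symmetric] E of_real_divide of_real_add) simp
  then have "(\<lambda>t. cosn m t * cosn n t) = (\<lambda>t. (1 / 2) * (cosn k t + cosn (m + n) t))" by blast
  then show ?thesis using combo_cmult[OF combo_add[OF combo_base[of cosn k] combo_base[of cosn "m + n"]], of "1 / 2"] by simp
qed

lemma combo_cos_cont: "combo cosn f \<Longrightarrow> continuous_on S f"
proof -
  assume "combo cosn f"
  then obtain N c where "\<forall>t. f t = (\<Sum>n<N. c n * cosn n t)" by (auto simp: combo_def)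
  then have "f = (\<lambda>t. \<Sum>n<N. c n * of_real (cos (real n * t)))" by (simp add: cosn_def fun_eq_iff)
  moreover have "continuous_on S (\<lambda>t. \<Sum>n<N. c n * complex_of_real (cos (real n * t)))" by (intro continuous_intros)
  ultimately show ?thesis by simp
qed

lemma cosn_0: "cosn 0 t = 1" by (simp add: cosn_def)

lemma combo_const: "combo cosn (\<lambda>t. c)"
  using combo_cmult[OF combo_base[of cosn 0], of c] by (simp add: cosn_0)

text \<open>The product formula makes the cosine combinations an algebra, index 0 contributes the
  constants, and \<open>cos\<close> alone separates the points of \<open>{0..pi}\<close>.\<close>

lemma cos_dense_real:
  assumes f: "continuous_on {0..pi} f" and e: "0 < e"
  shows "\<exists>g. combo cosn (\<lambda>t. of_real (g t)) \<and> (\<forall>x\<in>{0..pi}. \<bar>f x - g x\<bar> < e)"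
proof -
  interpret function_ring_on "{g. combo cosn (\<lambda>t. of_real (g t))}" "{0..pi}"
  proof
    show "continuous_on {0..pi} g" if "g \<in> {g. combo cosn (\<lambda>t. of_real (g t))}" for g
    proof -
      have "continuous_on {0..pi} (\<lambda>t. Re (of_real (g t)))"
        using that by (intro continuous_on_Re combo_cos_cont) simp
      then show ?thesis by simp
    qed
    show "(\<lambda>x. f x * g x) \<in> {g. combo cosn (\<lambda>t. of_real (g t))}"
      if "f \<in> {g. combo cosn (\<lambda>t. of_real (g t))}" "g \<in> {g. combo cosn (\<lambda>t. of_real (g t))}" for f g
    proof -
      have "combo cosn (\<lambda>t. cosn n t * of_real (g t))" for n
        by (rule combo_mult[OF combo_cos_mult]) (use that in simp)
      then have "combo cosn (\<lambda>t. of_real (g t) * cosn n t)" for n by (simp add: mult.commute)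
      then have "combo cosn (\<lambda>t. of_real (g t) * of_real (f t))"
        by (rule combo_mult) (use that in simp)
      then show ?thesis by (simp add: mult.commute)
    qed
    show "\<exists>f\<in>{g. combo cosn (\<lambda>t. of_real (g t))}. f x \<noteq> f y" if "x \<in> {0..pi}" "y \<in> {0..pi}" "x \<noteq> y" for x y
    proof (rule bexI[of _ cos])
      show "cos x \<noteq> cos y" using cos_inj_pi that by fastforce
      show "cos \<in> {g. combo cosn (\<lambda>t. of_real (g t))}" using combo_base[of cosn 1] by (simp add: cosn_def)
    qed
    show "(\<lambda>_. c) \<in> {g. combo cosn (\<lambda>t. of_real (g t))}" for c :: real
      using combo_const by simp
  qed (auto dest: combo_add)
  show ?thesis using Stone_Weierstrass_basic[OF f e] by blast
qed

lemma hnorm_L2_sup_bound: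
  assumes u: "u \<in> L2 a b" and ab: "a < b" and B: "\<And>x. a < x \<Longrightarrow> x < b \<Longrightarrow> cmod (u x) \<le> B"
  shows "hnorm (L2_std a b) u \<le> B * sqrt (b - a)"
proof -
  have "cmod (u ((a + b) / 2)) \<le> B" using ab by (intro B) auto
  then have B0: "0 \<le> B" using norm_ge_zero order_trans by blast
  have "(LINT x|leb a b. (cmod (u x))\<^sup>2) \<le> (LINT x|leb a b. B\<^sup>2)"
    by (rule integral_mono_AE) (use u B in \<open>auto simp: L2_def intro!: AE_leb_I power_mono\<close>)
  also have "\<dots> = B\<^sup>2 * (b - a)"
    using ab by (simp add: measure_restrict_space)
  finally have "sqrt (LINT x|leb a b. (cmod (u x))\<^sup>2) \<le> sqrt (B\<^sup>2 * (b - a))" by simp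
  also have "\<dots> = B * sqrt (b - a)" using B0 by (simp add: real_sqrt_mult)
  finally show ?thesis by (simp add: hnorm_L2_std)
qed

lemma cos_dense_L2:
  assumes u: "u \<in> L2 0 pi" and e: "0 < e"
  shows "\<exists>f. combo cosn f \<and> hnorm (L2_std 0 pi) (\<lambda>x. u x - f x) < e"
proof -
  obtain F where F: "continuous_on UNIV F" "hnorm (L2_std 0 pi) (\<lambda>x. u x - F x) < e / 2"
    using L2_continuous_dense[OF u, of "e / 2"] e by auto
  \<comment> \<open>Errors below \<open>d\<close> in the real and the imaginary part give a uniform
    error of at most \<open>2 * d\<close>, hence an \<open>L2\<close> error of at most
    \<open>e / 4\<close>.\<close>
  define d where "d = e / 4 / sqrt pi / 2"
  have d: "d > 0" using e by (simp add: d_def)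
  have c: "continuous_on {0..pi} (\<lambda>x. Re (F x))" "continuous_on {0..pi} (\<lambda>x. Im (F x))"
    by (intro continuous_intros continuous_on_subset[OF F(1)], auto)+
  obtain g where g: "combo cosn (\<lambda>t. of_real (g t))" "\<And>x. x \<in> {0..pi} \<Longrightarrow> \<bar>Re (F x) - g x\<bar> < d"
    using cos_dense_real[OF c(1) d] by blast
  obtain h where h: "combo cosn (\<lambda>t. of_real (h t))" "\<And>x. x \<in> {0..pi} \<Longrightarrow> \<bar>Im (F x) - h x\<bar> < d"
    using cos_dense_real[OF c(2) d] by blast
  define f where "f t = of_real (g t) + \<i> * of_real (h t)" for t
  have f: "combo cosn f" unfolding f_def[abs_def] by (intro combo_add combo_cmult g h)
  have b: "cmod (F x - f x) \<le> 2 * d" if "0 < x" "x < pi" for x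
  proof -
    have "cmod (F x - f x) \<le> \<bar>Re (F x - f x)\<bar> + \<bar>Im (F x - f x)\<bar>" by (rule cmod_le)
    also have "\<dots> \<le> d + d" using g(2)[of x] h(2)[of x] that by (intro add_mono) (simp_all add: f_def)
    finally show ?thesis by simp
  qed
  have "F \<in> L2 0 pi" by (intro continuous_L2 continuous_on_subset[OF F(1)]) auto
  moreover have "f \<in> L2 0 pi" by (intro continuous_L2 combo_cos_cont f)
  ultimately have m: "F \<in> L2 0 pi" "f \<in> L2 0 pi" .
  have "hnorm (L2_std 0 pi) (\<lambda>x. F x - f x) \<le> 2 * d * sqrt (pi - 0)"
    by (rule hnorm_L2_sup_bound[OF L2_diff[OF m] pi_gt_zero b])
  also have "\<dots> = e / 4" by (simp add: d_def)
  finally have "hnorm (L2_std 0 pi) (\<lambda>x. u x - f x) < e"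
    using L2s.hnorm_diff_triangle[of u 0 pi F f] u m F(2) e by simp
  then show ?thesis using f by blast
qed

section \<open>The cosine basis\<close>

lemma hnorm_L2_mono:
  assumes u: "u \<in> L2 a b" and v: "v \<in> L2 a b" and le: "\<And>x. a < x \<Longrightarrow> x < b \<Longrightarrow> cmod (u x) \<le> cmod (v x)"
  shows "hnorm (L2_std a b) u \<le> hnorm (L2_std a b) v"
proof -
  have "(LINT x|leb a b. (cmod (u x))\<^sup>2) \<le> (LINT x|leb a b. (cmod (v x))\<^sup>2)"
    by (rule integral_mono_AE) (use u v le in \<open>auto simp: L2_def intro!: AE_leb_I power_mono\<close>)
  then show ?thesis by (simp add: hnorm_L2_std)
qed

lemma combo_sin_mult: "combo sinn (\<lambda>t. of_real (sin t) * cosn n t)"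
proof (cases n)
  case 0
  then show ?thesis using combo_base[of sinn 1] by (simp add: cosn_def sinn_def)
next
  case (Suc m)
  have E: "sin t * cos (real n * t) = (sin (real (Suc n) * t) - sin (real m * t)) / 2" for t
  proof -
    have "t - real n * t = - (real m * t)" "t + real n * t = real (Suc n) * t"
      by (simp_all add: Suc algebra_simps)
    then show ?thesis using sin_times_cos[of t "real n * t"] by (simp only: sin_minus) simp
  qed
  have "of_real (sin t) * cosn n t = (1 / 2) * (sinn (Suc n) t + (-1) * sinn m t)" for t
    by (simp only: cosn_def sinn_def of_real_mult[symmetric] E of_real_divide of_real_diff) simp
  then have "(\<lambda>t. of_real (sin t) * cosn n t) = (\<lambda>t. (1 / 2) * (sinn (Suc n) t + (-1) * sinn m t))" by blast
  moreover have "combo sinn (\<lambda>t. (1 / 2) * (sinn (Suc n) t + (-1) * sinn m t))"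
    by (intro combo_cmult combo_add combo_base)
  ultimately show ?thesis by simp
qed

text \<open>Division by the regularized sine reduces totality of the sines, needed for derivatives, to
  totality of the cosines.\<close>

lemma sin_dense_L2:
  assumes g: "g \<in> L2 0 pi" and e: "0 < e"
  shows "\<exists>f. combo sinn f \<and> hnorm (L2_std 0 pi) (\<lambda>x. g x - f x) < e"
proof -
  \<comment> \<open>The maximum keeps \<open>w k\<close> bounded by \<open>k + 1\<close>, so
    \<open>h k\<close> stays in \<open>L2\<close>. On the open interval \<open>sin t * w k t\<close>
    is at most 1 and eventually equal to 1, so \<open>U k\<close> converges to \<open>g\<close> with
    dominating function \<open>g\<close>.\<close>
  define w where "w k t = 1 / max (sin t) (1 / (real k + 1))" for k t
  define h where "h k t = of_real (w k t) * g t" for k t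
  define U where "U k t = of_real (sin t) * h k t" for k t
  have wc: "continuous_on UNIV (w k)" for k
    unfolding w_def
  proof (intro continuous_intros ballI)
    fix t
    have "0 < max (sin t) (1 / (real k + 1))" by (simp add: less_max_iff_disj)
    then show "max (sin t) (1 / (real k + 1)) \<noteq> 0" by linarith
  qed
  have w0: "0 < w k t" "w k t \<le> real k + 1" for k t
  proof -
    have "0 < 1 / (real k + 1)" by simp
    then show "0 < w k t" unfolding w_def by (simp add: less_max_iff_disj)
    have "w k t \<le> 1 / (1 / (real k + 1))" unfolding w_def by (rule divide_left_mono) (auto simp: less_max_iff_disj)
    then show "w k t \<le> real k + 1" by simp
  qed
  have h2: "h k \<in> L2 0 pi" for k
    unfolding h_def[abs_def]
    by (rule L2_weight[OF _ _ g, where C="real k + 1"])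
       (use w0 less_imp_le[OF w0(1)] in \<open>auto intro!: borel_measurable_leb borel_measurable_continuous_onI wc AE_I2\<close>)
  have sinb: "(\<lambda>t. of_real (sin t) * f t) \<in> L2 0 pi" if "f \<in> L2 0 pi" for f
    by (rule L2_weight[OF _ _ that, where C=1])
       (auto intro!: borel_measurable_leb borel_measurable_continuous_onI continuous_intros AE_I2)
  have U2: "U k \<in> L2 0 pi" for k unfolding U_def[abs_def] by (rule sinb[OF h2])
  have "(\<lambda>k. hnorm (L2_std 0 pi) (\<lambda>x. g x - U k x)) \<longlonglongrightarrow> 0"
  proof (rule L2_dominated_convergence[OF L2_measurable[OF U2] L2_measurable[OF g] g])
    fix k t assume t: "0 < t" "t < pi"
    have s: "0 < sin t" using sin_gt_zero t by blast
    have "0 < max (sin t) (1 / (real k + 1))" using s by (simp add: less_max_iff_disj)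
    then have "sin t * w k t \<le> 1" unfolding w_def by (simp add: divide_le_eq)
    then have "\<bar>sin t\<bar> * \<bar>w k t\<bar> \<le> 1" using s w0(1)[of k t] by simp
    then show "cmod (U k t) \<le> cmod (g t)"
      using mult_right_mono[of "\<bar>sin t\<bar> * \<bar>w k t\<bar>" 1 "cmod (g t)"] by (simp add: U_def h_def norm_mult mult.assoc)
  next
    show "AE t in leb 0 pi. (\<lambda>k. U k t) \<longlonglongrightarrow> g t"
    proof (rule AE_leb_I)
      fix t :: real assume t: "0 < t" "t < pi"
      have s: "0 < sin t" using sin_gt_zero t by blast
      have "(\<lambda>k. 1 / (real k + 1)) \<longlonglongrightarrow> 0" by real_asymp
      then have "\<forall>\<^sub>F k in sequentially. 1 / (real k + 1) < sin t" by (rule order_tendstoD(2)) (rule s)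
      then have "\<forall>\<^sub>F k in sequentially. U k t = g t"
      proof eventually_elim
        case (elim k)
        then have "w k t = 1 / sin t" by (simp add: w_def max_def)
        then show ?case using s by (simp add: U_def h_def)
      qed
      then show "(\<lambda>k. U k t) \<longlonglongrightarrow> g t" by (rule tendsto_eventually)
    qed
  qed
  then obtain k where k: "hnorm (L2_std 0 pi) (\<lambda>x. g x - U k x) < e / 2"
    using order_tendstoD(2)[of _ 0 sequentially "e / 2"] e by (metis (no_types, lifting) eventually_sequentially half_gt_zero order_refl)
  obtain p where p: "combo cosn p" "hnorm (L2_std 0 pi) (\<lambda>x. h k x - p x) < e / 2"
    using cos_dense_L2[OF h2[of k], of "e / 2"] e by auto
  have p2: "p \<in> L2 0 pi" by (intro continuous_L2 combo_cos_cont p)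
  let ?f = "\<lambda>t. of_real (sin t) * p t"
  have f: "combo sinn ?f" by (rule combo_mult[OF combo_sin_mult p(1)])
  have "hnorm (L2_std 0 pi) (\<lambda>x. U k x - ?f x) \<le> hnorm (L2_std 0 pi) (\<lambda>x. h k x - p x)"
  proof (rule hnorm_L2_mono[OF L2_diff[OF U2 sinb[OF p2]] L2_diff[OF h2 p2]])
    fix x
    have "U k x - ?f x = of_real (sin x) * (h k x - p x)" by (simp add: U_def right_diff_distrib)
    then have "cmod (U k x - ?f x) = \<bar>sin x\<bar> * cmod (h k x - p x)" by (simp add: norm_mult)
    also have "\<dots> \<le> cmod (h k x - p x)" by (simp add: mult_left_le_one_le)
    finally show "cmod (U k x - ?f x) \<le> cmod (h k x - p x)" .
  qed
  then have "hnorm (L2_std 0 pi) (\<lambda>x. g x - ?f x) < e"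
    using L2s.hnorm_diff_triangle[of g 0 pi "U k" ?f] g U2 sinb[OF p2] k p(2) by simp
  then show ?thesis using f by blast
qed

lemma sin_antiderivative:
  assumes "combo sinn s"
  shows "\<exists>f. combo cosn f \<and> (\<forall>t\<in>{0..pi}. f t = f 0 + prim 0 pi s t)"
proof -
  obtain N c where "\<forall>t. s t = (\<Sum>n<N. c n * sinn n t)" using assms by (auto simp: combo_def)
  then have s: "s = (\<lambda>t. \<Sum>n<N. c n * sinn n t)" by blast
  have si: "integrable (leb 0 pi) (sinn n)" for n
    unfolding sinn_def[abs_def] by (intro L2_integrable continuous_L2 continuous_intros)
  have one: "\<exists>f. combo cosn f \<and> (\<forall>t\<in>{0..pi}. f t = f 0 + prim 0 pi (sinn n) t)" for n
  proof (cases "n = 0")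
    case True
    have "prim 0 pi (sinn n) t = 0" for t using True by (simp add: sinn_def[abs_def] prim_def)
    then show ?thesis by (intro exI[of _ "\<lambda>t. 0"]) (simp add: combo_zero)
  next
    case False
    have d: "((\<lambda>t. - cos (real n * t) / real n) has_real_derivative sin (real n * t)) (at t)" for t
      using False by (auto intro!: derivative_eq_intros)
    have "prim 0 pi (\<lambda>t. of_real (sin (real n * t))) t = of_real (- cos (real n * t) / real n - (- cos (real n * 0) / real n))"
      if "t \<in> {0..pi}" for t
      by (rule prim_of_derivative[OF d]) (use that in \<open>auto intro!: continuous_intros\<close>)
    then have "prim 0 pi (sinn n) t = (- 1 / of_nat n) * cosn n t - (- 1 / of_nat n) * cosn n 0" if "t \<in> {0..pi}" for t
      using that by (simp add: sinn_def[abs_def] cosn_def)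
    then show ?thesis
      by (intro exI[of _ "\<lambda>t. (- 1 / of_nat n) * cosn n t"] conjI combo_cmult combo_base) auto
  qed
  have "\<exists>f. combo cosn f \<and> (\<forall>t\<in>{0..pi}. f t = f 0 + prim 0 pi (\<lambda>t. \<Sum>n<N. c n * sinn n t) t)"
  proof (induction N)
    case 0
    then show ?case by (intro exI[of _ "\<lambda>t. 0"]) (simp add: combo_zero prim_def)
  next
    case (Suc N)
    then obtain f where f: "combo cosn f" "\<And>t. t \<in> {0..pi} \<Longrightarrow> f t = f 0 + prim 0 pi (\<lambda>t. \<Sum>n<N. c n * sinn n t) t" by blast
    obtain g where g: "combo cosn g" "\<And>t. t \<in> {0..pi} \<Longrightarrow> g t = g 0 + prim 0 pi (sinn N) t" using one by blast
    have "prim 0 pi (\<lambda>t. \<Sum>n<Suc N. c n * sinn n t) t = prim 0 pi (\<lambda>t. \<Sum>n<N. c n * sinn n t) t + c N * prim 0 pi (sinn N) t" for t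
      unfolding sum.lessThan_Suc
      by (subst prim_add) (auto simp: prim_cmult intro!: Bochner_Integration.integrable_sum si)
    moreover have "f t + c N * g t = (f 0 + c N * g 0) + (prim 0 pi (\<lambda>t. \<Sum>n<N. c n * sinn n t) t + c N * prim 0 pi (sinn N) t)"
      if "t \<in> {0..pi}" for t
      using f(2)[OF that] g(2)[OF that] by (simp add: algebra_simps)
    ultimately have "f t + c N * g t = (f 0 + c N * g 0) + prim 0 pi (\<lambda>t. \<Sum>n<Suc N. c n * sinn n t) t"
      if "t \<in> {0..pi}" for t
      using that by (simp only:)
    then show ?case
      by (intro exI[of _ "\<lambda>t. f t + c N * g t"] conjI ballI combo_add combo_cmult f(1) g(1))
  qed
  then show ?thesis by (simp add: s)
qed

text \<open>Cauchy-Schwarz against the indicator of \<open>s < x\<close>.\<close>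

lemma prim_bound:
  assumes h: "h \<in> L2 a b" and ab: "a < b"
  shows "cmod (prim a b h x) \<le> hnorm (L2_std a b) h * sqrt (b - a)"
proof -
  let ?i = "\<lambda>s. if s < x then 1 else 0 :: complex"
  have i: "?i \<in> L2 a b" by (rule bounded_L2[where B=1]) (auto intro!: borel_measurable_leb)
  have "prim a b h x = L2_ip a b (\<lambda>_. 1) h ?i"
    unfolding prim_def L2_ip_one by (rule Bochner_Integration.integral_cong) auto
  then have "cmod (prim a b h x) \<le> hnorm (L2_std a b) h * hnorm (L2_std a b) ?i"
    using L2s.Cauchy_Schwarz[of h a b ?i] h i by simp
  also have "\<dots> \<le> hnorm (L2_std a b) h * (1 * sqrt (b - a))"
    using L2s.hnorm_nonneg[of h a b] h by (intro mult_left_mono hnorm_L2_sup_bound i ab) auto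
  finally show ?thesis by simp
qed

text \<open>The derivative is approximated by sines in \<open>L2\<close> and the approximation is
  integrated to a cosine combination. With equal values at 0, the error itself is the primitive of
  the derivative error and is controlled by it, as in the Poincare inequality.\<close>

lemma cos_dense_H1:
  assumes u: "u \<in> H1 0 pi" and e: "0 < e"
  shows "\<exists>f. combo cosn f \<and> hnorm (H1_std 0 pi) (\<lambda>x. u x - f x) < e"
proof -
  let ?G = "wderiv 0 pi u"
  \<comment> \<open>If the derivative error has norm \<open>n\<close>, the error has norm at most
    \<open>n * pi\<close>; together the \<open>H1\<close> error is at most
    \<open>n * K\<close>.\<close>
  define K where "K = sqrt (1 + pi\<^sup>2)"
  have K: "K > 0" by (simp add: K_def add_pos_nonneg)
  have G: "?G \<in> L2 0 pi" by (rule wderiv_H1(1)[OF u])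
  obtain s where s: "combo sinn s" "hnorm (L2_std 0 pi) (\<lambda>x. ?G x - s x) < e / K"
    using sin_dense_L2[OF G, of "e / K"] e K by auto
  obtain N c where "\<forall>t. s t = (\<Sum>n<N. c n * sinn n t)" using s(1) by (auto simp: combo_def)
  then have "s = (\<lambda>t. \<Sum>n<N. c n * sinn n t)" by blast
  then have s2: "s \<in> L2 0 pi" by (auto simp: sinn_def intro!: continuous_L2 continuous_intros)
  obtain f0 where f0: "combo cosn f0" "\<And>t. t \<in> {0..pi} \<Longrightarrow> f0 t = f0 0 + prim 0 pi s t"
    using sin_antiderivative[OF s(1)] by blast
  \<comment> \<open>The added constant matches the boundary value at 0 and is itself a cosine
    combination.\<close>
  define f where "f t = f0 t + (crep 0 pi u 0 - f0 0)" for t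
  have f: "combo cosn f" unfolding f_def[abs_def] by (intro combo_add f0 combo_const)
  let ?h = "\<lambda>x. ?G x - s x"
  have h: "?h \<in> L2 0 pi" by (intro L2_diff G s2)
  have "AE x in leb 0 pi. x \<in> {0..pi}" by (rule AE_leb_I) auto
  then have ae: "AE x in leb 0 pi. u x - f x = 0 + prim 0 pi ?h x"
    using H1_repE[OF u pi_gt_zero]
  proof eventually_elim
    case (elim x)
    then show ?case using f0(2)[of x]
      by (simp add: f_def prim_diff[OF L2_integrable[OF G] L2_integrable[OF s2]])
  qed
  let ?n = "hnorm (L2_std 0 pi) ?h"
  have n0: "0 \<le> ?n" using L2s.hnorm_nonneg[of ?h 0 pi] h by simp
  have d2: "(\<lambda>x. u x - f x) \<in> L2 0 pi" using H1_L2[OF H1_I(1)[OF h pi_gt_zero ae]] .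
  have 1: "hnorm (L2_std 0 pi) (wderiv 0 pi (\<lambda>x. u x - f x)) = ?n"
  proof -
    have "L2_ip 0 pi (\<lambda>_. 1) (wderiv 0 pi (\<lambda>x. u x - f x)) (wderiv 0 pi (\<lambda>x. u x - f x)) = L2_ip 0 pi (\<lambda>_. 1) ?h ?h"
      by (rule L2_ip_cong_AE)
         (use H1_I(2)[OF h pi_gt_zero ae] wderiv_H1(1)[OF H1_I(1)[OF h pi_gt_zero ae]] in auto)
    then show ?thesis by (simp add: hnorm_def)
  qed
  have pr2: "prim 0 pi ?h \<in> L2 0 pi" by (intro continuous_L2 continuous_prim L2_integrable h)
  have 2: "hnorm (L2_std 0 pi) (\<lambda>x. u x - f x) \<le> ?n * pi"
  proof -
    have "L2_ip 0 pi (\<lambda>_. 1) (\<lambda>x. u x - f x) (\<lambda>x. u x - f x) = L2_ip 0 pi (\<lambda>_. 1) (prim 0 pi ?h) (prim 0 pi ?h)"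
      by (rule L2_ip_cong_AE) (use ae d2 in auto)
    then have "hnorm (L2_std 0 pi) (\<lambda>x. u x - f x) = hnorm (L2_std 0 pi) (prim 0 pi ?h)" by (simp add: hnorm_def)
    also have "\<dots> \<le> (?n * sqrt (pi - 0)) * sqrt (pi - 0)"
      by (rule hnorm_L2_sup_bound[OF pr2 pi_gt_zero]) (rule prim_bound[OF h pi_gt_zero])
    also have "\<dots> = ?n * pi" by (simp add: mult.assoc)
    finally show ?thesis .
  qed
  have "0 \<le> hnorm (L2_std 0 pi) (\<lambda>x. u x - f x)" using L2s.hnorm_nonneg d2 by simp
  then have "(hnorm (L2_std 0 pi) (\<lambda>x. u x - f x))\<^sup>2 \<le> (?n * pi)\<^sup>2" using 2 by (intro power_mono) auto
  then have "(hnorm (H1_std 0 pi) (\<lambda>x. u x - f x))\<^sup>2 \<le> (?n * K)\<^sup>2"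
    by (simp add: hnorm_H1_std_sq 1 K_def power_mult_distrib algebra_simps)
  then have "hnorm (H1_std 0 pi) (\<lambda>x. u x - f x) \<le> ?n * K"
    using n0 K by (simp add: power2_le_iff_abs_le)
  also have "\<dots> < e" using s(2) K by (simp add: field_simps)
  finally show ?thesis using f by blast
qed

section \<open>The cosines as eigenfunctions of the self-adjoint problem\<close>

definition pc :: "nat \<Rightarrow> real" where "pc n = (if n = 0 then sqrt (1 / pi) else sqrt (2 / pi))"

lemma pc_pos: "0 < pc n" by (simp add: pc_def)

lemma psi_tilde_cos: "psi_tilde n t = of_real (pc n * cos (real n * t))"
  by (simp add: psi_tilde_def pc_def)

lemma psi_tilde_H1: "psi_tilde n \<in> H1 0 pi"
    and wderiv_psi_tilde: "AE t in leb 0 pi. wderiv 0 pi (psi_tilde n) t = of_real (- (pc n * real n * sin (real n * t)))"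
proof -
  have e: "psi_tilde n = (\<lambda>t. of_real (pc n * cos (real n * t)))" by (rule ext) (rule psi_tilde_cos)
  have d: "((\<lambda>t. pc n * cos (real n * t)) has_real_derivative - (pc n * real n * sin (real n * t))) (at t)" for t
    by (auto intro!: derivative_eq_intros)
  have c: "continuous_on UNIV (\<lambda>t. - (pc n * real n * sin (real n * t)))" by (intro continuous_intros)
  show "psi_tilde n \<in> H1 0 pi" unfolding e by (rule H1_C1(1)[OF d c pi_gt_zero])
  show "AE t in leb 0 pi. wderiv 0 pi (psi_tilde n) t = of_real (- (pc n * real n * sin (real n * t)))"
    unfolding e by (rule H1_C1(2)[OF d c pi_gt_zero])
qed

lemma psi_tilde_L2: "psi_tilde n \<in> L2 0 pi" by (rule H1_L2[OF psi_tilde_H1])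

lemma combo_psi_tilde: "combo cosn f \<Longrightarrow> combo psi_tilde f"
proof -
  have "(\<lambda>t. 1 * cosn n t) = (\<lambda>t. (1 / of_real (pc n)) * psi_tilde n t)" for n
    using pc_pos[of n] by (simp add: psi_tilde_cos cosn_def)
  then have "combo psi_tilde (\<lambda>t. 1 * cosn n t)" for n using combo_cmult[OF combo_base] by metis
  then show "combo cosn f \<Longrightarrow> combo psi_tilde f" using combo_mult[of psi_tilde "\<lambda>_. 1" cosn f] by simp
qed

lemma integral_cos_int:
  "(LINT t|leb 0 pi. complex_of_real (cos (real_of_int k * t))) = (if k = 0 then of_real pi else 0)"
proof -
  define \<eta> where "\<eta> t = (if k = 0 then t else sin (real_of_int k * t) / real_of_int k)" for t
  have d: "(\<eta> has_real_derivative cos (real_of_int k * t)) (at t)" for t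
    unfolding \<eta>_def by (cases "k = 0") (auto intro!: derivative_eq_intros)
  have "prim 0 pi (\<lambda>t. of_real (cos (real_of_int k * t))) pi = of_real (\<eta> pi - \<eta> 0)"
    by (rule prim_of_derivative[OF d]) (auto intro!: continuous_intros)
  then show ?thesis using sin_npi_int[of k] by (simp add: prim_right \<eta>_def mult.commute)
qed

lemma psi_tilde_orthonormal: "L2_ip 0 pi (\<lambda>_. 1) (psi_tilde m) (psi_tilde n) = (if m = n then 1 else 0)"
proof -
  let ?c = "\<lambda>k t. complex_of_real (cos (real_of_int k * t))"
  have i: "integrable (leb 0 pi) (?c k)" for k by (intro L2_integrable continuous_L2 continuous_intros)
  have p: "psi_tilde m t * cnj (psi_tilde n t) = of_real (pc m * pc n / 2) * (?c (int m - int n) t + ?c (int m + int n) t)" for t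
  proof -
    have "pc m * cos (real m * t) * (pc n * cos (real n * t)) = (pc m * pc n) * (cos (real m * t) * cos (real n * t))" by simp
    also have "\<dots> = pc m * pc n / 2 * (cos (real_of_int (int m - int n) * t) + cos (real_of_int (int m + int n) * t))"
      by (simp add: cos_times_cos algebra_simps)
    finally have E: "pc m * cos (real m * t) * (pc n * cos (real n * t)) = \<dots>" .
    show ?thesis
      unfolding psi_tilde_cos complex_cnj_complex_of_real of_real_mult[symmetric] of_real_add[symmetric] by (simp only: E)
  qed
  have "L2_ip 0 pi (\<lambda>_. 1) (psi_tilde m) (psi_tilde n) =
     of_real (pc m * pc n / 2) * ((LINT t|leb 0 pi. ?c (int m - int n) t) + (LINT t|leb 0 pi. ?c (int m + int n) t))"
    unfolding L2_ip_one p by (simp only: Bochner_Integration.integral_mult_right_zero Bochner_Integration.integral_add[OF i i])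
  \<comment> \<open>The sum frequency contributes only for \<open>m = n = 0\<close>, where it
    doubles the integral; this is why \<open>pc 0\<close> carries \<open>1 / pi\<close> instead of
    \<open>2 / pi\<close>.\<close>
  also have "\<dots> = of_real (pc m * pc n / 2 * ((if m = n then pi else 0) + (if m = 0 \<and> n = 0 then pi else 0)))"
    unfolding integral_cos_int by simp
  also have "pc m * pc n / 2 * ((if m = n then pi else 0) + (if m = 0 \<and> n = 0 then pi else 0)) = (if m = n then 1 else 0)"
  proof (cases "m = n")
    case True
    have "pc n * pc n = (if n = 0 then 1 / pi else 2 / pi)" by (simp add: pc_def)
    then show ?thesis using True by simp
  qed auto
  finally show ?thesis by simp
qed

text \<open>Integration by parts against the conjugate of \<xi>: the derivative of the cosine is a
  sine and vanishes at both ends, so no boundary terms arise. This also gives orthogonality in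
  \<open>H1\<close>.\<close>

lemma psi_tilde_weak:
  assumes xi: "\<xi> \<in> H1 0 pi"
  shows "L2_ip 0 pi (\<lambda>_. 1) (wderiv 0 pi (psi_tilde n)) (wderiv 0 pi \<xi>) = of_real ((real n)\<^sup>2) * L2_ip 0 pi (\<lambda>_. 1) (psi_tilde n) \<xi>"
proof -
  let ?m = "\<lambda>t. - (pc n * real n * sin (real n * t))"
  let ?w = "\<lambda>t. complex_of_real (?m t)" and ?v = "\<lambda>t. cnj (\<xi> t)"
  have d: "(?m has_real_derivative - (pc n * (real n)\<^sup>2 * cos (real n * t))) (at t)" for t
    by (auto intro!: derivative_eq_intros simp: power2_eq_square)
  have c: "continuous_on UNIV (\<lambda>t. - (pc n * (real n)\<^sup>2 * cos (real n * t)))" by (intro continuous_intros)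
  note w = H1_C1[OF d c pi_gt_zero]
  note v = H1_cnj[OF xi pi_gt_zero]
  have b: "crep 0 pi ?w pi = 0" "crep 0 pi ?w 0 = 0" using w(3)[of pi] w(3)[of 0] by auto
  have parts: "(LINT x|leb 0 pi. ?w x * wderiv 0 pi ?v x) + (LINT x|leb 0 pi. wderiv 0 pi ?w x * ?v x) = 0"
    using H1_parts[OF w(1) v(1) pi_gt_zero] unfolding b by simp
  have "L2_ip 0 pi (\<lambda>_. 1) (wderiv 0 pi (psi_tilde n)) (wderiv 0 pi \<xi>) = L2_ip 0 pi (\<lambda>_. 1) ?w (\<lambda>x. cnj (wderiv 0 pi ?v x))"
  proof (rule L2_ip_cong_AE)
    show "AE x in leb 0 pi. wderiv 0 pi \<xi> x = cnj (wderiv 0 pi ?v x)" using v(2) by eventually_elim simp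
  qed (use wderiv_psi_tilde wderiv_H1(1)[OF psi_tilde_H1] wderiv_H1(1)[OF xi] in auto)
  also have "\<dots> = (LINT x|leb 0 pi. ?w x * wderiv 0 pi ?v x)" by (simp add: L2_ip_one)
  finally have 1: "L2_ip 0 pi (\<lambda>_. 1) (wderiv 0 pi (psi_tilde n)) (wderiv 0 pi \<xi>) = \<dots>" .
  have "(LINT x|leb 0 pi. wderiv 0 pi ?w x * ?v x) = L2_ip 0 pi (\<lambda>_. 1) (wderiv 0 pi ?w) \<xi>" by (simp add: L2_ip_one)
  also have "\<dots> = L2_ip 0 pi (\<lambda>_. 1) (\<lambda>t. of_real (- (real n)\<^sup>2) * psi_tilde n t) \<xi>"
  proof (rule L2_ip_cong_AE)
    show "AE t in leb 0 pi. wderiv 0 pi ?w t = of_real (- (real n)\<^sup>2) * psi_tilde n t"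
      using w(2) by eventually_elim (simp add: psi_tilde_cos)
  qed (use wderiv_H1(1)[OF w(1)] H1_L2[OF xi] in auto)
  also have "\<dots> = of_real (- (real n)\<^sup>2) * L2_ip 0 pi (\<lambda>_. 1) (psi_tilde n) \<xi>"
    using L2s.ip_cmult[of "psi_tilde n" 0 pi \<xi> "of_real (- (real n)\<^sup>2)"] psi_tilde_L2 H1_L2[OF xi]
    by (simp only: L2_space_simps)
  finally have 2: "(LINT x|leb 0 pi. wderiv 0 pi ?w x * ?v x) = \<dots>" .
  show ?thesis using parts unfolding 1 2 by (simp add: add_eq_0_iff2)
qed

lemma mu_tilde_pos: "0 < mu_tilde n" by (simp add: mu_tilde_def add_nonneg_pos)

lemma psi_tilde_H1_ip:
  "ip (H1_std 0 pi) (psi_tilde m) (psi_tilde n) = (if m = n then of_real (mu_tilde n) else 0)"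
  using psi_tilde_weak[OF psi_tilde_H1, of m n] by (simp add: psi_tilde_orthonormal mu_tilde_def)

interpretation H1p: semi_ip "H1_std 0 pi" by (rule semi_ip_H1_std[OF pi_gt_zero])

theorem psi_tilde_orthonormal_basis: "orthonormal_basis (L2_std 0 pi) psi_tilde"
proof -
  have "\<exists>f. combo psi_tilde f \<and> hnorm (L2_std 0 pi) (\<lambda>x. u x - f x) < e"
    if "u \<in> elems (L2_std 0 pi)" "0 < e" for u e
  proof -
    obtain f where "combo cosn f" "hnorm (L2_std 0 pi) (\<lambda>x. u x - f x) < e"
      using cos_dense_L2[of u e] \<open>u \<in> elems (L2_std 0 pi)\<close> \<open>0 < e\<close> by auto
    then show ?thesis by (intro exI[of _ f] conjI combo_psi_tilde)
  qed
  then show ?thesis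
    unfolding orthonormal_basis_def L2s.total_seq_combo
    by (simp only: L2_space_simps psi_tilde_L2 psi_tilde_orthonormal) simp
qed

lemma psi_tilde_total_H1: "total_seq (H1_std 0 pi) psi_tilde"
  unfolding H1p.total_seq_combo
proof (intro ballI allI impI)
  fix u and e :: real assume "u \<in> elems (H1_std 0 pi)" "0 < e"
  then obtain f where "combo cosn f" "hnorm (H1_std 0 pi) (\<lambda>x. u x - f x) < e"
    using cos_dense_H1[of u e] by auto
  then show "\<exists>f. combo psi_tilde f \<and> hnorm (H1_std 0 pi) (\<lambda>x. u x - f x) < e"
    by (intro exI[of _ f] conjI combo_psi_tilde)
qed

lemma hnorm_psi_tilde_L2: "hnorm (L2_std 0 pi) (psi_tilde n) = 1"
  by (simp add: hnorm_def psi_tilde_orthonormal)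

lemma hnorm_psi_tilde_H1: "hnorm (H1_std 0 pi) (psi_tilde n) = sqrt (mu_tilde n)"
  unfolding hnorm_def psi_tilde_H1_ip by simp

theorem psi_tilde_orthogonal_basis_H1: "orthogonal_basis (H1_std 0 pi) psi_tilde"
  unfolding orthogonal_basis_def hnorm_psi_tilde_H1 psi_tilde_H1_ip
  using psi_tilde_H1 psi_tilde_total_H1 mu_tilde_pos less_imp_neq by (auto simp: less_imp_neq[symmetric])

theorem psi_tilde_orthonormal_basis_H1: "orthonormal_basis (H1_std 0 pi) (normalize_seq (H1_std 0 pi) psi_tilde)"
proof -
  let ?c = "\<lambda>n. complex_of_real (1 / sqrt (mu_tilde n))"
  have n: "normalize_seq (H1_std 0 pi) psi_tilde n = (\<lambda>t. ?c n * psi_tilde n t)" for n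
    by (simp add: normalize_seq_def hnorm_psi_tilde_H1)
  have m: "psi_tilde n \<in> elems (H1_std 0 pi)" for n by (simp add: psi_tilde_H1)
  have "combo (normalize_seq (H1_std 0 pi) psi_tilde) f" if "combo psi_tilde f" for f
  proof -
    have "(\<lambda>t. 1 * psi_tilde n t) = (\<lambda>t. of_real (sqrt (mu_tilde n)) * normalize_seq (H1_std 0 pi) psi_tilde n t)" for n
      using mu_tilde_pos[of n] by (simp add: n)
    then have "combo (normalize_seq (H1_std 0 pi) psi_tilde) (\<lambda>t. 1 * psi_tilde n t)" for n
      using combo_cmult[OF combo_base] by metis
    then show ?thesis using combo_mult[of "normalize_seq (H1_std 0 pi) psi_tilde" "\<lambda>_. 1" psi_tilde f] that by simp
  qed
  then have "total_seq (H1_std 0 pi) (normalize_seq (H1_std 0 pi) psi_tilde)"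
    using psi_tilde_total_H1 unfolding H1p.total_seq_combo by blast
  moreover have "ip (H1_std 0 pi) (normalize_seq (H1_std 0 pi) psi_tilde i) (normalize_seq (H1_std 0 pi) psi_tilde j) = (if i = j then 1 else 0)" for i j
  proof -
    have "ip (H1_std 0 pi) (normalize_seq (H1_std 0 pi) psi_tilde i) (normalize_seq (H1_std 0 pi) psi_tilde j)
        = ?c i * (cnj (?c j) * ip (H1_std 0 pi) (psi_tilde i) (psi_tilde j))"
      unfolding n H1p.ip_cmult[OF m H1p.cmult_mem[OF m]] H1p.ip_cmult_right[OF m m] ..
    also have "\<dots> = (if i = j then of_real (1 / sqrt (mu_tilde i) * (1 / sqrt (mu_tilde i)) * mu_tilde i) else 0)"
      unfolding psi_tilde_H1_ip complex_cnj_complex_of_real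
      by (cases "i = j") (simp_all only: of_real_mult if_True if_False mult.assoc mult_zero_right simp_thms)
    also have "1 / sqrt (mu_tilde i) * (1 / sqrt (mu_tilde i)) * mu_tilde i = 1"
      using mu_tilde_pos[of i] by simp
    finally show ?thesis by simp
  qed
  moreover have "normalize_seq (H1_std 0 pi) psi_tilde i \<in> elems (H1_std 0 pi)" for i
    unfolding n by (rule H1p.cmult_mem[OF m])
  ultimately show ?thesis unfolding orthonormal_basis_def by blast
qed

section \<open>Second order Sobolev functions\<close>

lemma H2_cmult:
  assumes u: "u \<in> H2 a b" and ab: "a < b"
  shows "(\<lambda>x. c * u x) \<in> H2 a b"
    and "x \<in> {a..b} \<Longrightarrow> crep a b (wderiv a b (\<lambda>x. c * u x)) x = c * crep a b (wderiv a b u) x"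
    and "AE x in leb a b. wderiv a b (wderiv a b (\<lambda>x. c * u x)) x = c * wderiv a b (wderiv a b u) x"
proof -
  have 1: "u \<in> H1 a b" "wderiv a b u \<in> H1 a b" using u by (auto simp: H2_def)
  \<comment> \<open>The derivative of \<open>c * u\<close> is \<open>c\<close> times that of
    \<open>u\<close> only almost everywhere, so the second derivative and the boundary values are
    compared through \<open>H1_AE\<close>.\<close>
  note c1 = H1_cmult[OF 1(1) ab, where c=c] and c2 = H1_cmult[OF 1(2) ab, where c=c]
  note e = H1_AE[OF c2(1) ab c1(2)]
  show "(\<lambda>x. c * u x) \<in> H2 a b" using c1(1) e(1) by (simp add: H2_def)
  show "x \<in> {a..b} \<Longrightarrow> crep a b (wderiv a b (\<lambda>x. c * u x)) x = c * crep a b (wderiv a b u) x"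
    using e(3) c2(3) by simp
  show "AE x in leb a b. wderiv a b (wderiv a b (\<lambda>x. c * u x)) x = c * wderiv a b (wderiv a b u) x"
    using e(2) c2(2) by eventually_elim simp
qed

lemma H2_AE:
  assumes u: "u \<in> H2 a b" and ab: "a < b" and ae: "AE x in leb a b. v x = u x"
  shows "v \<in> H2 a b"
    and "x \<in> {a..b} \<Longrightarrow> crep a b (wderiv a b v) x = crep a b (wderiv a b u) x"
    and "AE x in leb a b. wderiv a b (wderiv a b v) x = wderiv a b (wderiv a b u) x"
proof -
  have 1: "u \<in> H1 a b" "wderiv a b u \<in> H1 a b" using u by (auto simp: H2_def)
  note c1 = H1_AE[OF 1(1) ab ae]
  note e = H1_AE[OF 1(2) ab c1(2)]
  show "v \<in> H2 a b" using c1(1) e(1) by (simp add: H2_def)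
  show "x \<in> {a..b} \<Longrightarrow> crep a b (wderiv a b v) x = crep a b (wderiv a b u) x" by (rule e(3))
  show "AE x in leb a b. wderiv a b (wderiv a b v) x = wderiv a b (wderiv a b u) x" by (rule e(2))
qed

lemma L2_null_imp_AE_zero:
  assumes u: "u \<in> L2 a b" and z: "hnorm (L2_std a b) u = 0"
  shows "AE x in leb a b. u x = 0"
proof -
  have "(LINT x|leb a b. (cmod (u x))\<^sup>2) = 0" using z by (simp add: hnorm_L2_std)
  then have "AE x in leb a b. (cmod (u x))\<^sup>2 = 0"
    using integral_nonneg_eq_0_iff_AE[OF L2_integrable_sq[OF u]] by simp
  then show ?thesis by eventually_elim simp
qed

lemma AE_iff_if_AE_eq:
  assumes "AE x in M. P x \<longleftrightarrow> Q x" shows "(AE x in M. P x) \<longleftrightarrow> (AE x in M. Q x)"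
proof
  assume "AE x in M. P x"
  with assms show "AE x in M. Q x" by eventually_elim blast
next
  assume "AE x in M. Q x"
  with assms show "AE x in M. P x" by eventually_elim blast
qed

section \<open>A Gronwall argument\<close>

text \<open>The tail integral of \<open>m\<close> times \<open>exp (K * x)\<close> is nondecreasing
  by the assumed inequality and zero at \<open>b\<close>. The tail integrals are therefore
  nonpositive, which forces \<open>m\<close> to vanish.\<close>

lemma Gronwall_backward_zero:
  fixes m :: "real \<Rightarrow> real"
  assumes c: "continuous_on {a..b} m" and nonneg: "\<And>x. x \<in> {a..b} \<Longrightarrow> 0 \<le> m x"
    and le: "\<And>x. x \<in> {a..b} \<Longrightarrow> m x \<le> K * integral {x..b} m" and K: "0 < K" and x: "x \<in> {a..b}"
  shows "m x = 0"
proof -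
  define h where "h x = exp (K * x) * (integral {a..b} m - integral {a..x} m)" for x
  have int: "m integrable_on {a..b}" using c by (rule integrable_continuous_real)
  have tail: "integral {a..b} m - integral {a..x} m = integral {x..b} m" if "x \<in> {a..b}" for x
    using Henstock_Kurzweil_Integration.integral_combine[of a x b m] that int by simp
  have d: "(h has_real_derivative exp (K * x) * (K * integral {x..b} m - m x)) (at x)" if x: "a < x" "x < b" for x
  proof -
    have xm: "x \<in> {a..b}" using x by auto
    have "((\<lambda>x. integral {a..x} m) has_real_derivative m x) (at x within {a..b})"
      by (rule integral_has_real_derivative[OF c xm])
    then have i: "((\<lambda>x. integral {a..x} m) has_real_derivative m x) (at x)"
      using x by (metis at_within_Icc_at)
    show ?thesis unfolding h_def tail[OF xm, symmetric]
      by (auto intro!: derivative_eq_intros i simp: algebra_simps)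
  qed
  have hc: "continuous_on {a..b} h"
    unfolding h_def by (intro continuous_intros indefinite_integral_continuous_1 int)
  have "h x \<le> h b"
  proof (rule DERIV_nonneg_imp_increasing_open[where f=h and a=x and b=b])
    show "x \<le> b" using x by simp
    show "continuous_on {x..b} h" using hc by (rule continuous_on_subset) (use x in auto)
    fix y assume y: "x < y" "y < b"
    then have "0 \<le> exp (K * y) * (K * integral {y..b} m - m y)" using le[of y] x by simp
    then show "\<exists>z. (h has_real_derivative z) (at y) \<and> 0 \<le> z" using d[of y] y x by auto
  qed
  also have "h b = 0" by (simp add: h_def)
  finally have "integral {x..b} m \<le> 0" using tail[OF x] by (simp add: h_def mult_le_0_iff)
  then have "K * integral {x..b} m \<le> 0" using K by (simp add: mult_nonneg_nonpos)
  then show ?thesis using le[OF x] nonneg[OF x] by simp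
qed

text \<open>Converts an almost everywhere bound on a derivative into an inequality with the
  Henstock-Kurzweil integral, the form in which \<open>Gronwall_backward_zero\<close> is
  applied.\<close>

lemma prim_increment_bound:
  assumes f: "integrable (leb a b) f" and g: "continuous_on {a..b} g"
    and le: "AE s in leb a b. cmod (f s) \<le> g s" and x: "x \<in> {a..b}"
  shows "cmod (prim a b f b - prim a b f x) \<le> integral {x..b} g"
proof -
  let ?g = "\<lambda>s. complex_of_real (g s)"
  have gi: "integrable (leb a b) ?g" by (intro L2_integrable continuous_L2 continuous_intros g)
  have cut: "prim a b h b - prim a b h x = (LINT s|leb a b. (if x \<le> s then h s else 0))"
    if h: "integrable (leb a b) h" for h
  proof -
    have "(LINT s|leb a b. (if x \<le> s then h s else 0)) = (LINT s|leb a b. h s - (if s < x then h s else 0))"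
      by (rule Bochner_Integration.integral_cong) auto
    also have "\<dots> = (LINT s|leb a b. h s) - (LINT s|leb a b. (if s < x then h s else 0))"
      by (rule Bochner_Integration.integral_diff[OF h integrable_cut[OF h]]) simp
    finally show ?thesis by (simp add: prim_right prim_def)
  qed
  have "cmod (prim a b f b - prim a b f x) \<le> (LINT s|leb a b. cmod (if x \<le> s then f s else 0))"
    unfolding cut[OF f] by (rule integral_norm_bound)
  also have "\<dots> \<le> (LINT s|leb a b. (if x \<le> s then g s else 0))"
  proof (rule integral_mono_AE)
    show "integrable (leb a b) (\<lambda>s. cmod (if x \<le> s then f s else 0))"
      by (intro integrable_norm integrable_cut[OF f]) simp
    have "integrable (leb a b) (\<lambda>s. if x \<le> s then ?g s else 0)" by (rule integrable_cut[OF gi]) simp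
    then have "integrable (leb a b) (\<lambda>s. Re (if x \<le> s then ?g s else 0))" by (rule integrable_Re)
    moreover have "(\<lambda>s. Re (if x \<le> s then ?g s else 0)) = (\<lambda>s. if x \<le> s then g s else 0)" by auto
    ultimately show "integrable (leb a b) (\<lambda>s. if x \<le> s then g s else 0)" by simp
    show "AE s in leb a b. cmod (if x \<le> s then f s else 0) \<le> (if x \<le> s then g s else 0)"
      using le by eventually_elim simp
  qed
  finally have 1: "cmod (prim a b f b - prim a b f x) \<le> (LINT s|leb a b. (if x \<le> s then g s else 0))" .
  have "complex_of_real (LINT s|leb a b. (if x \<le> s then g s else 0)) = (LINT s|leb a b. complex_of_real (if x \<le> s then g s else 0))"
    by simp
  also have "\<dots> = (LINT s|leb a b. (if x \<le> s then ?g s else 0))"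
    by (rule Bochner_Integration.integral_cong) auto
  also have "\<dots> = prim a b ?g b - prim a b ?g x" by (rule cut[OF gi, symmetric])
  also have "\<dots> = integral {a..b} ?g - integral {a..x} ?g"
    using x by (simp add: prim_eq_integral[OF gi])
  also have "\<dots> = integral {x..b} ?g"
  proof -
    have "?g integrable_on {a..b}" by (intro integrable_continuous_real continuous_intros g)
    then have "integral {a..x} ?g + integral {x..b} ?g = integral {a..b} ?g"
      using Henstock_Kurzweil_Integration.integral_combine[of a x b ?g] x by simp
    then show ?thesis by (metis add_diff_cancel_left')
  qed
  also have "\<dots> = of_real (integral {x..b} g)"
  proof -
    have "g integrable_on {x..b}"
      by (intro integrable_continuous_real continuous_on_subset[OF g]) (use x in auto)
    then have "(g has_integral integral {x..b} g) {x..b}" by (rule integrable_integral)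
    then have "((\<lambda>s. of_real (g s)) has_integral complex_of_real (integral {x..b} g)) {x..b}" by (rule has_integral_of_real)
    then show ?thesis by (rule integral_unique)
  qed
  finally have "(LINT s|leb a b. (if x \<le> s then g s else 0)) = integral {x..b} g" by (simp only: of_real_eq_iff)
  then show ?thesis using 1 by simp
qed

section \<open>The operators\<close>

locale sturm = annulus +
  fixes \<omega> \<sigma> :: real and nn :: "real \<Rightarrow> real"
  assumes omega_pos: "0 < \<omega>" and sigma_pos: "0 < \<sigma>" and nn: "nn \<in> Linfty r1 r2"
begin

abbreviation "Tt \<equiv> T_tilde r1 r2 \<omega> \<sigma> nn"
abbreviation "Tr \<equiv> T_op r1 r2 \<omega> \<sigma> nn"
text \<open>The zeroth-order coefficient after the substitution; at \<open>r = \<rho> t\<close> it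
  is \<delta> squared times \<open>\<omega>\<^sup>2 * nn r * r\<^sup>2\<close>. Likewise
  \<open>kap\<close> is the boundary coefficient in the variable \<open>t\<close>.\<close>

definition q where "q t = \<omega>\<^sup>2 * r1\<^sup>2 * \<delta>\<^sup>2 * exp (2 * \<delta> * t) * nn (\<rho> t)"
definition kap where "kap = \<omega> * \<sigma> * (\<delta> * r2)"

lemma kap_pos: "0 < kap"
  using omega_pos sigma_pos delta_pos r1_pos r1_less by (simp add: kap_def)

lemma T_tilde_iff:
  "(u, f) \<in> Tt \<longleftrightarrow> u \<in> H2 0 pi \<and> f \<in> L2 0 pi \<and> crep 0 pi (wderiv 0 pi u) 0 = 0 \<and>
     crep 0 pi (wderiv 0 pi u) pi = - \<i> * of_real kap * crep 0 pi u pi \<and>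
     (AE t in leb 0 pi. f t = - wderiv 0 pi (wderiv 0 pi u) t - of_real (q t) * u t)"
proof -
  have "crep 0 pi (wderiv 0 pi u) pi + \<i> * of_real \<omega> * of_real \<sigma> * of_real (\<delta> * r2) * crep 0 pi u pi = 0 \<longleftrightarrow>
    crep 0 pi (wderiv 0 pi u) pi = - \<i> * of_real kap * crep 0 pi u pi"
    by (simp add: kap_def add_eq_0_iff2 mult.assoc)
  then show ?thesis by (simp only: T_tilde_def Let_def q_def \<rho>_def mem_Collect_eq prod.case)
qed

lemma q_bounded: "q \<in> borel_measurable (leb 0 pi)" "\<exists>M. AE t in leb 0 pi. \<bar>q t\<bar> \<le> M"
proof -
  let ?c = "\<lambda>t. \<omega>\<^sup>2 * r1\<^sup>2 * \<delta>\<^sup>2 * exp (2 * \<delta> * t)"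
  have n: "push r1 r2 nn \<in> Linfty 0 pi" by (rule Linfty_push[OF nn])
  then have [measurable]: "(\<lambda>t. nn (\<rho> t)) \<in> borel_measurable (leb 0 pi)" by (simp add: Linfty_def push_eq[abs_def])
  have [measurable]: "?c \<in> borel_measurable (leb 0 pi)" by (rule borel_measurable_leb) measurable
  show "q \<in> borel_measurable (leb 0 pi)" unfolding q_def[abs_def] by measurable
  obtain C where C: "AE t in leb 0 pi. \<bar>nn (\<rho> t)\<bar> \<le> C" using n by (auto simp: Linfty_def push_eq[abs_def])
  have "AE t in leb 0 pi. ?c t \<le> ?c pi" using delta_pos by (intro AE_leb_I mult_left_mono) auto
  then have "AE t in leb 0 pi. \<bar>q t\<bar> \<le> ?c pi * C"
    using C
  proof eventually_elim
    case (elim t)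
    have "\<bar>q t\<bar> = ?c t * \<bar>nn (\<rho> t)\<bar>" by (simp add: q_def abs_mult)
    also have "\<dots> \<le> ?c pi * C" using elim by (rule mult_mono) auto
    finally show ?case .
  qed
  then show "\<exists>M. AE t in leb 0 pi. \<bar>q t\<bar> \<le> M" ..
qed

lemma q_L2: "u \<in> L2 0 pi \<Longrightarrow> (\<lambda>t. of_real (q t) * u t) \<in> L2 0 pi"
  using q_bounded L2_weight by blast

lemma Tt_mem: "(u, f) \<in> Tt \<Longrightarrow> u \<in> L2 0 pi \<and> f \<in> L2 0 pi"
  by (auto simp: T_tilde_iff H2_def H1_L2)

lemma Tt_cmult: assumes "(u, f) \<in> Tt" shows "(\<lambda>t. c * u t, \<lambda>t. c * f t) \<in> Tt"
proof -
  have T: "u \<in> H2 0 pi" "f \<in> L2 0 pi" "crep 0 pi (wderiv 0 pi u) 0 = 0"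
     "crep 0 pi (wderiv 0 pi u) pi = - \<i> * of_real kap * crep 0 pi u pi"
     "AE t in leb 0 pi. f t = - wderiv 0 pi (wderiv 0 pi u) t - of_real (q t) * u t"
    using assms by (auto simp: T_tilde_iff)
  note h = H2_cmult[OF T(1) pi_gt_zero, where c=c]
  have u1: "u \<in> H1 0 pi" using T(1) by (simp add: H2_def)
  have "AE t in leb 0 pi. c * f t = - wderiv 0 pi (wderiv 0 pi (\<lambda>t. c * u t)) t - of_real (q t) * (c * u t)"
    using T(5) h(3)
  proof eventually_elim
    case (elim t)
    show ?case unfolding elim by (simp add: algebra_simps)
  qed
  then show ?thesis
    unfolding T_tilde_iff using h(1) h(2)[where x=0] h(2)[where x=pi] T L2_cmult[OF T(2)] H1_cmult(3)[OF u1 pi_gt_zero, where x=pi and c=c] by simp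
qed

lemma Tt_AE:
  assumes "(u, f) \<in> Tt" and u': "AE t in leb 0 pi. u' t = u t" and f': "AE t in leb 0 pi. f' t = f t"
  shows "(u', f') \<in> Tt"
proof -
  have T: "u \<in> H2 0 pi" "f \<in> L2 0 pi" "crep 0 pi (wderiv 0 pi u) 0 = 0"
     "crep 0 pi (wderiv 0 pi u) pi = - \<i> * of_real kap * crep 0 pi u pi"
     "AE t in leb 0 pi. f t = - wderiv 0 pi (wderiv 0 pi u) t - of_real (q t) * u t"
    using assms by (auto simp: T_tilde_iff)
  note h = H2_AE[OF T(1) pi_gt_zero u']
  have u1: "u \<in> H1 0 pi" using T(1) by (simp add: H2_def)
  have "AE t in leb 0 pi. f t = f' t" using f' by eventually_elim simp
  then have "f' \<in> L2 0 pi" by (rule L2_AE[OF T(2)])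
  moreover have "AE t in leb 0 pi. f' t = - wderiv 0 pi (wderiv 0 pi u') t - of_real (q t) * u' t"
    using T(5) h(3) u' f' by eventually_elim simp
  ultimately show ?thesis
    unfolding T_tilde_iff using h(1) h(2)[where x=0] h(2)[where x=pi] T H1_AE(3)[OF u1 pi_gt_zero u', where x=pi] by simp
qed

text \<open>The pairing is bilinear, without conjugation. Thus the form is symmetric in
  \<open>u\<close> and \<open>v\<close> despite the nonreal boundary coefficient, and the quadratic
  form arises by inserting a conjugate for \<open>v\<close>.\<close>

lemma Tt_weak:
  assumes "(u, f) \<in> Tt" and v: "v \<in> H1 0 pi"
  shows "(LINT t|leb 0 pi. f t * v t) = \<i> * of_real kap * crep 0 pi u pi * crep 0 pi v pi
     + (LINT t|leb 0 pi. wderiv 0 pi u t * wderiv 0 pi v t) - (LINT t|leb 0 pi. of_real (q t) * u t * v t)"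
proof -
  have T: "u \<in> H1 0 pi" "wderiv 0 pi u \<in> H1 0 pi" "f \<in> L2 0 pi" "crep 0 pi (wderiv 0 pi u) 0 = 0"
     "crep 0 pi (wderiv 0 pi u) pi = - \<i> * of_real kap * crep 0 pi u pi"
     "AE t in leb 0 pi. f t = - wderiv 0 pi (wderiv 0 pi u) t - of_real (q t) * u t"
    using assms by (auto simp: T_tilde_iff H2_def)
  let ?w = "wderiv 0 pi (wderiv 0 pi u)"
  have m2: "?w \<in> L2 0 pi" "(\<lambda>t. of_real (q t) * u t) \<in> L2 0 pi" "v \<in> L2 0 pi"
    using wderiv_H1(1)[OF T(2)] q_L2[OF H1_L2[OF T(1)]] H1_L2[OF v] by auto
  have i: "integrable (leb 0 pi) (\<lambda>t. ?w t * v t)" "integrable (leb 0 pi) (\<lambda>t. of_real (q t) * u t * v t)"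
    by (intro L2_mult_integrable m2)+
  have "(LINT t|leb 0 pi. f t * v t) = (LINT t|leb 0 pi. - (?w t * v t) - of_real (q t) * u t * v t)"
  proof (rule integral_cong_AE)
    show "AE t in leb 0 pi. f t * v t = - (?w t * v t) - of_real (q t) * u t * v t"
      using T(6)
    proof eventually_elim
      case (elim t)
      show ?case unfolding elim by (simp add: algebra_simps)
    qed
  qed (use L2_mult_integrable[OF T(3) m2(3)] i in auto)
  also have "\<dots> = - (LINT t|leb 0 pi. ?w t * v t) - (LINT t|leb 0 pi. of_real (q t) * u t * v t)"
    using i by simp
  also have "(LINT t|leb 0 pi. ?w t * v t) =
      - \<i> * of_real kap * crep 0 pi u pi * crep 0 pi v pi - (LINT t|leb 0 pi. wderiv 0 pi u t * wderiv 0 pi v t)"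
    using H1_parts[OF T(2) v pi_gt_zero] T(4,5) by (simp add: eq_diff_eq add.commute)
  finally show ?thesis by simp
qed

lemma Tt_symmetric:
  assumes a: "(u, f) \<in> Tt" and b: "(v, g) \<in> Tt"
  shows "(LINT t|leb 0 pi. f t * v t) = (LINT t|leb 0 pi. u t * g t)"
proof -
  have h: "u \<in> H1 0 pi" "v \<in> H1 0 pi" using a b by (auto simp: T_tilde_iff H2_def)
  show ?thesis using Tt_weak[OF a h(2)] Tt_weak[OF b h(1)] by (simp add: mult_ac)
qed

lemma Tt_kernel:
  assumes "(u, f) \<in> Tt" and f: "AE t in leb 0 pi. f t = 0"
  shows "hnorm (L2_std 0 pi) u = 0"
proof -
  have T: "u \<in> H1 0 pi" "wderiv 0 pi u \<in> H1 0 pi" "f \<in> L2 0 pi"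
     "crep 0 pi (wderiv 0 pi u) pi = - \<i> * of_real kap * crep 0 pi u pi"
     "AE t in leb 0 pi. f t = - wderiv 0 pi (wderiv 0 pi u) t - of_real (q t) * u t"
    using assms by (auto simp: T_tilde_iff H2_def)
  let ?U = "crep 0 pi u" and ?V = "crep 0 pi (wderiv 0 pi u)" and ?w = "wderiv 0 pi (wderiv 0 pi u)"
  note c = H1_cnj[OF T(1) pi_gt_zero]
  have "(LINT t|leb 0 pi. f t * cnj (u t)) = (LINT t|leb 0 pi. 0)"
  proof (rule integral_cong_AE)
    show "(\<lambda>t. f t * cnj (u t)) \<in> borel_measurable (leb 0 pi)"
      using L2_mult_integrable[OF T(3) L2_cnj[OF H1_L2[OF T(1)]]] by simp
    show "AE t in leb 0 pi. f t * cnj (u t) = 0" using f by eventually_elim simp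
  qed simp
  \<comment> \<open>The weak equation tested with the conjugate of \<open>u\<close>. As
    \<open>q\<close> is real, only the boundary term can have an imaginary part.\<close>
  then have z: "\<i> * of_real kap * ?U pi * cnj (?U pi) + (LINT t|leb 0 pi. wderiv 0 pi u t * wderiv 0 pi (\<lambda>t. cnj (u t)) t)
     - (LINT t|leb 0 pi. of_real (q t) * u t * cnj (u t)) = 0"
    using Tt_weak[OF assms(1) c(1)] c(3)[of pi] by simp
  have "(LINT t|leb 0 pi. wderiv 0 pi u t * wderiv 0 pi (\<lambda>t. cnj (u t)) t) = (LINT t|leb 0 pi. wderiv 0 pi u t * cnj (wderiv 0 pi u t))"
  proof (rule integral_cong_AE)
    show "AE t in leb 0 pi. wderiv 0 pi u t * wderiv 0 pi (\<lambda>t. cnj (u t)) t = wderiv 0 pi u t * cnj (wderiv 0 pi u t)"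
      using c(2) by eventually_elim simp
  qed (use L2_mult_integrable wderiv_H1(1)[OF T(1)] wderiv_H1(1)[OF c(1)] L2_cnj[OF wderiv_H1(1)[OF T(1)]] in \<open>blast intro: borel_measurable_integrable\<close>)+
  also have "\<dots> = of_real ((hnorm (L2_std 0 pi) (wderiv 0 pi u))\<^sup>2)"
    using L2s.ip_self[of "wderiv 0 pi u" 0 pi] wderiv_H1(1)[OF T(1)] by (simp add: L2_ip_one)
  finally have 1: "Im (LINT t|leb 0 pi. wderiv 0 pi u t * wderiv 0 pi (\<lambda>t. cnj (u t)) t) = 0" by simp
  have "(LINT t|leb 0 pi. of_real (q t) * u t * cnj (u t)) = L2_ip 0 pi q u u" by (simp add: L2_ip_def)
  then have 2: "Im (LINT t|leb 0 pi. of_real (q t) * u t * cnj (u t)) = 0" by (simp add: L2_ip_self)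
  have "?U pi * cnj (?U pi) = of_real ((cmod (?U pi))\<^sup>2)" by (rule complex_norm_square[symmetric])
  then have "\<i> * of_real kap * ?U pi * cnj (?U pi) = \<i> * of_real (kap * (cmod (?U pi))\<^sup>2)"
    by (simp only: mult.assoc of_real_mult)
  then have "Im (\<i> * of_real kap * ?U pi * cnj (?U pi)) = kap * (cmod (?U pi))\<^sup>2"
    by (simp only: Im_i_times Re_complex_of_real)
  moreover have "Im (\<i> * of_real kap * ?U pi * cnj (?U pi)) = 0"
    using arg_cong[OF z, of Im] 1 2 by simp
  ultimately have U0: "?U pi = 0" using kap_pos by simp
  then have V0: "?V pi = 0" using T(4) by simp
  obtain M where M: "AE t in leb 0 pi. \<bar>q t\<bar> \<le> M" using q_bounded by blast
  \<comment> \<open>For the first-order system \<open>U' = V\<close>, \<open>V' = - q U\<close>, the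
    two derivatives are bounded by \<open>m\<close> and \<open>\<bar>M\<bar> * m\<close>
    respectively; \<open>K\<close> adds the two constants.\<close>
  define K where "K = 1 + \<bar>M\<bar>"
  define m where "m t = cmod (?U t) + cmod (?V t)" for t
  have cU: "continuous_on {0..pi} ?U" "continuous_on {0..pi} ?V" by (intro continuous_crep T pi_gt_zero)+
  have cm: "continuous_on {0..pi} (\<lambda>t. c * m t)" for c unfolding m_def by (intro continuous_intros cU)
  note w2 = wderiv_H1(1)[OF T(1)] wderiv_H1(1)[OF T(2)]
  have m0: "m t = 0" if t: "t \<in> {0..pi}" for t
  proof (rule Gronwall_backward_zero[where K=K and m=m and a=0 and b=pi and x=t])
    show "continuous_on {0..pi} m" using cm[of 1] by simp
    fix x assume x: "x \<in> {0..pi}"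
    show "0 \<le> m x" by (simp add: m_def)
    have inc: "cmod (?V x) \<le> integral {x..pi} (\<lambda>t. \<bar>M\<bar> * m t)"
    proof -
      have "AE t in leb 0 pi. cmod (?w t) \<le> \<bar>M\<bar> * m t"
        using T(5) f M H1_rep(1)[OF T(1) pi_gt_zero]
      proof eventually_elim
        case (elim t)
        have "?w t = - (of_real (q t) * u t)" using elim(1,2) by algebra
        then have "?w t = - (of_real (q t) * ?U t)" by (simp only: elim(4))
        then have "cmod (?w t) = \<bar>q t\<bar> * cmod (?U t)" by (simp add: norm_mult)
        also have "\<dots> \<le> \<bar>M\<bar> * m t" using elim by (intro mult_mono) (auto simp: m_def)
        finally show ?case .
      qed
      from prim_increment_bound[OF L2_integrable[OF w2(2)] cm this x]
      have "cmod (?V pi - ?V x) \<le> integral {x..pi} (\<lambda>t. \<bar>M\<bar> * m t)"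
        using H1_rep(2)[OF T(2) pi_gt_zero, of pi] H1_rep(2)[OF T(2) pi_gt_zero x] by simp
      then show ?thesis using V0 by simp
    qed
    have "cmod (?U x) \<le> integral {x..pi} (\<lambda>t. 1 * m t)"
    proof -
      have "AE t in leb 0 pi. cmod (wderiv 0 pi u t) \<le> 1 * m t"
        using H1_rep(1)[OF T(2) pi_gt_zero] by eventually_elim (simp add: m_def)
      from prim_increment_bound[OF L2_integrable[OF w2(1)] cm this x]
      have "cmod (?U pi - ?U x) \<le> integral {x..pi} (\<lambda>t. 1 * m t)"
        using H1_rep(2)[OF T(1) pi_gt_zero, of pi] H1_rep(2)[OF T(1) pi_gt_zero x] by simp
      then show ?thesis using U0 by simp
    qed
    then show "m x \<le> K * integral {x..pi} m"
      using inc by (simp add: m_def[of x] K_def distrib_right)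
  qed (use t in \<open>auto simp: K_def add_pos_nonneg\<close>)
  have "AE t in leb 0 pi. t \<in> {0..pi}" by (rule AE_leb_I) auto
  then have "AE t in leb 0 pi. u t = 0"
    using H1_rep(1)[OF T(1) pi_gt_zero]
  proof eventually_elim
    case (elim t)
    then have "cmod (?U t) + cmod (?V t) = 0" using m0[of t] by (simp add: m_def)
    then show ?case using elim by (simp add: add_nonneg_eq_0_iff)
  qed
  then have "AE t in leb 0 pi. (cmod (u t))\<^sup>2 = 0" by eventually_elim simp
  then have "(LINT t|leb 0 pi. (cmod (u t))\<^sup>2) = 0" by (rule integral_eq_zero_AE)
  then show ?thesis by (simp add: hnorm_L2_std)
qed

section \<open>The adjoint is the complex conjugate\<close>

theorem adjoint_T_tilde:
  assumes res: "z \<in> resolvent_set (L2_std 0 pi) Tt"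
  shows "(v, w) \<in> adjoint_op (L2_std 0 pi) Tt \<longleftrightarrow> (\<lambda>t. cnj (v t), \<lambda>t. cnj (w t)) \<in> Tt"
proof
  have sub: "ip (L2_std 0 pi) f v = ip (L2_std 0 pi) u w"
    if "(u, f) \<in> Tt" "(\<lambda>t. cnj (v t), \<lambda>t. cnj (w t)) \<in> Tt" for u f v w
    using Tt_symmetric[OF that] by (simp add: L2_ip_one)
  {
    assume "(\<lambda>t. cnj (v t), \<lambda>t. cnj (w t)) \<in> Tt"
    moreover from this have "(\<lambda>t. cnj (cnj (v t))) \<in> L2 0 pi" "(\<lambda>t. cnj (cnj (w t))) \<in> L2 0 pi"
      using Tt_mem L2_cnj by blast+
    ultimately show "(v, w) \<in> adjoint_op (L2_std 0 pi) Tt" using sub by (auto simp: adjoint_op_def)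
  }
  assume adj: "(v, w) \<in> adjoint_op (L2_std 0 pi) Tt"
  then have v: "v \<in> L2 0 pi" and w: "w \<in> L2 0 pi"
    and a: "\<And>u f. (u, f) \<in> Tt \<Longrightarrow> ip (L2_std 0 pi) f v = ip (L2_std 0 pi) u w"
    by (auto simp: adjoint_op_def)
  have surj: "\<exists>u. (u, \<lambda>t. z * u t + g t) \<in> Tt" if "g \<in> L2 0 pi" for g
    using res that by (simp add: resolvent_set_def)
  let ?g = "\<lambda>t. w t - cnj z * v t"
  have g: "?g \<in> L2 0 pi" by (intro L2_diff L2_cmult v w)
  \<comment> \<open>The conjugate of \<open>u0\<close> solves the conjugate equation, shifted by
    \<open>cnj z\<close>, with the right-hand side that belongs to \<open>v\<close>. It remains to
    show that it equals \<open>v\<close> almost everywhere.\<close>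
  obtain u0 where u0: "(u0, \<lambda>t. z * u0 t + cnj (?g t)) \<in> Tt" using surj[OF L2_cnj[OF g]] by blast
  define v0 where "v0 t = cnj (u0 t)" for t
  let ?w0 = "\<lambda>t. cnj z * v0 t + ?g t"
  have v0T: "(\<lambda>t. cnj (v0 t), \<lambda>t. cnj (?w0 t)) \<in> Tt" using u0 by (simp add: v0_def)
  have v0: "v0 \<in> L2 0 pi" using Tt_mem[OF u0] L2_cnj unfolding v0_def by blast
  let ?d = "\<lambda>t. v t - v0 t"
  have d: "?d \<in> L2 0 pi" by (intro L2_diff v v0)
  \<comment> \<open>Surjectivity is used a second time, now with the difference as right-hand side:
    the adjoint relations make it orthogonal to the range of \<open>Tt - z\<close>, hence to
    itself.\<close>
  obtain u where u: "(u, \<lambda>t. z * u t + ?d t) \<in> Tt" using surj[OF d] by blast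
  have um: "u \<in> L2 0 pi" using Tt_mem[OF u] by blast
  let ?f = "\<lambda>t. z * u t + ?d t"
  have fm: "?f \<in> L2 0 pi" by (intro L2_add L2_cmult um d)
  have w0m: "?w0 \<in> L2 0 pi" by (intro L2_add L2_cmult v0 g)
  have "L2_ip 0 pi (\<lambda>_. 1) ?f v - L2_ip 0 pi (\<lambda>_. 1) ?f v0 = L2_ip 0 pi (\<lambda>_. 1) u w - L2_ip 0 pi (\<lambda>_. 1) u ?w0"
    using a[OF u] sub[OF u v0T] by simp
  then have "L2_ip 0 pi (\<lambda>_. 1) ?f ?d = L2_ip 0 pi (\<lambda>_. 1) u (\<lambda>t. w t - ?w0 t)"
    using L2s.ip_diff_right[of v 0 pi v0 ?f] L2s.ip_diff_right[of w 0 pi ?w0 u] v v0 fm um w w0m by simp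
  also have "(\<lambda>t. w t - ?w0 t) = (\<lambda>t. cnj z * ?d t)" by (simp add: algebra_simps)
  also have "L2_ip 0 pi (\<lambda>_. 1) u (\<lambda>t. cnj z * ?d t) = z * L2_ip 0 pi (\<lambda>_. 1) u ?d"
    using L2s.ip_cmult_right[of ?d 0 pi u "cnj z"] d um by simp
  also have "L2_ip 0 pi (\<lambda>_. 1) ?f ?d = z * L2_ip 0 pi (\<lambda>_. 1) u ?d + L2_ip 0 pi (\<lambda>_. 1) ?d ?d"
    using L2s.ip_add[of "\<lambda>t. z * u t" 0 pi ?d ?d] L2s.ip_cmult[of u 0 pi ?d z] L2_cmult[OF um] d um by simp
  finally have "L2_ip 0 pi (\<lambda>_. 1) ?d ?d = 0" by simp
  then have "hnorm (L2_std 0 pi) ?d = 0" by (simp add: hnorm_def)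
  then have ae: "AE t in leb 0 pi. ?d t = 0" by (rule L2_null_imp_AE_zero[OF d])
  show "(\<lambda>t. cnj (v t), \<lambda>t. cnj (w t)) \<in> Tt"
  proof (rule Tt_AE[OF v0T])
    show "AE t in leb 0 pi. cnj (v t) = cnj (v0 t)" using ae by eventually_elim simp
    show "AE t in leb 0 pi. cnj (w t) = cnj (?w0 t)" using ae by eventually_elim (simp add: algebra_simps)
  qed
qed

section \<open>Change of variables for the operators\<close>

lemma rho_recip_deriv: "((\<lambda>t. 1 / \<rho> t) has_real_derivative - (\<delta> / \<rho> t)) (at t)"
  using rho_pos[of t] by (auto intro!: derivative_eq_intros rho_deriv simp: power2_eq_square)

text \<open>In the variable \<open>t\<close> the operator \<open>r d/dr\<close> becomes
  \<open>d/dt\<close> divided by \<delta>. The first derivative is thus \<delta> times the push of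
  \<open>r u'\<close>, which is again in \<open>H1\<close>, and the same rule applies once
  more.\<close>

lemma H2_push_imp:
  assumes u: "u \<in> H1 r1 r2" and W: "wderiv r1 r2 u \<in> H1 r1 r2"
  shows "push r1 r2 u \<in> H2 0 pi"
    and "t \<in> {0..pi} \<Longrightarrow> crep 0 pi (wderiv 0 pi (push r1 r2 u)) t = of_real (\<delta> * \<rho> t) * crep r1 r2 (wderiv r1 r2 u) (\<rho> t)"
    and "AE t in leb 0 pi. wderiv 0 pi (wderiv 0 pi (push r1 r2 u)) t =
       of_real (\<delta>\<^sup>2 * \<rho> t) * wderiv r1 r2 (\<lambda>s. of_real s * wderiv r1 r2 u s) (\<rho> t)"
proof -
  let ?RW = "\<lambda>s. of_real s * wderiv r1 r2 u s"
  have RW: "?RW \<in> H1 r1 r2" and cRW: "\<And>x. x \<in> {r1..r2} \<Longrightarrow> crep r1 r2 ?RW x = of_real x * crep r1 r2 (wderiv r1 r2 u) x"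
    using H1_mult_C1[OF W r1_less, of "\<lambda>s. s" "\<lambda>_. 1"] by auto
  have pRW: "push r1 r2 ?RW \<in> H1 0 pi" using RW by (simp add: H1_push)
  note c = H1_cmult[OF pRW pi_gt_zero, where c="of_real \<delta>"]
  have "AE t in leb 0 pi. wderiv 0 pi (push r1 r2 u) t = of_real \<delta> * push r1 r2 ?RW t"
    using wderiv_push(1)[OF u] by eventually_elim (simp add: push_eq mult.assoc)
  note e = H1_AE[OF c(1) pi_gt_zero this]
  show "push r1 r2 u \<in> H2 0 pi" using u e(1) by (simp add: H2_def H1_push)
  show "crep 0 pi (wderiv 0 pi (push r1 r2 u)) t = of_real (\<delta> * \<rho> t) * crep r1 r2 (wderiv r1 r2 u) (\<rho> t)" if t: "t \<in> {0..pi}"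
    using e(3)[OF t] c(3)[OF t] wderiv_push(2)[OF RW t] cRW[of "\<rho> t"] t rho_mem_cl[of t] by (simp add: mult.assoc)
  show "AE t in leb 0 pi. wderiv 0 pi (wderiv 0 pi (push r1 r2 u)) t = of_real (\<delta>\<^sup>2 * \<rho> t) * wderiv r1 r2 ?RW (\<rho> t)"
    using e(2) c(2) wderiv_push(1)[OF RW] by eventually_elim (simp add: push_eq power2_eq_square mult.assoc)
qed

text \<open>The derivative in \<open>r\<close> is the derivative in \<open>t\<close> divided by the
  Jacobian, and \<open>1 / \<rho> t\<close> is continuously differentiable, so \<open>H1\<close>
  regularity survives the division.\<close>

lemma H2_push_rev:
  assumes u: "push r1 r2 u \<in> H2 0 pi"
  shows "u \<in> H1 r1 r2" "wderiv r1 r2 u \<in> H1 r1 r2"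
proof -
  show u1: "u \<in> H1 r1 r2" using u by (simp add: H2_def H1_push)
  have w: "wderiv 0 pi (push r1 r2 u) \<in> H1 0 pi" using u by (simp add: H2_def)
  have "continuous_on UNIV (\<lambda>t. - (\<delta> / \<rho> t))" using rho_pos by (intro continuous_intros continuous_rho) (simp add: less_imp_neq[symmetric])
  from H1_mult_C1(1)[OF w pi_gt_zero rho_recip_deriv this]
  have "(\<lambda>t. of_real (1 / \<rho> t) * wderiv 0 pi (push r1 r2 u) t) \<in> H1 0 pi" .
  from H1_cmult(1)[OF this pi_gt_zero, where c="of_real (1 / \<delta>)"]
  have h: "(\<lambda>t. of_real (1 / \<delta>) * (of_real (1 / \<rho> t) * wderiv 0 pi (push r1 r2 u) t)) \<in> H1 0 pi" .
  have "AE t in leb 0 pi. push r1 r2 (wderiv r1 r2 u) t = of_real (1 / \<delta>) * (of_real (1 / \<rho> t) * wderiv 0 pi (push r1 r2 u) t)"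
    using wderiv_push(1)[OF u1]
  proof eventually_elim
    case (elim t)
    then show ?case using delta_pos rho_pos[of t] by simp
  qed
  from H1_AE(1)[OF h pi_gt_zero this] show "wderiv r1 r2 u \<in> H1 r1 r2" by (simp add: H1_push)
qed

theorem T_op_iff: "(u, f) \<in> Tr \<longleftrightarrow> (push r1 r2 u, \<lambda>t. of_real (\<delta>\<^sup>2) * push r1 r2 f t) \<in> Tt"
proof (cases "u \<in> H2 r1 r2")
  case False
  then have "push r1 r2 u \<notin> H2 0 pi" using H2_push_rev[of u] by (auto simp: H2_def)
  with False show ?thesis by (simp add: T_tilde_iff T_op_def)
next
  case True
  then have u: "u \<in> H1 r1 r2" "wderiv r1 r2 u \<in> H1 r1 r2" by (auto simp: H2_def)
  note h = H2_push_imp[OF u]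
  let ?RW = "\<lambda>s. of_real s * wderiv r1 r2 u s"
  have d0: "\<delta> \<noteq> 0" using delta_pos by simp
  have L: "(\<lambda>t. of_real (\<delta>\<^sup>2) * push r1 r2 f t) \<in> L2 0 pi \<longleftrightarrow> f \<in> L2 r1 r2"
  proof -
    have "(\<lambda>t. of_real (\<delta>\<^sup>2) * push r1 r2 f t) \<in> L2 0 pi \<longleftrightarrow> push r1 r2 f \<in> L2 0 pi"
    proof
      assume "(\<lambda>t. of_real (\<delta>\<^sup>2) * push r1 r2 f t) \<in> L2 0 pi"
      from L2_cmult[OF this, of "of_real (1 / \<delta>\<^sup>2)"] show "push r1 r2 f \<in> L2 0 pi" using d0 by simp
    qed (rule L2_cmult)
    then show ?thesis by (simp add: L2_push)
  qed
  have b1: "crep 0 pi (wderiv 0 pi (push r1 r2 u)) 0 = 0 \<longleftrightarrow> crep r1 r2 (wderiv r1 r2 u) r1 = 0"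
    using h(2)[of 0] d0 r1_pos by (simp add: rho_0)
  have b2: "crep 0 pi (wderiv 0 pi (push r1 r2 u)) pi = - \<i> * of_real kap * crep 0 pi (push r1 r2 u) pi \<longleftrightarrow>
     crep r1 r2 (wderiv r1 r2 u) r2 + \<i> * of_real \<omega> * of_real \<sigma> * crep r1 r2 u r2 = 0"
  proof -
    \<comment> \<open>The boundary conditions differ by the chain-rule factor at \<open>r2\<close>,
      which is the factor contained in \<open>kap\<close>.\<close>
    have "of_real (\<delta> * r2) * (crep r1 r2 (wderiv r1 r2 u) r2 + \<i> * of_real \<omega> * of_real \<sigma> * crep r1 r2 u r2) =
      crep 0 pi (wderiv 0 pi (push r1 r2 u)) pi + \<i> * of_real kap * crep 0 pi (push r1 r2 u) pi"
      using h(2)[of pi] wderiv_push(2)[OF u(1), of pi] by (simp add: rho_pi kap_def algebra_simps)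
    moreover have "of_real (\<delta> * r2) \<noteq> (0::complex)" using d0 r1_pos r1_less by simp
    ultimately show ?thesis by (metis (no_types, lifting) add_eq_0_iff2 mult_eq_0_iff mult_minus_left)
  qed
  have q: "q t = \<omega>\<^sup>2 * nn (\<rho> t) * (\<rho> t)\<^sup>2 * \<delta>\<^sup>2" for t
    using exp_double[of "\<delta> * t"] by (simp add: q_def \<rho>_def power_mult_distrib mult.assoc)
  have eq: "(AE t in leb 0 pi. of_real (\<delta>\<^sup>2) * push r1 r2 f t =
      - wderiv 0 pi (wderiv 0 pi (push r1 r2 u)) t - of_real (q t) * push r1 r2 u t) \<longleftrightarrow>
     (AE r in leb r1 r2. f r = - of_real r * wderiv r1 r2 ?RW r - of_real (\<omega>\<^sup>2 * nn r * r\<^sup>2) * u r)"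
  proof -
    have "AE t in leb 0 pi. (of_real (\<delta>\<^sup>2) * push r1 r2 f t =
      - wderiv 0 pi (wderiv 0 pi (push r1 r2 u)) t - of_real (q t) * push r1 r2 u t) \<longleftrightarrow>
      f (\<rho> t) = - of_real (\<rho> t) * wderiv r1 r2 ?RW (\<rho> t) - of_real (\<omega>\<^sup>2 * nn (\<rho> t) * (\<rho> t)\<^sup>2) * u (\<rho> t)"
      using h(3)
    proof eventually_elim
      case (elim t)
      have "- wderiv 0 pi (wderiv 0 pi (push r1 r2 u)) t - of_real (q t) * push r1 r2 u t =
        of_real (\<delta>\<^sup>2) * (- of_real (\<rho> t) * wderiv r1 r2 ?RW (\<rho> t) - of_real (\<omega>\<^sup>2 * nn (\<rho> t) * (\<rho> t)\<^sup>2) * u (\<rho> t))"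
        unfolding elim q push_eq by (simp add: algebra_simps)
      moreover have "of_real (\<delta>\<^sup>2) \<noteq> (0::complex)" using d0 by simp
      ultimately show ?case by (simp only: push_eq mult_cancel_left simp_thms)
    qed
    then show ?thesis unfolding AE_change_vars by (rule AE_iff_if_AE_eq)
  qed
  show ?thesis
    unfolding T_tilde_iff unfolding T_op_def L b1 b2 eq using True h(1) by simp
qed

end

section \<open>Sequences of comparable size\<close>

lemma asymp_equiv_seqI:
  assumes "0 < c" "0 < C" "\<And>n. c * b n \<le> a n" "\<And>n. a n \<le> C * b n"
  shows "asymp_equiv_seq a b"
  unfolding asymp_equiv_seq_def by (intro exI[of _ c] exI[of _ C]) (use assms in auto)

lemma asymp_equiv_seqE:
  assumes "asymp_equiv_seq a b"
  obtains c C where "0 < c" "0 < C" "\<And>n. c * b n \<le> a n" "\<And>n. a n \<le> C * b n"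
  using assms unfolding asymp_equiv_seq_def by auto

lemma asymp_trans:
  assumes "asymp_equiv_seq a b" "asymp_equiv_seq b d" shows "asymp_equiv_seq a d"
proof -
  obtain c C where c: "0 < c" "0 < C" "\<And>n. c * b n \<le> a n" "\<And>n. a n \<le> C * b n"
    by (rule asymp_equiv_seqE[OF assms(1)]) (rule that)
  obtain e E where e: "0 < e" "0 < E" "\<And>n. e * d n \<le> b n" "\<And>n. b n \<le> E * d n"
    by (rule asymp_equiv_seqE[OF assms(2)]) (rule that)
  show ?thesis
  proof (rule asymp_equiv_seqI[of "c * e" "C * E"])
    fix n
    have "c * (e * d n) \<le> c * b n" "C * b n \<le> C * (E * d n)" using c e by (auto intro: mult_left_mono)
    then show "c * e * d n \<le> a n" "a n \<le> C * E * d n"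
      using c(3,4)[of n] unfolding mult.assoc by linarith+
  qed (use c e in auto)
qed

lemma asymp_sym:
  assumes "asymp_equiv_seq a b" shows "asymp_equiv_seq b a"
proof -
  obtain c C where c: "0 < c" "0 < C" "\<And>n. c * b n \<le> a n" "\<And>n. a n \<le> C * b n"
    by (rule asymp_equiv_seqE[OF assms(1)]) (rule that)
  show ?thesis
    by (rule asymp_equiv_seqI[of "1 / C" "1 / c"])
       (use c in \<open>auto simp: pos_divide_le_eq pos_le_divide_eq mult.commute\<close>)
qed

lemma asymp_mult:
  assumes "asymp_equiv_seq a b" and d: "\<And>n. 0 \<le> d n"
  shows "asymp_equiv_seq (\<lambda>n. d n * a n) (\<lambda>n. d n * b n)"
proof -
  obtain c C where c: "0 < c" "0 < C" "\<And>n. c * b n \<le> a n" "\<And>n. a n \<le> C * b n"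
    by (rule asymp_equiv_seqE[OF assms(1)]) (rule that)
  show ?thesis
  proof (rule asymp_equiv_seqI[OF c(1,2)])
    fix n
    show "c * (d n * b n) \<le> d n * a n" "d n * a n \<le> C * (d n * b n)"
      using mult_left_mono[OF c(3)[of n] d[of n]] mult_left_mono[OF c(4)[of n] d[of n]] by (simp_all add: mult.left_commute)
  qed
qed

lemma asymp_cmult:
  assumes "0 < k" "\<And>n. 0 \<le> a n" shows "asymp_equiv_seq (\<lambda>n. k * a n) a"
  by (rule asymp_equiv_seqI[of k k]) (use assms in auto)

text \<open>Convergent sequences are bounded; this is applied to the ratio and to its reciprocal.
  Positivity of every term covers the finitely many indices about which the limit says
  nothing.\<close>

lemma asymp_if_ratio_tendsto_1:
  assumes lim: "(\<lambda>n. a n / b n) \<longlonglongrightarrow> 1" and a: "\<And>n. 0 < a n" and b: "\<And>n. (0::real) < b n"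
  shows "asymp_equiv_seq a b"
proof -
  have "bounded (range (\<lambda>n. a n / b n))" using lim convergent_imp_bounded by blast
  then obtain C where C: "\<And>n. \<bar>a n / b n\<bar> \<le> C" by (auto simp: bounded_iff)
  have "(\<lambda>n. inverse (a n / b n)) \<longlonglongrightarrow> inverse 1" by (intro tendsto_inverse lim) simp
  then have "bounded (range (\<lambda>n. inverse (a n / b n)))" using convergent_imp_bounded by blast
  then obtain D where D: "\<And>n. \<bar>inverse (a n / b n)\<bar> \<le> D" by (auto simp: bounded_iff)
  have C': "a n / b n \<le> C" for n using order_trans[OF abs_ge_self C[of n]] .
  have D': "b n / a n \<le> D" for n using order_trans[OF abs_ge_self D[of n]] by simp
  have "0 < b 0 / a 0" "0 < a 0 / b 0" using a[of 0] b[of 0] by simp_all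
  then have D0: "0 < D" and C0: "0 < C" using D'[of 0] C'[of 0] by linarith+
  show ?thesis
  proof (rule asymp_equiv_seqI[of "1 / D" C])
    fix n
    have "b n \<le> D * a n" using D'[of n] a[of n] by (simp add: pos_divide_le_eq)
    then show "1 / D * b n \<le> a n" using D0 by (simp add: pos_divide_le_eq mult.commute)
    show "a n \<le> C * b n" using C'[of n] b[of n] by (simp add: pos_divide_le_eq)
  qed (use C0 D0 in auto)
qed

section \<open>Transport to the annulus\<close>

lemma (in semi_ip) orthogonal_basis_cmult:
  assumes e: "orthogonal_basis H e" and c: "c \<noteq> 0"
  shows "orthogonal_basis H (\<lambda>n t. c * e n t)"
proof -
  interpret I: transport H H False "\<lambda>r. r" "\<lambda>r. r" by unfold_locales auto
  interpret I: norm_transport H H False "\<lambda>r. r" "\<lambda>r. r" 1 1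
    by unfold_locales (auto simp: I.Q_def cnj_if_const)
  have m: "e n \<in> elems H" for n using e by (simp add: orthogonal_basis_def)
  have t: "total_seq H (\<lambda>n t. c * e n t)"
    using I.total_seq_transport[OF _ m, where \<alpha>="\<lambda>_. c"] e c by (simp add: I.P_def cnj_if_const orthogonal_basis_def)
  show ?thesis
    unfolding orthogonal_basis_def hnorm_cmult[OF m] ip_cmult[OF m cmult_mem[OF m]] ip_cmult_right[OF m m]
    using t e c by (simp add: orthogonal_basis_def cmult_mem)
qed

lemma (in semi_ip) root_space_cmult:
  assumes A: "\<And>u f c. (u, f) \<in> A \<Longrightarrow> (\<lambda>t. c * u t, \<lambda>t. c * f t) \<in> A" and u: "u \<in> root_space H A z"
  shows "(\<lambda>t. c * u t) \<in> root_space H A z"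
proof -
  have s: "(\<lambda>t. c * u t, \<lambda>t. c * w t) \<in> shift_op A z" if "(u, w) \<in> shift_op A z" for u w
    using A[of u "\<lambda>t. w t + z * u t" c] that by (simp add: shift_iff algebra_simps)
  have p: "(u, w) \<in> shift_op A z ^^ k \<Longrightarrow> (\<lambda>t. c * u t, \<lambda>t. c * w t) \<in> shift_op A z ^^ k" for k w
  proof (induction k arbitrary: w)
    case 0
    then show ?case by simp
  next
    case (Suc k)
    then obtain v where v: "(u, v) \<in> shift_op A z ^^ k" "(v, w) \<in> shift_op A z" by (elim relpow_Suc_E)
    show ?case by (rule relpow_Suc_I[OF Suc.IH[OF v(1)] s[OF v(2)]])
  qed
  obtain k w where w: "(u, w) \<in> shift_op A z ^^ k" "w \<in> elems H" "hnorm H w = 0"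
    using u by (auto simp: root_space_def)
  then have "(\<lambda>t. c * w t) \<in> elems H" "hnorm H (\<lambda>t. c * w t) = 0"
    using cmult_mem hnorm_cmult by auto
  with p[OF w(1)] show ?thesis
    unfolding root_space_def mem_Collect_eq by (intro exI[of _ k] exI[of _ "\<lambda>t. c * w t"] conjI)
qed

context annulus
begin

text \<open>The weight \<open>1 / r\<close> cancels the Jacobian except for its constant factor
  \<delta>.\<close>

lemma L2_ip_recip: "L2_ip r1 r2 (\<lambda>r. 1 / r) u v = of_real \<delta> * L2_ip 0 pi (\<lambda>_. 1) (push r1 r2 u) (push r1 r2 v)"
proof -
  have "(\<lambda>t. \<delta> * \<rho> t * (1 / \<rho> t)) = (\<lambda>_. \<delta>)" using rho_pos by (simp add: fun_eq_iff less_imp_neq[symmetric])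
  then show ?thesis unfolding L2_ip_push by (simp only: L2_ip_const[of _ _ \<delta>])
qed

lemma L2_ip_wderiv_push:
  assumes u: "u \<in> H1 r1 r2" and v: "v \<in> H1 r1 r2"
  shows "L2_ip 0 pi (\<lambda>_. 1) (wderiv 0 pi (push r1 r2 u)) (wderiv 0 pi (push r1 r2 v))
       = of_real \<delta> * L2_ip r1 r2 (\<lambda>r. r) (wderiv r1 r2 u) (wderiv r1 r2 v)"
proof -
  have "push r1 r2 u \<in> H1 0 pi" "push r1 r2 v \<in> H1 0 pi" using u v by (simp_all add: H1_push)
  then have "L2_ip 0 pi (\<lambda>_. 1) (wderiv 0 pi (push r1 r2 u)) (wderiv 0 pi (push r1 r2 v)) =
    L2_ip 0 pi (\<lambda>_. 1) (\<lambda>t. of_real (\<delta> * \<rho> t) * push r1 r2 (wderiv r1 r2 u) t) (\<lambda>t. of_real (\<delta> * \<rho> t) * push r1 r2 (wderiv r1 r2 v) t)"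
    by (intro L2_ip_cong_AE wderiv_push(1) u v wderiv_H1(1)) auto
  also have "\<dots> = of_real \<delta> * L2_ip 0 pi (\<lambda>t. \<delta> * \<rho> t * \<rho> t) (push r1 r2 (wderiv r1 r2 u)) (push r1 r2 (wderiv r1 r2 v))"
    unfolding L2_ip_def
    by (subst Bochner_Integration.integral_mult_right_zero[symmetric], rule Bochner_Integration.integral_cong) (simp_all add: mult_ac)
  also have "\<dots> = of_real \<delta> * L2_ip r1 r2 (\<lambda>r. r) (wderiv r1 r2 u) (wderiv r1 r2 v)"
    by (simp only: L2_ip_push)
  finally show ?thesis .
qed

lemma Q_push: "transport.Q False \<rho> = push r1 r2" by (rule Q_eq_push[OF semi_ip_L2_std])
lemma P_pull: "transport.P False tau = pull r1 r2" by (rule P_eq_pull[OF semi_ip_L2_std])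

lemma isometry_L2: "isometry (L2_std 0 pi) (L2_rinv r1 r2) False tau \<rho> \<delta>"
  by (intro isometry.intro isometry_axioms.intro transport_std semi_ip_L2_std)
     (simp_all add: Q_push delta_pos L2_push L2_ip_recip cnj_if_const)

text \<open>The weights \<open>\<delta> * r\<close> and \<open>1 / (\<delta> * r)\<close> compensate
  the Jacobian and the chain-rule factors exactly, so \<kappa> is 1 here.\<close>

lemma isometry_H1: "isometry (H1_std 0 pi) (H1_r r1 r2) False tau \<rho> 1"
proof (intro isometry.intro isometry_axioms.intro transport_std semi_ip_H1_std pi_gt_zero)
  fix u v assume "u \<in> elems (H1_r r1 r2)" "v \<in> elems (H1_r r1 r2)"
  then have u: "u \<in> H1 r1 r2" "v \<in> H1 r1 r2" by simp_all
  have "L2_ip r1 r2 (\<lambda>r. \<delta> * r) u' v' = of_real \<delta> * L2_ip r1 r2 (\<lambda>r. r) u' v'" for u' v'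
    unfolding L2_ip_def by (subst Bochner_Integration.integral_mult_right_zero[symmetric]) (simp add: mult.assoc)
  moreover have "L2_ip r1 r2 (\<lambda>r. 1 / (\<delta> * r)) u v = of_real (1 / \<delta>) * L2_ip r1 r2 (\<lambda>r. 1 / r) u v"
    unfolding L2_ip_def by (subst Bochner_Integration.integral_mult_right_zero[symmetric]) (simp add: mult.assoc)
  ultimately show "ip (H1_r r1 r2) u v = of_real 1 * cnj_if False (ip (H1_std 0 pi) (transport.Q False \<rho> u) (transport.Q False \<rho> v))"
    using delta_pos by (simp add: Q_push cnj_if_const L2_ip_wderiv_push[OF u] L2_ip_recip)
qed (simp_all add: Q_push H1_push)

lemma norm_transport_L2: "norm_transport (L2_std 0 pi) (L2_std r1 r2) False tau \<rho> (sqrt (\<delta> * r1)) (sqrt (\<delta> * r2))"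
proof (intro norm_transport.intro norm_transport_axioms.intro transport_std semi_ip_L2_std)
  have pos: "0 < \<delta> * r1" "0 < \<delta> * r2" using delta_pos r1_pos r1_less by simp_all
  then show "0 < sqrt (\<delta> * r1)" "0 < sqrt (\<delta> * r2)" by simp_all
  fix v assume "v \<in> elems (L2_std r1 r2)"
  then have v: "push r1 r2 v \<in> L2 0 pi" by (simp add: L2_push)
  have e: "hnorm (L2_std r1 r2) v = sqrt (Re (L2_ip 0 pi (\<lambda>t. \<delta> * \<rho> t * 1) (push r1 r2 v) (push r1 r2 v)))"
    by (simp only: hnorm_def L2_space_simps L2_ip_push)
  have n: "0 \<le> hnorm (L2_std 0 pi) (push r1 r2 v)" using L2s.hnorm_nonneg v by simp
  have b: "\<delta> * r1 * (hnorm (L2_std 0 pi) (push r1 r2 v))\<^sup>2 \<le> Re (L2_ip 0 pi (\<lambda>t. \<delta> * \<rho> t * 1) (push r1 r2 v) (push r1 r2 v))"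
    "Re (L2_ip 0 pi (\<lambda>t. \<delta> * \<rho> t * 1) (push r1 r2 v) (push r1 r2 v)) \<le> \<delta> * r2 * (hnorm (L2_std 0 pi) (push r1 r2 v))\<^sup>2"
  proof -
    have m: "(\<lambda>t. \<delta> * \<rho> t * 1) \<in> borel_measurable borel" by measurable
    have bd: "\<delta> * r1 \<le> \<delta> * \<rho> t * 1" "\<delta> * \<rho> t * 1 \<le> \<delta> * r2" if "0 < t" "t < pi" for t
      using rho_bounds[OF that] delta_pos by simp_all
    show "\<delta> * r1 * (hnorm (L2_std 0 pi) (push r1 r2 v))\<^sup>2 \<le> Re (L2_ip 0 pi (\<lambda>t. \<delta> * \<rho> t * 1) (push r1 r2 v) (push r1 r2 v))"
      by (rule L2_ip_weight_bounds(1)[OF m bd pos(1) v])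
    show "Re (L2_ip 0 pi (\<lambda>t. \<delta> * \<rho> t * 1) (push r1 r2 v) (push r1 r2 v)) \<le> \<delta> * r2 * (hnorm (L2_std 0 pi) (push r1 r2 v))\<^sup>2"
      by (rule L2_ip_weight_bounds(2)[OF m bd pos(1) v])
  qed
  show "sqrt (\<delta> * r1) * hnorm (L2_std 0 pi) (transport.Q False \<rho> v) \<le> hnorm (L2_std r1 r2) v"
    using real_sqrt_le_mono[OF b(1)] n by (simp add: Q_push e real_sqrt_mult)
  show "hnorm (L2_std r1 r2) v \<le> sqrt (\<delta> * r2) * hnorm (L2_std 0 pi) (transport.Q False \<rho> v)"
    using real_sqrt_le_mono[OF b(2)] n by (simp add: Q_push e real_sqrt_mult)
qed (simp add: Q_push L2_push)

text \<open>Without weights, the derivative part acquires \<open>1 / (\<delta> * \<rho> t)\<close>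
  (two chain-rule factors against one Jacobian) and the function part acquires
  \<open>\<delta> * \<rho> t\<close>. The constants come from the extreme values of these two
  weights.\<close>

lemma norm_transport_H1:
  "norm_transport (H1_std 0 pi) (H1_std r1 r2) False tau \<rho>
     (sqrt (min (1 / (\<delta> * r2)) (\<delta> * r1))) (sqrt (max (1 / (\<delta> * r1)) (\<delta> * r2)))"
proof (intro norm_transport.intro norm_transport_axioms.intro transport_std semi_ip_H1_std pi_gt_zero)
  let ?lo = "min (1 / (\<delta> * r2)) (\<delta> * r1)" and ?hi = "max (1 / (\<delta> * r1)) (\<delta> * r2)"
  have pos: "0 < \<delta> * r1" "0 < \<delta> * r2" using delta_pos r1_pos r1_less by simp_all
  then have lo: "0 < ?lo" and hi: "0 < ?hi" by (simp_all add: less_max_iff_disj)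
  then show "0 < sqrt ?lo" "0 < sqrt ?hi" by simp_all
  fix v assume "v \<in> elems (H1_std r1 r2)"
  then have v: "v \<in> H1 r1 r2" by simp
  then have p: "push r1 r2 v \<in> H1 0 pi" by (simp add: H1_push)
  let ?p = "push r1 r2 v" and ?w = "wderiv 0 pi (push r1 r2 v)"
  have w: "?w \<in> L2 0 pi" by (rule wderiv_H1(1)[OF p])
  have p2: "?p \<in> L2 0 pi" by (rule H1_L2[OF p])
  have bd: "\<delta> * r1 \<le> \<delta> * \<rho> t \<and> \<delta> * \<rho> t \<le> \<delta> * r2" if "0 < t" "t < pi" for t
    using rho_bounds[OF that] delta_pos by simp
  have bd': "1 / (\<delta> * r2) \<le> 1 / (\<delta> * \<rho> t) \<and> 1 / (\<delta> * \<rho> t) \<le> 1 / (\<delta> * r1)" if "0 < t" "t < pi" for t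
    by (intro conjI frac_le; use bd[OF that] pos in linarith)
  have e1: "Re (L2_ip r1 r2 (\<lambda>_. 1) v v) = Re (L2_ip 0 pi (\<lambda>t. \<delta> * \<rho> t * 1) ?p ?p)"
    by (simp only: L2_ip_push)
  have e2: "L2_ip r1 r2 (\<lambda>_. 1) (wderiv r1 r2 v) (wderiv r1 r2 v) = L2_ip 0 pi (\<lambda>t. 1 / (\<delta> * \<rho> t)) ?w ?w"
  proof -
    have d: "\<delta> * \<rho> t \<noteq> 0" for t using delta_pos rho_pos[of t] by simp
    have "L2_ip 0 pi (\<lambda>t. 1 / (\<delta> * \<rho> t)) ?w ?w = L2_ip 0 pi (\<lambda>t. 1 / (\<delta> * \<rho> t))
       (\<lambda>t. of_real (\<delta> * \<rho> t) * push r1 r2 (wderiv r1 r2 v) t) (\<lambda>t. of_real (\<delta> * \<rho> t) * push r1 r2 (wderiv r1 r2 v) t)"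
      by (intro L2_ip_cong_AE wderiv_push(1) v w) (auto intro!: borel_measurable_leb)
    also have "\<dots> = L2_ip 0 pi (\<lambda>t. \<delta> * \<rho> t * 1) (push r1 r2 (wderiv r1 r2 v)) (push r1 r2 (wderiv r1 r2 v))"
      unfolding L2_ip_def
    proof (rule Bochner_Integration.integral_cong[OF refl])
      fix t
      let ?x = "push r1 r2 (wderiv r1 r2 v) t" and ?c = "complex_of_real (\<delta> * \<rho> t)"
      have "?c \<noteq> 0" using d[of t] by (simp only: of_real_eq_0_iff not_False_eq_True)
      then have "(1 / ?c) * (?c * ?x) * (?c * cnj ?x) = ?c * ?x * cnj ?x" by simp
      then show "of_real (1 / (\<delta> * \<rho> t)) * (?c * ?x) * cnj (?c * ?x) = of_real (\<delta> * \<rho> t * 1) * ?x * cnj ?x"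
        by (simp only: of_real_divide of_real_1 complex_cnj_mult complex_cnj_complex_of_real mult_1_right)
    qed
    finally show ?thesis by (simp only: L2_ip_push)
  qed
  have e: "(hnorm (H1_std r1 r2) v)\<^sup>2 = Re (L2_ip 0 pi (\<lambda>t. 1 / (\<delta> * \<rho> t)) ?w ?w) + Re (L2_ip 0 pi (\<lambda>t. \<delta> * \<rho> t * 1) ?p ?p)"
    unfolding e1[symmetric] e2[symmetric] by (simp add: hnorm_def L2_ip_self)
  let ?W = "(hnorm (L2_std 0 pi) ?w)\<^sup>2" and ?P = "(hnorm (L2_std 0 pi) ?p)\<^sup>2"
  have b1: "\<delta> * r1 * ?P \<le> Re (L2_ip 0 pi (\<lambda>t. \<delta> * \<rho> t * 1) ?p ?p)"
    "Re (L2_ip 0 pi (\<lambda>t. \<delta> * \<rho> t * 1) ?p ?p) \<le> \<delta> * r2 * ?P"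
  proof -
    have m: "(\<lambda>t. \<delta> * \<rho> t * 1) \<in> borel_measurable borel" by measurable
    have bd1: "\<delta> * r1 \<le> \<delta> * \<rho> t * 1" "\<delta> * \<rho> t * 1 \<le> \<delta> * r2" if "0 < t" "t < pi" for t
      using bd[OF that] by simp_all
    show "\<delta> * r1 * ?P \<le> Re (L2_ip 0 pi (\<lambda>t. \<delta> * \<rho> t * 1) ?p ?p)"
      by (rule L2_ip_weight_bounds(1)[OF m bd1 pos(1) p2])
    show "Re (L2_ip 0 pi (\<lambda>t. \<delta> * \<rho> t * 1) ?p ?p) \<le> \<delta> * r2 * ?P"
      by (rule L2_ip_weight_bounds(2)[OF m bd1 pos(1) p2])
  qed
  have b2: "1 / (\<delta> * r2) * ?W \<le> Re (L2_ip 0 pi (\<lambda>t. 1 / (\<delta> * \<rho> t)) ?w ?w)"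
    "Re (L2_ip 0 pi (\<lambda>t. 1 / (\<delta> * \<rho> t)) ?w ?w) \<le> 1 / (\<delta> * r1) * ?W"
  proof -
    have m: "(\<lambda>t. 1 / (\<delta> * \<rho> t)) \<in> borel_measurable borel" by measurable
    have l: "0 < 1 / (\<delta> * r2)" using pos by simp
    show "1 / (\<delta> * r2) * ?W \<le> Re (L2_ip 0 pi (\<lambda>t. 1 / (\<delta> * \<rho> t)) ?w ?w)"
      by (rule L2_ip_weight_bounds(1)[OF m bd'[THEN conjunct1] bd'[THEN conjunct2] l w])
    show "Re (L2_ip 0 pi (\<lambda>t. 1 / (\<delta> * \<rho> t)) ?w ?w) \<le> 1 / (\<delta> * r1) * ?W"
      by (rule L2_ip_weight_bounds(2)[OF m bd'[THEN conjunct1] bd'[THEN conjunct2] l w])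
  qed
  have W0: "0 \<le> ?W" "0 \<le> ?P" by simp_all
  have m1: "?lo * ?W \<le> 1 / (\<delta> * r2) * ?W" "?lo * ?P \<le> \<delta> * r1 * ?P"
    "1 / (\<delta> * r1) * ?W \<le> ?hi * ?W" "\<delta> * r2 * ?P \<le> ?hi * ?P"
    by (intro mult_right_mono W0 min.cobounded1 min.cobounded2 max.cobounded1 max.cobounded2)+
  have n: "0 \<le> hnorm (H1_std 0 pi) ?p" using semi_ip.hnorm_nonneg[OF semi_ip_H1_std[OF pi_gt_zero]] p by simp
  have n': "0 \<le> hnorm (H1_std r1 r2) v" using semi_ip.hnorm_nonneg[OF semi_ip_H1_std[OF r1_less]] v by simp
  have "?lo * (hnorm (H1_std 0 pi) ?p)\<^sup>2 \<le> (hnorm (H1_std r1 r2) v)\<^sup>2"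
    unfolding hnorm_H1_std_sq[of 0 pi ?p] e distrib_left using b1 b2 m1 by linarith
  from real_sqrt_le_mono[OF this]
  show "sqrt ?lo * hnorm (H1_std 0 pi) (transport.Q False \<rho> v) \<le> hnorm (H1_std r1 r2) v"
    using n n' by (simp only: Q_push real_sqrt_mult real_sqrt_abs abs_of_nonneg)
  have "(hnorm (H1_std r1 r2) v)\<^sup>2 \<le> ?hi * (hnorm (H1_std 0 pi) ?p)\<^sup>2"
    unfolding hnorm_H1_std_sq[of 0 pi ?p] e distrib_left using b1 b2 m1 by linarith
  from real_sqrt_le_mono[OF this]
  show "hnorm (H1_std r1 r2) v \<le> sqrt ?hi * hnorm (H1_std 0 pi) (transport.Q False \<rho> v)"
    using n n' by (simp only: Q_push real_sqrt_mult real_sqrt_abs abs_of_nonneg)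
qed (simp add: Q_push H1_push)

lemma selfadjoint_eigenpair_pull:
  "selfadjoint_eigenpair r1 r2 (1 / \<delta>\<^sup>2 * mu_tilde n) (pull r1 r2 (psi_tilde n))"
proof -
  let ?u = "pull r1 r2 (psi_tilde n)"
  have u: "?u \<in> H1 r1 r2" using H1_push[of ?u] psi_tilde_H1 by simp
  have "L2_ip r1 r2 (\<lambda>r. 1 / r) ?u ?u = of_real \<delta>"
    by (simp add: L2_ip_recip psi_tilde_orthonormal)
  then have n: "hnorm (L2_rinv r1 r2) ?u \<noteq> 0" using delta_pos by (simp add: hnorm_def)
  have "of_real (1 / \<delta>\<^sup>2 * mu_tilde n) * L2_ip r1 r2 (\<lambda>r. 1 / r) ?u \<xi> =
        L2_ip r1 r2 (\<lambda>r. r) (wderiv r1 r2 ?u) (wderiv r1 r2 \<xi>) + of_real (1 / \<delta>\<^sup>2) * L2_ip r1 r2 (\<lambda>r. 1 / r) ?u \<xi>"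
    if x: "\<xi> \<in> H1 r1 r2" for \<xi>
  proof -
    have px: "push r1 r2 \<xi> \<in> H1 0 pi" using x by (simp add: H1_push)
    let ?X = "L2_ip 0 pi (\<lambda>_. 1) (psi_tilde n) (push r1 r2 \<xi>)"
    have d: "complex_of_real \<delta> \<noteq> 0" using delta_pos by simp
    have "of_real \<delta> * L2_ip r1 r2 (\<lambda>r. r) (wderiv r1 r2 ?u) (wderiv r1 r2 \<xi>) = of_real ((real n)\<^sup>2) * ?X"
      using L2_ip_wderiv_push[OF u x] psi_tilde_weak[OF px, of n] by simp
    then have "L2_ip r1 r2 (\<lambda>r. r) (wderiv r1 r2 ?u) (wderiv r1 r2 \<xi>) = of_real ((real n)\<^sup>2) * ?X / of_real \<delta>"
      using d by (simp add: field_simps)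
    then show ?thesis using d
      by (simp add: L2_ip_recip mu_tilde_def power2_eq_square field_simps)
  qed
  then show ?thesis using u n by (simp add: selfadjoint_eigenpair_def)
qed

end

text \<open>The normalized sequence stays close to the same \<open>e\<close>, which thus serves both
  as the witness in \<open>bari_basis\<close> and in the explicit sum.\<close>

lemma bari_basis_normalized:
  assumes "semi_ip H" and R: "riesz_basis H x" and e: "orthonormal_basis H e" and q: "quadratically_close H e x"
  shows "bari_basis H (normalize_seq H x)" "quadratically_close H e (normalize_seq H x)"
proof -
  interpret semi_ip H by fact
  obtain c C where c: "0 < c" "\<And>n. c \<le> hnorm H (x n)" by (rule riesz_basis_norms[OF R]) (rule that)
  have xm: "x n \<in> elems H" for n using R by (simp add: riesz_basis_def)
  have em: "e n \<in> elems H" "hnorm H (e n) = 1" for n using e by (simp_all add: orthonormal_basis_def hnorm_def)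
  have x0: "hnorm H (x n) \<noteq> 0" for n using c(1) c(2)[of n] by linarith
  have rn: "riesz_basis H (normalize_seq H x)" by (rule riesz_basis_normalize[OF R])
  then have nm: "normalize_seq H x n \<in> elems H" for n by (simp add: riesz_basis_def)
  show qn: "quadratically_close H e (normalize_seq H x)"
    by (rule quadratically_close_normalize[OF em xm x0 q])
  show "bari_basis H (normalize_seq H x)"
    unfolding bari_basis_def using rn e quadratically_close_commute[OF em(1) nm qn] by blast
qed

section \<open>Transfer of the whole list of properties to the annulus\<close>

context annulus
begin

text \<open>Stated for any two graphs related by the substitution, because it is applied to
  \<open>T_tilde\<close> with \<open>T_op\<close> and again to their adjoints. Nonvanishing of all
  eigenvalues turns the limits into bounds at every index.\<close>

theorem basis_properties_transport:
  assumes adm: "admissible_pairs A lamt phit"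
    and A_mem: "\<And>u f. (u, f) \<in> A \<Longrightarrow> u \<in> L2 0 pi \<and> f \<in> L2 0 pi"
    and A_cmult: "\<And>u f c. (u, f) \<in> A \<Longrightarrow> (\<lambda>t. c * u t, \<lambda>t. c * f t) \<in> A"
    and B_iff: "\<And>u f. (u, f) \<in> B \<longleftrightarrow> (push r1 r2 u, \<lambda>t. of_real (\<delta>\<^sup>2) * push r1 r2 f t) \<in> A"
    and nz: "\<And>n. lamt n \<noteq> 0"
  shows "basis_properties r1 r2 B (\<lambda>n. of_real (1 / \<delta>\<^sup>2) * lamt n) (\<lambda>n. pull r1 r2 (phit n))
    (\<lambda>n. 1 / \<delta>\<^sup>2 * mu_tilde n) (\<lambda>n. pull r1 r2 (psi_tilde n))"
proof -
  let ?H = "L2_std 0 pi" and ?K = "L2_rinv r1 r2" and ?H1 = "H1_std 0 pi" and ?K1 = "H1_r r1 r2"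
  let ?lam = "\<lambda>n. of_real (1 / \<delta>\<^sup>2) * lamt n" and ?phi = "\<lambda>n. pull r1 r2 (phit n)" and ?psi = "\<lambda>n. pull r1 r2 (psi_tilde n)"
  let ?k = "of_real (1 / \<delta>\<^sup>2) :: complex" and ?x = "\<lambda>n t. phit n t / of_real (sqrt (mu_tilde n))"
  have d: "0 < \<delta>" by (rule delta_pos)
  have a: "normalized_root_pairs ?H A lamt phit" "\<exists>n0. \<forall>n>n0. simple_eigenvalue ?H A (lamt n)"
    "bari_basis ?H phit" "quadratically_close ?H psi_tilde phit" "bari_basis ?H1 ?x"
    "quadratically_close ?H1 (\<lambda>n t. psi_tilde n t / of_real (sqrt (mu_tilde n))) ?x"
    "(\<lambda>n. sqrt (cmod (lamt n)) / sqrt (mu_tilde n)) \<longlonglongrightarrow> 1" "(\<lambda>n. lamt n / of_real (mu_tilde n)) \<longlonglongrightarrow> 1"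
    using adm unfolding admissible_pairs_def by blast+
  interpret L: isometry ?H ?K False tau \<rho> \<delta> by (rule isometry_L2)
  interpret I: isometry ?H1 ?K1 False tau \<rho> 1 by (rule isometry_H1)
  interpret N: norm_transport ?H "L2_std r1 r2" False tau \<rho> "sqrt (\<delta> * r1)" "sqrt (\<delta> * r2)" by (rule norm_transport_L2)
  interpret M: norm_transport ?H1 "H1_std r1 r2" False tau \<rho>
    "sqrt (min (1 / (\<delta> * r2)) (\<delta> * r1))" "sqrt (max (1 / (\<delta> * r1)) (\<delta> * r2))" by (rule norm_transport_H1)
  interpret O: op_transport ?H ?K False tau \<rho> \<delta> A B "\<delta>\<^sup>2"
    by unfold_locales
       (use d A_mem A_cmult B_iff in \<open>auto simp: Q_push L2_ip_recip cnj_if_const\<close>)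
  have zs: "O.zs z = ?k * z" for z by (simp add: O.zs_def cnj_if_const)
  have R: "root_pairs_factor 1 ?H A lamt phit" using a(1) by (simp add: normalized_root_pairs_def)
  have RB: "root_pairs_factor ?k ?K B ?lam ?phi"
    using O.root_pairs_transport[OF R] unfolding zs P_pull by simp
  have RS: "\<exists>s::nat \<Rightarrow> real. (\<forall>n. 0 < s n) \<and> (\<forall>n. eigenvector ?K B (?lam n) (?phi n) \<longrightarrow> s n = 1) \<and>
      root_pairs ?K B ?lam (\<lambda>n r. of_real (s n) * ?phi n r)"
  proof -
    have sub: "(\<lambda>t. c * u t) \<in> root_space ?K B z" if "u \<in> root_space ?K B z" for u c z
    proof -
      have "L.Q (\<lambda>t. c * u t) = (\<lambda>t. c * L.Q u t)" by (simp add: L.Q_def cnj_if_const)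
      then show ?thesis
        using L2s.root_space_cmult[OF A_cmult that[unfolded O.root_space_transport], of c] by (simp add: O.root_space_transport)
    qed
    have k: "0 < 1 / \<delta>\<^sup>2" using d by simp
    obtain s :: "nat \<Rightarrow> real" where "\<And>n. 0 < s n" "\<And>n. eigenvector ?K B (?lam n) (?phi n) \<Longrightarrow> s n = 1"
        "root_pairs ?K B ?lam (\<lambda>n r. of_real (s n) * ?phi n r)"
      by (rule root_pairs_rescale[OF RB k O.B_cmult sub]) (assumption+, rule that)
    then show ?thesis by (intro exI[of _ s] conjI allI impI)
  qed
  have psi2: "psi_tilde n \<in> elems ?H" "psi_tilde n \<in> elems ?H1" for n by (simp_all add: psi_tilde_L2 psi_tilde_H1)
  have phi2: "phit n \<in> elems ?H" for n using a(3) by (simp add: bari_basis_def riesz_basis_def)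
  have x1: "?x n \<in> elems ?H1" for n using a(5) by (simp add: bari_basis_def riesz_basis_def)
  have sm: "0 < sqrt (mu_tilde n)" for n using mu_tilde_pos by simp
  have phix: "phit n = (\<lambda>t. of_real (sqrt (mu_tilde n)) * ?x n t)" for n using sm[of n] by (simp add: less_imp_neq[symmetric])
  have phi1: "phit n \<in> elems ?H1" for n using H1p.cmult_mem[OF x1, of "of_real (sqrt (mu_tilde n))" n] phix[of n] by simp
  have nphi: "hnorm ?H1 (phit n) = sqrt (mu_tilde n) * hnorm ?H1 (?x n)" for n
    using H1p.hnorm_cmult[OF x1, of "of_real (sqrt (mu_tilde n))" n] phix[of n] sm[of n] by simp
  have nL: "normalize_seq ?K (\<lambda>n. pull r1 r2 (y n)) = (\<lambda>n. L.S (normalize_seq ?H y n))" if "\<And>n. y n \<in> elems ?H" for y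
    using L.normalize_seq_transport[of y, OF that] unfolding P_pull by (rule ext)
  have nI: "normalize_seq ?K1 (\<lambda>n. pull r1 r2 (y n)) = (\<lambda>n. I.S (normalize_seq ?H1 y n))" if "\<And>n. y n \<in> elems ?H1" for y
    using I.normalize_seq_transport[of y, OF that] unfolding P_pull by (rule ext)
  have npsi: "normalize_seq ?H psi_tilde = psi_tilde"
    by (simp add: normalize_seq_def[abs_def] hnorm_psi_tilde_L2)
  have npsi1: "normalize_seq ?H1 psi_tilde = (\<lambda>n t. psi_tilde n t / of_real (sqrt (mu_tilde n)))"
    by (simp add: normalize_seq_def[abs_def] hnorm_psi_tilde_H1)
  \<comment> \<open>The positive factor \<open>1 / sqrt (mu_tilde n)\<close> cancels under
    normalization.\<close>
  have nx: "normalize_seq ?H1 ?x = normalize_seq ?H1 phit"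
  proof (intro ext)
    fix n t
    have "phit n t / of_real (sqrt (mu_tilde n)) / of_real (hnorm ?H1 (?x n)) = phit n t / of_real (sqrt (mu_tilde n) * hnorm ?H1 (?x n))"
      by simp
    then show "normalize_seq ?H1 ?x n t = normalize_seq ?H1 phit n t"
      unfolding normalize_seq_def nphi .
  qed
  have rx: "riesz_basis ?H phit" "riesz_basis ?H1 ?x" using a(3,5) by (simp_all add: bari_basis_def)
  note bL = bari_basis_normalized[OF semi_ip_L2_std rx(1) psi_tilde_orthonormal_basis a(4)]
  note bH = bari_basis_normalized[OF semi_ip_H1_std[OF pi_gt_zero] rx(2) psi_tilde_orthonormal_basis_H1[unfolded npsi1] a(6), unfolded nx]
  have nm: "normalize_seq ?H phit n \<in> elems ?H" "normalize_seq ?H1 phit n \<in> elems ?H1"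
    "normalize_seq ?H1 psi_tilde n \<in> elems ?H1" for n
    using bL(1) bH(1) psi_tilde_orthonormal_basis_H1 by (simp_all add: bari_basis_def riesz_basis_def orthonormal_basis_def)

  have ob: "orthonormal_basis ?K (normalize_seq ?K ?psi)"
    unfolding nL[OF psi2(1)] npsi by (rule L.orthonormal_basis_S[OF psi_tilde_orthonormal_basis])
  have og: "orthogonal_basis ?K1 (normalize_seq ?K ?psi)"
  proof -
    \<comment> \<open>Normalizing in \<open>L2_rinv\<close> divides by \<open>sqrt \<delta>\<close>,
      while the transport of \<open>H1\<close> has no such factor; it is supplied before
      transporting.\<close>
    let ?c = "complex_of_real (1 / sqrt \<delta>)"
    have "?c \<noteq> 0" using d by simp
    from I.orthogonal_basis_S[OF H1p.orthogonal_basis_cmult[OF psi_tilde_orthogonal_basis_H1 this]]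
    have "orthogonal_basis ?K1 (\<lambda>n. I.S (\<lambda>t. ?c * psi_tilde n t))" .
    moreover have "I.S (\<lambda>t. ?c * psi_tilde n t) = L.S (psi_tilde n)" for n
      by (simp add: I.S_def L.S_def I.P_def cnj_if_const)
    ultimately show ?thesis unfolding nL[OF psi2(1)] npsi by simp
  qed
  have simple: "\<exists>n0>0. \<forall>n>n0. simple_eigenvalue ?K B (?lam n)"
  proof -
    obtain n0 where n0: "\<And>n. n > n0 \<Longrightarrow> simple_eigenvalue ?H A (lamt n)" using a(2) by blast
    have "simple_eigenvalue ?K B (O.zs (lamt n))" if "n > n0" for n
      by (rule O.simple_eigenvalue_transport) (simp only: O.sz_zs n0[OF that])
    \<comment> \<open>The successor makes the threshold positive.\<close>
    then show ?thesis unfolding zs by (intro exI[of _ "Suc n0"]) auto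
  qed
  have bari: "bari_basis ?K (normalize_seq ?K ?phi)" "quadratically_close ?K (normalize_seq ?K ?psi) (normalize_seq ?K ?phi)"
    unfolding nL[OF psi2(1)] nL[OF phi2] npsi
    by (rule L.bari_basis_S[OF bL(1)], rule L.quadratically_close_S[OF psi2(1) nm(1) bL(2)])
  have bari1: "bari_basis ?K1 (normalize_seq ?K1 ?phi)" "quadratically_close ?K1 (normalize_seq ?K1 ?psi) (normalize_seq ?K1 ?phi)"
    unfolding nI[OF psi2(2)] nI[OF phi1]
    by (rule I.bari_basis_S[OF bH(1)], rule I.quadratically_close_S[OF nm(3,2) bH(2)[folded npsi1]])

  obtain c1 C1 where c1: "0 < c1" "0 < C1" "\<And>n. c1 \<le> hnorm ?H (phit n)" "\<And>n. hnorm ?H (phit n) \<le> C1"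
    by (rule L2s.riesz_basis_norms[OF rx(1)]) (rule that)
  obtain c2 C2 where c2: "0 < c2" "0 < C2" "\<And>n. c2 \<le> hnorm ?H1 (?x n)" "\<And>n. hnorm ?H1 (?x n) \<le> C2"
    by (rule H1p.riesz_basis_norms[OF rx(2)]) (rule that)
  have mphi: "?phi n \<in> elems (L2_std r1 r2)" "?phi n \<in> elems (H1_std r1 r2)" for n
    using phi2[of n] phi1[of n] N.elems_iff[of "?phi n"] M.elems_iff[of "?phi n"] by (simp_all add: Q_push)
  have aN: "asymp_equiv_seq (\<lambda>n. hnorm (L2_std r1 r2) (?phi n)) (\<lambda>n. hnorm ?H (phit n))"
    by (rule asymp_equiv_seqI[OF N.c_pos N.C_pos])
       (use N.norm_lower[OF mphi(1)] N.norm_upper[OF mphi(1)] in \<open>simp_all add: Q_push\<close>)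
  have aM: "asymp_equiv_seq (\<lambda>n. hnorm (H1_std r1 r2) (?phi n)) (\<lambda>n. hnorm ?H1 (phit n))"
    by (rule asymp_equiv_seqI[OF M.c_pos M.C_pos])
       (use M.norm_lower[OF mphi(2)] M.norm_upper[OF mphi(2)] in \<open>simp_all add: Q_push\<close>)
  have b1: "asymp_equiv_seq (\<lambda>n. hnorm ?H (phit n)) (\<lambda>n. 1)"
    by (rule asymp_equiv_seqI[OF c1(1,2)]) (use c1 in simp_all)
  have b2: "asymp_equiv_seq (\<lambda>n. hnorm ?H1 (phit n)) (\<lambda>n. sqrt (mu_tilde n))"
  proof (rule asymp_equiv_seqI[OF c2(1,2)])
    fix n
    show "c2 * sqrt (mu_tilde n) \<le> hnorm ?H1 (phit n)" "hnorm ?H1 (phit n) \<le> C2 * sqrt (mu_tilde n)"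
      unfolding nphi using mult_left_mono[OF c2(3)[of n] less_imp_le[OF sm[of n]]] mult_left_mono[OF c2(4)[of n] less_imp_le[OF sm[of n]]]
      by (simp_all add: mult.commute)
  qed
  have L1: "asymp_equiv_seq (\<lambda>n. hnorm (L2_std r1 r2) (?phi n)) (\<lambda>n. 1)" by (rule asymp_trans[OF aN b1])
  have M1: "asymp_equiv_seq (\<lambda>n. hnorm (H1_std r1 r2) (?phi n)) (\<lambda>n. sqrt (mu_tilde n))" by (rule asymp_trans[OF aM b2])
  have lt: "asymp_equiv_seq (\<lambda>n. sqrt (cmod (lamt n))) (\<lambda>n. sqrt (mu_tilde n))"
    by (rule asymp_if_ratio_tendsto_1[OF a(7)]) (use nz sm in auto)
  have sl: "sqrt (cmod (?lam n)) = 1 / \<delta> * sqrt (cmod (lamt n))" for n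
  proof -
    have "cmod (?lam n) = (1 / \<delta>)\<^sup>2 * cmod (lamt n)"
      by (simp add: norm_mult norm_divide norm_power power_divide)
    then show ?thesis using d by (simp add: real_sqrt_mult real_sqrt_divide)
  qed
  have l1: "asymp_equiv_seq (\<lambda>n. sqrt (cmod (?lam n))) (\<lambda>n. sqrt (mu_tilde n))"
    unfolding sl by (rule asymp_trans[OF asymp_cmult lt]) (use d in simp_all)
  \<comment> \<open>With indices from 0 the bounds read
    \<open>((n + 1) / 2)^2 \<le> n^2 + 1 \<le> (n + 1)^2\<close>; the left one follows from
    \<open>(n - 1)^2\<close> and \<open>n^2\<close> being nonnegative.\<close>
  have mn: "asymp_equiv_seq (\<lambda>n. sqrt (mu_tilde n)) (\<lambda>n. real (Suc n))"
  proof (rule asymp_equiv_seqI[of "1 / 2" 1])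
    fix n
    show "1 / 2 * real (Suc n) \<le> sqrt (mu_tilde n)"
    proof (rule real_le_rsqrt)
      have "0 \<le> (real n - 1)\<^sup>2" "0 \<le> (real n)\<^sup>2" by simp_all
      then show "(1 / 2 * real (Suc n))\<^sup>2 \<le> mu_tilde n" by (simp add: mu_tilde_def power2_eq_square algebra_simps)
    qed
    show "sqrt (mu_tilde n) \<le> 1 * real (Suc n)"
      by (rule real_le_lsqrt) (simp_all add: mu_tilde_def power2_eq_square algebra_simps)
  qed simp_all
  have lam_n: "asymp_equiv_seq (\<lambda>n. sqrt (cmod (?lam n))) (\<lambda>n. real (Suc n))" by (rule asymp_trans[OF l1 mn])
  \<comment> \<open>The \<open>L2\<close> norms are bounded above and below, so both sides are
    comparable to \<open>sqrt (mu_tilde n)\<close>.\<close>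
  have hh: "asymp_equiv_seq (\<lambda>n. hnorm (H1_std r1 r2) (?phi n)) (\<lambda>n. sqrt (cmod (?lam n)) * hnorm (L2_std r1 r2) (?phi n))"
  proof -
    have "asymp_equiv_seq (\<lambda>n. sqrt (cmod (?lam n)) * hnorm (L2_std r1 r2) (?phi n)) (\<lambda>n. sqrt (cmod (?lam n)) * 1)"
      by (rule asymp_mult[OF L1]) simp
    then have "asymp_equiv_seq (\<lambda>n. sqrt (cmod (?lam n)) * hnorm (L2_std r1 r2) (?phi n)) (\<lambda>n. sqrt (cmod (?lam n)))" by simp
    from asymp_trans[OF asymp_trans[OF M1 asymp_sym[OF l1]] asymp_sym[OF this]] show ?thesis .
  qed
  have inf: "0 < (INF n. cmod (?lam n))"
  proof -
    obtain c C where c: "0 < c" "\<And>n. c * real (Suc n) \<le> sqrt (cmod (?lam n))"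
      by (rule asymp_equiv_seqE[OF lam_n]) (rule that)
    have "c\<^sup>2 \<le> cmod (?lam n)" for n
    proof -
      have "c * 1 \<le> c * real (Suc n)" using c(1) by (intro mult_left_mono) auto
      then have "c \<le> sqrt (cmod (?lam n))" using c(2)[of n] by linarith
      then have "c\<^sup>2 \<le> (sqrt (cmod (?lam n)))\<^sup>2" using c(1) by (intro power_mono) auto
      then show ?thesis by simp
    qed
    then have "c\<^sup>2 \<le> (INF n. cmod (?lam n))" by (intro cINF_greatest) auto
    then show ?thesis using c(1) by (meson less_le_trans zero_less_power)
  qed
  have rL: "riesz_basis (L2_std r1 r2) (normalize_seq (L2_std r1 r2) ?phi)"
  proof -
    obtain c C where c: "0 < c" "0 < C" "\<And>n. c * 1 \<le> hnorm (L2_std r1 r2) (?phi n)" "\<And>n. hnorm (L2_std r1 r2) (?phi n) \<le> C * 1"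
      by (rule asymp_equiv_seqE[OF L1]) (rule that)
    have p: "0 < hnorm (L2_std r1 r2) (?phi n)" for n using c(1) c(3)[of n] by linarith
    have "riesz_basis (L2_std r1 r2) (\<lambda>n r. 1 / of_real (hnorm (L2_std r1 r2) (?phi n)) * L.P (phit n) r)"
    proof (rule N.riesz_basis_transport[OF rx(1), of "1 / C" _ "1 / c"])
      fix n
      show "1 / C \<le> cmod (1 / of_real (hnorm (L2_std r1 r2) (?phi n)))" "cmod (1 / of_real (hnorm (L2_std r1 r2) (?phi n))) \<le> 1 / c"
        using c p[of n] by (simp_all add: norm_divide frac_le)
    qed (use c in simp)
    then show ?thesis by (simp add: normalize_seq_def[abs_def] P_pull)
  qed
  have rH: "riesz_basis (H1_std r1 r2) (normalize_seq (H1_std r1 r2) ?phi)"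
  proof -
    obtain c C where c: "0 < c" "0 < C" "\<And>n. c * sqrt (mu_tilde n) \<le> hnorm (H1_std r1 r2) (?phi n)"
        "\<And>n. hnorm (H1_std r1 r2) (?phi n) \<le> C * sqrt (mu_tilde n)"
      by (rule asymp_equiv_seqE[OF M1]) (rule that)
    have p: "0 < hnorm (H1_std r1 r2) (?phi n)" for n using c(1) c(3)[of n] sm[of n] by (meson less_le_trans mult_pos_pos)
    \<comment> \<open>\<open>?x n\<close> already contains the factor
      \<open>1 / sqrt (mu_tilde n)\<close>; this multiplier replaces it by the norm on the annulus,
      and \<open>M1\<close> bounds it from both sides.\<close>
    let ?\<alpha> = "\<lambda>n. sqrt (mu_tilde n) / hnorm (H1_std r1 r2) (?phi n)"
    have "riesz_basis (H1_std r1 r2) (\<lambda>n r. of_real (?\<alpha> n) * I.P (?x n) r)"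
    proof (rule M.riesz_basis_transport[OF rx(2), of "1 / C" _ "1 / c"])
      fix n
      have "cmod (of_real (?\<alpha> n)) = ?\<alpha> n" unfolding norm_of_real using p[of n] sm[of n] by simp
      moreover have "1 / C \<le> ?\<alpha> n" "?\<alpha> n \<le> 1 / c"
        using c(1,2) c(3,4)[of n] p[of n] by (simp_all add: field_simps)
      ultimately show "1 / C \<le> cmod (of_real (?\<alpha> n))" "cmod (of_real (?\<alpha> n)) \<le> 1 / c" by simp_all
    qed (use c in simp)
    moreover have "(\<lambda>r. of_real (?\<alpha> n) * I.P (?x n) r) = normalize_seq (H1_std r1 r2) ?phi n" for n
      using sm[of n] by (simp add: normalize_seq_def P_pull pull_def fun_eq_iff)
    ultimately show ?thesis by simp
  qed
  have lim: "(\<lambda>n. ?lam n / of_real (1 / \<delta>\<^sup>2 * mu_tilde n)) \<longlonglongrightarrow> 1"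
  proof -
    have "?lam n / of_real (1 / \<delta>\<^sup>2 * mu_tilde n) = lamt n / of_real (mu_tilde n)" for n
      using d by simp
    then show ?thesis using a(8) by (simp only:)
  qed
  have psi_real: "\<forall>n. \<forall>r\<in>{r1<..<r2}. ?psi n r \<in> \<real>" by (simp add: pull_def psi_tilde_cos)
  show ?thesis
    unfolding basis_properties_def
    by (intro conjI RB RS allI selfadjoint_eigenpair_pull psi_real ob og simple bari bari1 lam_n hh inf rL rH lim)
qed

end

section \<open>Complex conjugation\<close>

lemma transport_id: "semi_ip H \<Longrightarrow> transport H (\<lambda>r. r) (\<lambda>r. r)"
  by (simp add: transport_def transport_axioms_def)

lemma Q_cnj: "transport.Q True (\<lambda>r. r) v = (\<lambda>t. cnj (v t))"
  by (simp add: transport.Q_def[OF transport_id[OF semi_ip_L2_std]] cnj_if_const)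

lemma P_cnj: "transport.P True (\<lambda>r. r) v = (\<lambda>t. cnj (v t))"
  by (simp add: transport.P_def[OF transport_id[OF semi_ip_L2_std]] cnj_if_const)

lemma isometry_cnj_L2: "isometry (L2_std 0 pi) (L2_std 0 pi) True (\<lambda>r. r) (\<lambda>r. r) 1"
proof (intro isometry.intro isometry_axioms.intro transport_id semi_ip_L2_std)
  show "v \<in> elems (L2_std 0 pi) \<longleftrightarrow> transport.Q True (\<lambda>r. r) v \<in> elems (L2_std 0 pi)" for v
    unfolding Q_cnj using L2_cnj[of v 0 pi] L2_cnj[of "\<lambda>t. cnj (v t)" 0 pi] by auto
qed (simp_all add: Q_cnj cnj_if_const L2_ip_cnj)

lemma isometry_cnj_H1: "isometry (H1_std 0 pi) (H1_std 0 pi) True (\<lambda>r. r) (\<lambda>r. r) 1"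
proof (intro isometry.intro isometry_axioms.intro transport_id semi_ip_H1_std pi_gt_zero)
  show "v \<in> elems (H1_std 0 pi) \<longleftrightarrow> transport.Q True (\<lambda>r. r) v \<in> elems (H1_std 0 pi)" for v
    unfolding Q_cnj using H1_cnj(1)[of v 0 pi] H1_cnj(1)[of "\<lambda>t. cnj (v t)" 0 pi] by auto
  fix v w assume "v \<in> elems (H1_std 0 pi)" "w \<in> elems (H1_std 0 pi)"
  then have vw: "v \<in> H1 0 pi" "w \<in> H1 0 pi" by simp_all
  have "L2_ip 0 pi (\<lambda>_. 1) (wderiv 0 pi (\<lambda>t. cnj (v t))) (wderiv 0 pi (\<lambda>t. cnj (w t)))
      = L2_ip 0 pi (\<lambda>_. 1) (\<lambda>t. cnj (wderiv 0 pi v t)) (\<lambda>t. cnj (wderiv 0 pi w t))"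
    by (rule L2_ip_cong_AE) (use H1_cnj[OF vw(1) pi_gt_zero] H1_cnj[OF vw(2) pi_gt_zero] wderiv_H1(1) in auto)
  then show "ip (H1_std 0 pi) v w = of_real 1 * cnj_if True (ip (H1_std 0 pi) (transport.Q True (\<lambda>r. r) v) (transport.Q True (\<lambda>r. r) w))"
    by (simp add: Q_cnj cnj_if_const L2_ip_cnj)
qed simp_all

text \<open>Conjugation is an isometry of both spaces and fixes the real functions
  \<open>psi_tilde n\<close>, so every requirement passes to the conjugated pairs.\<close>

theorem admissible_pairs_cnj:
  assumes adm: "admissible_pairs A lam phi"
    and A_mem: "\<And>u f. (u, f) \<in> A \<Longrightarrow> u \<in> L2 0 pi \<and> f \<in> L2 0 pi"
    and A_cmult: "\<And>u f c. (u, f) \<in> A \<Longrightarrow> (\<lambda>t. c * u t, \<lambda>t. c * f t) \<in> A"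
    and B_iff: "\<And>u f. (u, f) \<in> B \<longleftrightarrow> (\<lambda>t. cnj (u t), \<lambda>t. cnj (f t)) \<in> A"
  shows "admissible_pairs B (\<lambda>n. cnj (lam n)) (\<lambda>n t. cnj (phi n t))"
proof -
  let ?H = "L2_std 0 pi" and ?H1 = "H1_std 0 pi"
  let ?x = "\<lambda>n t. phi n t / of_real (sqrt (mu_tilde n))" and ?p = "\<lambda>n t. psi_tilde n t / of_real (sqrt (mu_tilde n))"
  have a: "normalized_root_pairs ?H A lam phi" "\<exists>n0. \<forall>n>n0. simple_eigenvalue ?H A (lam n)"
    "bari_basis ?H phi" "quadratically_close ?H psi_tilde phi" "bari_basis ?H1 ?x"
    "quadratically_close ?H1 ?p ?x"
    "(\<lambda>n. sqrt (cmod (lam n)) / sqrt (mu_tilde n)) \<longlonglongrightarrow> 1"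
    "(\<lambda>n. sqrt (cmod (lam n)) / hnorm ?H1 (phi n)) \<longlonglongrightarrow> 1"
    "quadratically_close ?H1 (normalize_seq ?H1 phi) ?p"
    "(\<lambda>n. lam n / of_real (mu_tilde n)) \<longlonglongrightarrow> 1"
    using adm unfolding admissible_pairs_def by blast+
  interpret L: isometry ?H ?H True "\<lambda>r. r" "\<lambda>r. r" 1 by (rule isometry_cnj_L2)
  interpret I: isometry ?H1 ?H1 True "\<lambda>r. r" "\<lambda>r. r" 1 by (rule isometry_cnj_H1)
  interpret O: op_transport ?H ?H True "\<lambda>r. r" "\<lambda>r. r" 1 A B 1
    by unfold_locales (use A_mem A_cmult B_iff in \<open>auto simp: Q_cnj L2_ip_cnj cnj_if_const\<close>)
  have zs: "O.zs z = cnj z" for z by (simp add: O.zs_def cnj_if_const)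
  have SL: "L.S u = (\<lambda>t. cnj (u t))" for u by (simp add: L.S_def P_cnj)
  have SI: "I.S u = (\<lambda>t. cnj (u t))" for u by (simp add: I.S_def P_cnj)
  have psi: "(\<lambda>t. cnj (psi_tilde n t)) = psi_tilde n" for n by (simp add: psi_tilde_cos fun_eq_iff)
  have psip: "(\<lambda>t. cnj (?p n t)) = ?p n" for n by (simp add: psi_tilde_cos fun_eq_iff)
  have phi2: "phi n \<in> elems ?H" for n using a(3) by (simp add: bari_basis_def riesz_basis_def)
  have x1: "?x n \<in> elems ?H1" for n using a(5) by (simp add: bari_basis_def riesz_basis_def)
  have sm: "sqrt (mu_tilde n) \<noteq> 0" for n using mu_tilde_pos[of n] by simp
  have phi1: "phi n \<in> elems ?H1" for n
    using H1p.cmult_mem[OF x1, of "of_real (sqrt (mu_tilde n))" n] sm[of n] by simp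
  have p1: "?p n \<in> elems ?H1" for n
    using H1p.cmult_mem[of "psi_tilde n" "1 / of_real (sqrt (mu_tilde n))"] psi_tilde_H1 by simp
  have nm: "normalize_seq ?H1 phi n \<in> elems ?H1" for n
    using H1p.cmult_mem[OF phi1, of "1 / of_real (hnorm ?H1 (phi n))"] by (simp add: normalize_seq_def)
  have R: "root_pairs_factor 1 ?H A lam phi" using a(1) by (simp add: normalized_root_pairs_def)
  have RB: "root_pairs ?H B (\<lambda>n. cnj (lam n)) (\<lambda>n t. cnj (phi n t))"
    using O.root_pairs_transport[OF R] unfolding zs P_cnj by simp
  have N: "normalized_root_pairs ?H B (\<lambda>n. cnj (lam n)) (\<lambda>n t. cnj (phi n t))"
    unfolding normalized_root_pairs_def
  proof (intro conjI RB allI impI)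
    fix n assume "eigenvector ?H B (cnj (lam n)) (\<lambda>t. cnj (phi n t))"
    then have "eigenvector ?H A (lam n) (phi n)" by (simp add: O.eigenvector_transport Q_cnj cnj_if_const)
    then have "hnorm ?H (phi n) = 1" using a(1) by (simp add: normalized_root_pairs_def)
    then show "hnorm ?H (\<lambda>t. cnj (phi n t)) = 1" using L.hnorm_S[OF phi2, of n] by (simp add: SL)
  qed
  have S: "\<exists>n0. \<forall>n>n0. simple_eigenvalue ?H B (cnj (lam n))"
  proof -
    obtain n0 where n0: "\<And>n. n > n0 \<Longrightarrow> simple_eigenvalue ?H A (lam n)" using a(2) by blast
    have "simple_eigenvalue ?H B (O.zs (lam n))" if "n > n0" for n
      by (rule O.simple_eigenvalue_transport) (simp only: O.sz_zs n0[OF that])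
    then show ?thesis unfolding zs by blast
  qed
  have b: "bari_basis ?H (\<lambda>n t. cnj (phi n t))" using L.bari_basis_S[OF a(3)] unfolding SL .
  have q: "quadratically_close ?H psi_tilde (\<lambda>n t. cnj (phi n t))"
    using L.quadratically_close_S[of psi_tilde phi] psi_tilde_L2 phi2 a(4) unfolding SL psi by simp
  have xc: "(\<lambda>t. cnj (?x n t)) = (\<lambda>t. cnj (phi n t) / of_real (sqrt (mu_tilde n)))" for n by simp
  have b1: "bari_basis ?H1 (\<lambda>n t. cnj (phi n t) / of_real (sqrt (mu_tilde n)))"
    using I.bari_basis_S[OF a(5)] unfolding SI xc .
  have q1: "quadratically_close ?H1 ?p (\<lambda>n t. cnj (phi n t) / of_real (sqrt (mu_tilde n)))"
    using I.quadratically_close_S[OF p1 x1 a(6)] unfolding SI xc psip .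
  have n1: "hnorm ?H1 (\<lambda>t. cnj (phi n t)) = hnorm ?H1 (phi n)" for n using I.hnorm_S[OF phi1, of n] by (simp add: SI)
  have "normalize_seq ?H1 (\<lambda>n t. cnj (phi n t)) = (\<lambda>n t. cnj (normalize_seq ?H1 phi n t))"
    by (intro ext) (simp add: normalize_seq_def n1)
  then have q2: "quadratically_close ?H1 (normalize_seq ?H1 (\<lambda>n t. cnj (phi n t))) ?p"
    using I.quadratically_close_S[OF nm p1 a(9)] unfolding SI psip by simp
  have l: "(\<lambda>n. cnj (lam n) / of_real (mu_tilde n)) \<longlonglongrightarrow> 1"
    using tendsto_cnj[OF a(10)] by simp
  show ?thesis
    unfolding admissible_pairs_def n1 complex_mod_cnj
    by (intro conjI N S b q b1 q1 q2 l a(7) a(8))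
qed

text \<open>The adjoint part covers every admissible choice of pairs; the existence claim in the
  middle ensures that this part is not vacuous.\<close>

theorem corollary3p4:
  fixes r1 r2 \<omega> \<sigma> :: real and nn :: "real \<Rightarrow> real"
    and lamt :: "nat \<Rightarrow> complex" and phit :: "nat \<Rightarrow> real \<Rightarrow> complex"
  assumes "0 < r1" and "r1 < r2" and "0 < \<omega>" and "0 < \<sigma>"
    and "nn \<in> Linfty r1 r2"
    and "admissible_pairs (T_tilde r1 r2 \<omega> \<sigma> nn) lamt phit"
  shows "basis_properties r1 r2 (T_op r1 r2 \<omega> \<sigma> nn)
           (\<lambda>n. of_real (1 / (delta r1 r2)\<^sup>2) * lamt n) (\<lambda>n. pull r1 r2 (phit n))
           (\<lambda>n. 1 / (delta r1 r2)\<^sup>2 * mu_tilde n) (\<lambda>n. pull r1 r2 (psi_tilde n)) \<and>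
         (\<exists>nut chit. admissible_pairs (adjoint_op (L2_std 0 pi) (T_tilde r1 r2 \<omega> \<sigma> nn)) nut chit) \<and>
         (\<forall>nut chit. admissible_pairs (adjoint_op (L2_std 0 pi) (T_tilde r1 r2 \<omega> \<sigma> nn)) nut chit \<longrightarrow>
           basis_properties r1 r2 (adjoint_op (L2_rinv r1 r2) (T_op r1 r2 \<omega> \<sigma> nn))
             (\<lambda>n. of_real (1 / (delta r1 r2)\<^sup>2) * nut n) (\<lambda>n. pull r1 r2 (chit n))
             (\<lambda>n. 1 / (delta r1 r2)\<^sup>2 * mu_tilde n) (\<lambda>n. pull r1 r2 (psi_tilde n)))"
proof -
  interpret sturm r1 r2 \<omega> \<sigma> nn by unfold_locales fact+
  let ?H = "L2_std 0 pi" and ?K = "L2_rinv r1 r2"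
  let ?A = "adjoint_op ?H Tt" and ?B = "adjoint_op ?K Tr"
  \<comment> \<open>Each \<open>lam n\<close> is a spectral value and each spectral value has an
    eigenvector, so a trivial kernel excludes zero.\<close>
  have no_zero: "lam n \<noteq> 0" if adm: "admissible_pairs A lam phi"
    and ker: "\<And>u. (u, \<lambda>t. 0 * u t) \<in> A \<Longrightarrow> hnorm ?H u = 0" for A lam phi n
  proof
    assume "lam n = 0"
    have R: "root_pairs ?H A lam phi" using adm by (simp add: admissible_pairs_def normalized_root_pairs_def)
    then have "lam n \<in> spectrum ?H A" by (auto simp: root_pairs_factor_def)
    then obtain u where "eigenvector ?H A (lam n) u" using R unfolding root_pairs_factor_def by blast
    then show False using ker[of u] \<open>lam n = 0\<close> by (simp add: eigenvector_def)
  qed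
  have kT: "hnorm ?H u = 0" if "(u, \<lambda>t. 0 * u t) \<in> Tt" for u
    by (rule Tt_kernel[OF that]) simp
  have 1: "basis_properties r1 r2 Tr (\<lambda>n. of_real (1 / \<delta>\<^sup>2) * lamt n) (\<lambda>n. pull r1 r2 (phit n))
      (\<lambda>n. 1 / \<delta>\<^sup>2 * mu_tilde n) (\<lambda>n. pull r1 r2 (psi_tilde n))"
    by (rule basis_properties_transport[OF assms(6) Tt_mem Tt_cmult T_op_iff no_zero[OF assms(6) kT]])
  \<comment> \<open>A countable set is not the whole plane, which yields the resolvent point for
    \<open>adjoint_T_tilde\<close>.\<close>
  have "countable (spectrum ?H Tt)"
    using assms(6) by (simp add: admissible_pairs_def normalized_root_pairs_def root_pairs_factor_def)
  then have "spectrum ?H Tt \<noteq> UNIV" using uncountable_UNIV_complex by auto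
  then obtain z where z: "z \<in> resolvent_set ?H Tt" by (auto simp: spectrum_def)
  note adj = adjoint_T_tilde[OF z]
  have 2: "admissible_pairs ?A (\<lambda>n. cnj (lamt n)) (\<lambda>n t. cnj (phit n t))"
    by (rule admissible_pairs_cnj[OF assms(6) Tt_mem Tt_cmult adj])
  \<comment> \<open>Conjugation maps the kernel of the adjoint into that of
    \<open>Tt\<close>.\<close>
  have kA: "hnorm ?H u = 0" if "(u, \<lambda>t. 0 * u t) \<in> ?A" for u
  proof -
    have "(\<lambda>t. cnj (u t), \<lambda>t. 0 * cnj (u t)) \<in> Tt" using that unfolding adj by simp
    then have "hnorm ?H (\<lambda>t. cnj (u t)) = 0" by (rule kT)
    then show ?thesis by (simp add: hnorm_L2_std)
  qed
  \<comment> \<open>The adjoint of \<open>Tr\<close> is reached by transporting the adjoint relation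
    itself, so its domain never has to be computed on the annulus.\<close>
  interpret isometry ?H ?K False tau \<rho> \<delta> by (rule isometry_L2)
  interpret O: op_transport ?H ?K False tau \<rho> \<delta> Tt Tr "\<delta>\<^sup>2"
    by unfold_locales
       (use delta_pos Tt_mem Tt_cmult T_op_iff in \<open>auto simp: Q_push L2_ip_recip cnj_if_const\<close>)
  have 3: "basis_properties r1 r2 ?B (\<lambda>n. of_real (1 / \<delta>\<^sup>2) * nut n) (\<lambda>n. pull r1 r2 (chit n))
      (\<lambda>n. 1 / \<delta>\<^sup>2 * mu_tilde n) (\<lambda>n. pull r1 r2 (psi_tilde n))"
    if adm: "admissible_pairs ?A nut chit" for nut chit
  proof (rule basis_properties_transport[OF adm])
    show "u \<in> L2 0 pi \<and> f \<in> L2 0 pi" if "(u, f) \<in> ?A" for u f using that by (simp add: adjoint_op_def)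
    show "(\<lambda>t. c * u t, \<lambda>t. c * f t) \<in> ?A" if "(u, f) \<in> ?A" for u f c
      by (rule L2s.adjoint_cmult[OF _ that]) (simp add: Tt_mem)
    show "(u, f) \<in> ?B \<longleftrightarrow> (push r1 r2 u, \<lambda>t. of_real (\<delta>\<^sup>2) * push r1 r2 f t) \<in> ?A" for u f
      using O.adjoint_transport[of u f] by (simp only: Q_push)
    show "nut n \<noteq> 0" for n by (rule no_zero[OF adm kA])
  qed
  show ?thesis using 1 2 3 by blast
qed

end
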